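(* Let $d\ge 1$ and let $S$ be a finite symmetric generating set of $\mathbb{Z}^d$. For any function $f:\mathbb{Z}^d\to\mathbb{R}$ that is asymptotically homogeneous of order $k$, $$\lim_{n\to\infty}\frac{1}{|B_n|}\sum_{\mathsf{x}\in B_n}\frac{1}{n^k} f(\mathsf{x}) = \left(\frac{d}{d+k}\right)\lim_{n\to\infty}\frac{1}{|S_n|}\sum_{\mathsf{x}\in S_n}\frac{1}{n^k} f(\mathsf{x}).$$ That is, if $f\sim g$ with $g$ homogeneous of order $k$, the coefficients of growth for sphere averages and ball averages are related by $V_{g,S}=\left(\frac{d}{d+k}\right)v_{g,S}$.
   Context: Symmetric means $S=-S$. The word length $|\mathsf{w}|$ of $\mathsf{w}\in\mathbb{Z}^d$ is the minimal number of elements of $S$ (with repetition) summing to $\mathsf{w}$; $S_n=\{\mathsf{w}: |\mathsf{w}|=n\}$, $B_n=\{\mathsf{w}: |\mathsf{w}|\le n\}$, and $|S_n|,|B_n|$ are their cardinalities. A function $g:\mathbb{R}^d\to\mathbb{R}$ is homogeneous of order $k$ if $g(a\mathsf{x})=a^k g(\mathsf{x})$ for all $a\ge 0$ and all $\mathsf{x}$. A function $f:\mathbb{Z}^d\to\mathbb{R}$ is asymptotically homogeneous of order $k$ if there is $g:\mathbb{R}^d\to\mathbb{R}$ homogeneous of order $k$ with $f\sim g$, i.e. $f(\mathsf{x})/g(\mathsf{x})\to 1$ as $\mathsf{x}\to\infty$ in $\mathbb{Z}^d$. Let $Q$ be the convex hull of $S$ in $\mathbb{R}^d$ and $L=\partial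 Q$. The cone measure on $L$ is $\mu_L(A)=\mathrm{Vol}(\hat A)/\mathrm{Vol}(Q)$, where $\hat A=\{t\mathsf{x}:0\le t\le 1,\ \mathsf{x}\in A\}$ and $\mathrm{Vol}$ is Lebesgue measure. The coefficients are $v_{g,S}=\int_L g\,d\mu_L$ (coefficient of $n^k$ in the average of $f$ over $S_n$) and $V_{g,S}=\frac{1}{\mathrm{Vol}(Q)}\int_Q g\,d\mathrm{Vol}$ (coefficient of $n^k$ in the average of $f$ over $B_n$).
   Formalization: For arbitrary homogeneous g the limits may fail to exist; proved: if the sphere limit exists, the ball limit exists and is d/(d+k) times it; if g is continuous away from 0, both limits exist and equal v and V; V = d/(d+k) v holds for every g. The order k is taken to be at least 0. *)

theory Defs
  imports "HOL-Analysis.Analysis" "HOL-Library.Landau_Symbols"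
    "HOL-Computational_Algebra.Group_Closure"
begin

definition of_int_vec :: "int ^ 'n \<Rightarrow> real ^ 'n" where
  "of_int_vec w = (\<chi> i. of_int (w $ i))"

definition symmetric_generating_set :: "(int ^ 'n) set \<Rightarrow> bool" where
  "symmetric_generating_set S \<longleftrightarrow> S = uminus ` S \<and> group_closure S = UNIV"

definition word_length :: "(int ^ 'n) set \<Rightarrow> int ^ 'n \<Rightarrow> nat" where
  "word_length S w = (LEAST n. \<exists>ws. set ws \<subseteq> S \<and> length ws = n \<and> sum_list ws = w)"

definition word_sphere :: "(int ^ 'n) set \<Rightarrow> nat \<Rightarrow> (int ^ 'n) set" where
  "word_sphere S n = {w. word_length S w = n}"

definition word_ball :: "(int ^ 'n) set \<Rightarrow> nat \<Rightarrow> (int ^ 'n) set" where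
  "word_ball S n = {w. word_length S w \<le> n}"

definition scaled_average :: "real \<Rightarrow> (int ^ 'n \<Rightarrow> real) \<Rightarrow> (nat \<Rightarrow> (int ^ 'n) set) \<Rightarrow> nat \<Rightarrow> real" where
  "scaled_average k f A n =
     1 / real (card (A n)) * (\<Sum>x\<in>A n. 1 / (real n powr k) * f x)"

text \<open>
  Homogeneity of real order \<open>k \<ge> 0\<close>. In HOL \<open>0 powr 0 = 0\<close>, so the instance
  \<open>a = k = 0\<close> is left out: it would force \<open>g 0 = 0\<close> and exclude nonzero constants, while
  the other convention \<open>0\<^sup>0 = 1\<close> would leave only constants as functions of order 0.
  For \<open>k > 0\<close> nothing is left out.
\<close>
definition homogeneous :: "real \<Rightarrow> (real ^ 'n \<Rightarrow> real) \<Rightarrow> bool" where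
  "homogeneous k g \<longleftrightarrow>
     (\<forall>a x. a \<ge> 0 \<and> (a \<noteq> 0 \<or> k \<noteq> 0) \<longrightarrow> g (a *\<^sub>R x) = a powr k * g x)"

text \<open>
  \<open>f(x)/g(x)\<close> tends to 1 as \<open>x\<close> tends to infinity in the lattice; neighbourhoods
  of infinity in a lattice are the cofinite sets. The relation of
  \<^theory>\<open>HOL-Library.Landau_Symbols\<close> reads \<open>0/0\<close> as 1, so that \<open>g\<close> may vanish at
  lattice points where \<open>f\<close> does.
\<close>
definition asymptotic_to :: "(int ^ 'n \<Rightarrow> real) \<Rightarrow> (real ^ 'n \<Rightarrow> real) \<Rightarrow> bool" where
  "asymptotic_to f g \<longleftrightarrow> f \<sim>[cofinite] (\<lambda>x. g (of_int_vec x))"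

definition hull_of :: "(int ^ 'n) set \<Rightarrow> (real ^ 'n) set" where
  "hull_of S = convex hull (of_int_vec ` S)"

definition cone_hat :: "(real ^ 'n) set \<Rightarrow> (real ^ 'n) set" where
  "cone_hat A = {t *\<^sub>R x | t x. 0 \<le> t \<and> t \<le> 1 \<and> x \<in> A}"

text \<open>
  The cone measure on the boundary of \<open>Q\<close>; a set is measurable if the cone over it is
  Lebesgue measurable. For \<open>Q\<close> a convex body with 0 in its interior these sets form a
  sigma-algebra, on which the given set function is a probability measure.
\<close>
definition cone_measure :: "(real ^ 'n) set \<Rightarrow> (real ^ 'n) measure" where
  "cone_measure Q =
     measure_of (frontier Q) {A. A \<subseteq> frontier Q \<and> cone_hat A \<in> sets lebesgue}
       (\<lambda>A. emeasure lebesgue (cone_hat A) / emeasure lebesgue Q)"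

definition sphere_coeff :: "(real ^ 'n \<Rightarrow> real) \<Rightarrow> (int ^ 'n) set \<Rightarrow> real" where
  "sphere_coeff g S = (LINT x|cone_measure (hull_of S). g x)"

definition ball_coeff :: "(real ^ 'n \<Rightarrow> real) \<Rightarrow> (int ^ 'n) set \<Rightarrow> real" where
  "ball_coeff g S =
     1 / measure lebesgue (hull_of S) * (LINT x:hull_of S|lebesgue. g x)"

end

theory Submission
  imports Defs
begin

text \<open>
  Let \<open>p\<close> be the gauge of \<open>Q\<close>. The word length of \<open>w\<close> lies between \<open>p w\<close> and \<open>p w + K\<close>, so sums over
  unions of \<open>M\<close> consecutive word spheres agree with integrals over shells of \<open>p\<close> up to an error
  independent of \<open>M\<close>. To pass to single spheres, decompose space by the hyperplanes spanned by
  elements of \<open>S\<close>: away from these walls, a direction lies in the open cone over a basis of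
  generators contained in one facet of \<open>Q\<close>, and deep inside this cone adding a generator of the
  basis increases the word length by exactly one. This gives a nearly defined injection from each
  sphere to the next that hardly changes directions, so sphere sums of a nonnegative function of
  the direction are almost increasing, and a Tauberian argument yields their asymptotics.
  Summing the sphere sums gives the ball averages. The relation between the coefficients holds
  because, for a cone \<open>C\<close> in \<open>Q\<close>, scaling determines the integral of \<open>p\<^sup>k\<close> over \<open>C\<close> from the volume of \<open>C\<close>.
\<close>

subsection \<open>Minkowski gauge\<close>

text \<open>The thickness of a word sphere, measured by the gauge, is of the size of the error
  \<open>K\<close> itself, so volume alone cannot control a single sphere: its count could still
  oscillate with \<open>n\<close>. Near monotonicity excludes this, since the terms of an
  oscillating sequence would have to drop inside some window. Word length need not agree with the
  gauge even inside the cone over a facet; only its increments along generators of that facet are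
  known, and only at sufficient depth. Hence a neighbourhood of the walls of fixed width is
  discarded. Seen from the origin its angle shrinks like \<open>1/n\<close>, so it holds few points
  of the sphere of radius \<open>n\<close>. Functions of the direction suffice: on that sphere,
  \<open>f\<close> divided by \<open>n^k\<close> is uniformly close to such a function when
  \<open>g\<close> is continuous off the origin, and the mean of that function over \<open>Q\<close>
  is its integral against the cone measure.\<close>

definition gauge_fun :: "'a::real_normed_vector set \<Rightarrow> 'a \<Rightarrow> real" where
  "gauge_fun Q x = Inf {t. 0 < t \<and> (1 / t) *\<^sub>R x \<in> Q}"

locale sym_convex_body =
  fixes Q :: "'a::euclidean_space set"
  assumes compact: "compact Q" and convex: "convex Q" and zero_interior: "0 \<in> interior Q"
    and uminus_mem: "x \<in> Q \<Longrightarrow> - x \<in> Q"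
begin

abbreviation p :: "'a \<Rightarrow> real" where "p \<equiv> gauge_fun Q"

lemma closed: "closed Q" using compact by (rule compact_imp_closed)

lemma zero_mem: "0 \<in> Q" using zero_interior interior_subset by blast

lemma scale_mem: "c *\<^sub>R x \<in> Q" if "x \<in> Q" "0 \<le> c" "c \<le> 1"
  using convexD[OF convex that(1) zero_mem, of c "1 - c"] that by simp

lemma inner_radius: obtains r where "0 < r" "\<And>x. norm x \<le> r \<Longrightarrow> x \<in> Q"
proof -
  obtain r where "r > 0" "cball 0 r \<subseteq> Q"
    using zero_interior mem_interior_cball by blast
  thus ?thesis by (intro that[of r]) (auto simp: subset_iff)
qed

lemma outer_radius: obtains R where "0 < R" "\<And>x. x \<in> Q \<Longrightarrow> norm x \<le> R"
  using compact_imp_bounded[OF compact] by (auto simp: bounded_pos)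

text \<open>\<open>Q\<close> is star-shaped about 0 and closed, so the admissible \<open>t\<close>
  form an interval that contains its infimum unless this is 0. The later facts on the gauge are read
  off from this equivalence.\<close>

lemma gauge_le_iff: assumes "0 < t" shows "p x \<le> t \<longleftrightarrow> (1 / t) *\<^sub>R x \<in> Q"
proof
  let ?A = "{t. 0 < t \<and> (1 / t) *\<^sub>R x \<in> Q}"
  have bdd: "bdd_below ?A" by (auto intro!: bdd_belowI[of _ 0])
  show "p x \<le> t" if "(1 / t) *\<^sub>R x \<in> Q"
    unfolding gauge_fun_def using assms that by (intro cInf_lower bdd) auto
  assume le: "p x \<le> t"
  have ne: "?A \<noteq> {}"
  proof -
    obtain r where r: "0 < r" "\<And>x. norm x \<le> r \<Longrightarrow> x \<in> Q" using inner_radius by blast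
    define t where "t = (norm x + 1) / r"
    have "t > 0" using r by (simp add: t_def add_nonneg_pos)
    moreover have "norm ((1/t) *\<^sub>R x) \<le> r"
      using r \<open>t > 0\<close> by (simp add: t_def field_simps add_nonneg_pos)
    ultimately show ?thesis using r by blast
  qed
  have above: "(1 / u) *\<^sub>R x \<in> Q" if less: "p x < u" for u
  proof -
    obtain s where s: "s \<in> ?A" "s < u"
      using less cInf_lessD[OF ne] unfolding gauge_fun_def by blast
    have "(s/u) *\<^sub>R ((1 / s) *\<^sub>R x) \<in> Q" using s by (simp add: scale_mem del: scaleR_scaleR)
    thus ?thesis using s by simp
  qed
  have "(\<lambda>n. (1 / (t + 1 / real (Suc n))) *\<^sub>R x) \<longlonglongrightarrow> (1 / (t + 0)) *\<^sub>R x"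
    using assms LIMSEQ_inverse_real_of_nat
    by (intro tendsto_intros) (auto simp: inverse_eq_divide)
  moreover have "(1 / (t + 1 / real (Suc n))) *\<^sub>R x \<in> Q" for n
    using le by (intro above) (simp add: add_strict_increasing2 less_eq_real_def le_less_trans)
  ultimately show "(1 / t) *\<^sub>R x \<in> Q"
    using closed_sequentially[OF closed] by (metis (lifting) add_0_right)
qed

lemma gauge_nonneg [simp]: "0 \<le> p x"
proof (rule ccontr)
  assume "\<not> ?thesis"
  hence *: "p x < 0" by simp
  have mem: "(1 / t) *\<^sub>R x \<in> Q" if "t > 0" for t using gauge_le_iff[OF that, of x] that * by simp
  have "p x \<ge> 0" unfolding gauge_fun_def
    using mem[of 1] by (intro cInf_greatest) (auto intro: exI[of _ 1])
  thus False using * by simp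
qed

lemma gauge_eqI: assumes "\<And>t. t > 0 \<Longrightarrow> p x \<le> t \<longleftrightarrow> y \<le> t" "0 \<le> y" shows "p x = y"
proof (rule antisym)
  show "p x \<le> y"
  proof (rule dense_ge)
    fix z assume "y < z" thus "p x \<le> z" using assms by simp
  qed
  show "y \<le> p x"
  proof (rule dense_ge)
    fix z assume "p x < z" thus "y \<le> z"
      using assms(1)[of z] gauge_nonneg[of x] by linarith
  qed
qed

lemma gauge_zero [simp]: "p 0 = 0"
  by (rule gauge_eqI) (auto simp: gauge_le_iff zero_mem)

lemma gauge_scale: assumes "0 \<le> c" shows "p (c *\<^sub>R x) = c * p x"
proof (cases "c = 0")
  case False
  hence c: "c > 0" using assms by simp
  show ?thesis
  proof (rule gauge_eqI)
    fix t :: real assume t: "t > 0"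
    have "p (c *\<^sub>R x) \<le> t \<longleftrightarrow> p x \<le> t / c"
      using t c by (simp add: gauge_le_iff)
    thus "(p (c *\<^sub>R x) \<le> t) = (c * p x \<le> t)" using c by (simp add: field_simps)
  qed (use c in auto)
qed simp

lemma gauge_add: "p (x + y) \<le> p x + p y"
proof (rule field_le_epsilon)
  fix e :: real assume e: "e > 0"
  define s t where "s = p x + e/2" and "t = p y + e/2"
  have st: "s > 0" "t > 0" using e by (auto simp: s_def t_def add_nonneg_pos)
  have "(1/s) *\<^sub>R x \<in> Q" "(1/t) *\<^sub>R y \<in> Q"
    using e st by (simp_all add: gauge_le_iff[symmetric] s_def t_def)
  hence "(s/(s+t)) *\<^sub>R ((1/s) *\<^sub>R x) + (t/(s+t)) *\<^sub>R ((1/t) *\<^sub>R y) \<in> Q"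
    using st by (intro convexD[OF convex]) (auto simp: add_divide_distrib[symmetric])
  hence "(1/(s+t)) *\<^sub>R (x+y) \<in> Q" using st by (simp add: scaleR_add_right)
  hence "p (x+y) \<le> s + t" using st by (simp add: gauge_le_iff)
  thus "p (x+y) \<le> p x + p y + e" by (simp add: s_def t_def)
qed

lemma uminus_mem_iff [simp]: "- x \<in> Q \<longleftrightarrow> x \<in> Q"
  using uminus_mem[of x] uminus_mem[of "-x"] by auto

lemma gauge_minus [simp]: "p (- x) = p x"
  by (rule gauge_eqI) (auto simp: gauge_le_iff)

lemma gauge_triangle: "\<bar>p x - p y\<bar> \<le> p (x - y)"
  using gauge_add[of "x - y" y] gauge_add[of "y - x" x] gauge_minus[of "x - y"] by simp

lemma gauge_norm_bounds: obtains r R where "0 < r" "0 < R"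
    "\<And>x. p x \<le> R * norm x" "\<And>x. norm x \<le> r * p x"
proof -
  obtain r where r: "0 < r" "\<And>x. norm x \<le> r \<Longrightarrow> x \<in> Q" using inner_radius by blast
  obtain R where R: "0 < R" "\<And>x. x \<in> Q \<Longrightarrow> norm x \<le> R" using outer_radius by blast
  have 1: "p x \<le> 1/r * norm x" for x
  proof (cases "x = 0")
    case False
    hence "(1 / (1/r * norm x)) *\<^sub>R x \<in> Q" using r by (intro r(2)) simp
    thus ?thesis using False r by (subst gauge_le_iff) auto
  qed simp
  have 2: "norm x \<le> R * p x" for x
  proof -
    have "norm x / R \<le> p x"
    proof (rule dense_ge)
      fix t assume t: "p x < t"
      hence t0: "t > 0" using gauge_nonneg[of x] by linarith
      have "(1/t) *\<^sub>R x \<in> Q" using t gauge_le_iff[OF t0, of x] by simp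
      from R(2)[OF this] show "norm x / R \<le> t" using t0 R(1) by (simp add: field_simps)
    qed
    thus ?thesis using R by (simp add: field_simps)
  qed
  show ?thesis using that[of R "1/r"] 1 2 r R by simp
qed

lemma gauge_eq_0_iff [simp]: "p x = 0 \<longleftrightarrow> x = 0"
  using gauge_norm_bounds[of "x = 0"] by (metis gauge_zero mult_zero_right norm_le_zero_iff)

lemma gauge_pos_iff [simp]: "0 < p x \<longleftrightarrow> x \<noteq> 0"
  using gauge_nonneg[of x] gauge_eq_0_iff[of x] by linarith

lemma continuous_gauge: "continuous_on A p"
proof -
  obtain r R where R: "0 < r" "0 < R" "\<And>x. p x \<le> R * norm x" "\<And>x. norm x \<le> r * p x"
    using gauge_norm_bounds by blast
  have "R-lipschitz_on UNIV p"
    by (rule lipschitz_onI) (use R gauge_triangle order_trans in \<open>auto simp: dist_norm, blast\<close>)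
  thus ?thesis using lipschitz_on_continuous_on continuous_on_subset by blast
qed

lemma mem_iff: "x \<in> Q \<longleftrightarrow> p x \<le> 1"
  by (simp add: gauge_le_iff)

text \<open>The set \<open>p x < 1\<close> is open and inside \<open>Q\<close>, so it misses the
  frontier. At \<open>p x = 1\<close> no ball fits in \<open>Q\<close>, since a small radial step
  outwards makes the gauge exceed 1.\<close>

lemma frontier_eq: "frontier Q = {x. p x = 1}"
proof -
  have "{x. p x < 1} \<subseteq> interior Q"
    by (rule interior_maximal) (auto simp: mem_iff intro!: open_Collect_less continuous_gauge)
  moreover have "p x \<noteq> 1" if x: "x \<in> interior Q" for x
  proof
    assume px: "p x = 1"
    obtain e where e: "e > 0" "cball x e \<subseteq> Q" using x mem_interior_cball by blast
    have nx: "norm x > 0" using px by auto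
    have "dist x ((1 + e / norm x) *\<^sub>R x) = e"
      using e nx by (simp add: dist_norm scaleR_add_left)
    hence "p ((1 + e / norm x) *\<^sub>R x) \<le> 1" using e mem_iff by force
    moreover have "1 + e / norm x > 1" using e nx by simp
    ultimately show False using px by (simp add: gauge_scale)
  qed
  ultimately show ?thesis
    using closed mem_iff interior_subset[of Q]
    by (auto simp: frontier_def) (force simp: less_le)+
qed

lemma gauge_radial: "x \<noteq> 0 \<Longrightarrow> p ((1 / p x) *\<^sub>R x) = 1"
  by (simp add: gauge_scale)

end

subsection \<open>Homogeneous integrals over cones\<close>

lemma integral_lebesgue_scale:
  fixes F :: "'a::euclidean_space \<Rightarrow> real"
  assumes F [measurable]: "F \<in> borel_measurable lebesgue" and s: "0 < s"
  shows "integral\<^sup>L lebesgue F = s ^ DIM('a) * (LINT y|lebesgue. F (s *\<^sub>R y))"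
proof -
  let ?T = "(*\<^sub>R) s :: 'a \<Rightarrow> 'a"
  have T: "(\<lambda>x. 0 + (\<Sum>j\<in>Basis. (s * (x \<bullet> j)) *\<^sub>R j)) = ?T"
    by (auto simp: fun_eq_iff euclidean_representation scaleR_scaleR[symmetric] scaleR_sum_right[symmetric]
        simp del: scaleR_scaleR)
  have m: "?T \<in> lebesgue \<rightarrow>\<^sub>M lebesgue" by (rule lebesgue_measurable_scaling)
  have "(lebesgue :: 'a measure) = density (distr lebesgue lebesgue ?T) (\<lambda>_. s ^ DIM('a))"
    using lebesgue_affine_euclidean[of "\<lambda>_. s" "0::'a"] s unfolding T by simp
  hence "integral\<^sup>L lebesgue F = integral\<^sup>L (density (distr lebesgue lebesgue ?T) (\<lambda>_. s ^ DIM('a))) F"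
    by simp
  also have "\<dots> = s ^ DIM('a) * integral\<^sup>L (distr lebesgue lebesgue ?T) F"
    using s by (subst integral_density) auto
  also have "integral\<^sup>L (distr lebesgue lebesgue ?T) F = (LINT y|lebesgue. F (s *\<^sub>R y))"
    by (rule integral_distr[OF m F])
  finally show ?thesis .
qed

text \<open>This is the derivative of \<open>s powr a\<close> at 1. It gives the relative volume of
  thin shells, and later the increments of \<open>real n powr (r + 1)\<close>.\<close>

lemma tendsto_powr_quotient: "((\<lambda>s::real. (1 - s powr a) / (1 - s)) \<longlongrightarrow> a) (at_left 1)"
proof -
  have "((\<lambda>s. s powr a) has_real_derivative a * 1 powr (a - 1) * 1) (at 1)"
    by (auto intro!: derivative_eq_intros)
  hence "((\<lambda>s. (s powr a - 1 powr a) / (s - 1)) \<longlongrightarrow> a) (at (1::real))"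
    by (simp add: has_field_derivative_iff)
  hence "((\<lambda>s. (s powr a - 1 powr a) / (s - 1)) \<longlongrightarrow> a) (at_left (1::real))"
    by (rule filterlim_mono) (auto simp: at_within_le_at)
  moreover have "(s powr a - 1 powr a) / (s - 1) = (1 - s powr a) / (1 - s)" for s :: real
    by (metis minus_diff_eq minus_divide_divide powr_one_eq_one)
  ultimately show ?thesis by simp
qed

context sym_convex_body
begin

lemma Q_lmeasurable [simp]: "Q \<in> lmeasurable"
  by (rule lmeasurable_compact[OF compact])

lemma sets_Q [measurable, simp]: "Q \<in> sets lebesgue"
  using Q_lmeasurable by blast

lemma volume_pos: "0 < measure lebesgue Q"
proof -
  obtain r where r: "0 < r" "\<And>x. norm x \<le> r \<Longrightarrow> x \<in> Q" using inner_radius by blast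
  have "0 < measure lebesgue (cball (0::'a) r)" using content_cball_pos[OF r(1)] by simp
  also have "\<dots> \<le> measure lebesgue Q"
    using r by (intro measure_mono_fmeasurable) auto
  finally show ?thesis .
qed

lemma measurable_gauge [measurable]: "p \<in> borel_measurable lebesgue"
  by (intro measurable_completion) (auto intro!: borel_measurable_continuous_onI continuous_gauge)

lemma integrable_bounded_on_Q:
  fixes F :: "'a \<Rightarrow> real"
  assumes "F \<in> borel_measurable lebesgue" "\<And>x. x \<notin> Q \<Longrightarrow> F x = 0" "\<And>x. \<bar>F x\<bar> \<le> B"
  shows "integrable lebesgue F"
proof (rule Bochner_Integration.integrable_bound)
  show "integrable lebesgue (\<lambda>x. B * indicator Q x)"
    using Q_lmeasurable by (simp add: fmeasurable_def)
  show "AE x in lebesgue. norm (F x) \<le> norm (B * indicator Q x)"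
    using assms by (auto simp: indicator_def intro: order_trans[OF _ abs_ge_self])
qed fact

text \<open>Scaling by s evaluates the integral over the part \<open>p \<le> s\<close> of a truncated cone; comparing
  the integrals of \<open>p\<^sup>k\<close> and of 1 over the remaining thin layer and letting s tend to 1
  replaces polar coordinates.\<close>
lemma integral_gauge_powr_cone:
  assumes C [measurable]: "C \<in> sets lebesgue" and CQ: "C \<subseteq> Q - {0}"
    and scale: "\<And>x t. x \<in> C \<Longrightarrow> 0 < t \<Longrightarrow> p (t *\<^sub>R x) \<le> 1 \<Longrightarrow> t *\<^sub>R x \<in> C"
    and k: "0 \<le> k"
  shows "(LINT x|lebesgue. indicator C x * p x powr k) =
    real DIM('a) / (real DIM('a) + k) * measure lebesgue C"
proof -
  define J where "J k = (LINT x|lebesgue. indicator C x * p x powr k)" for k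
  define X where "X s k = (LINT x|lebesgue. indicator {x\<in>C. s < p x} x * p x powr k)" for s k
  let ?d = "real DIM('a)"
  have le1: "p x \<le> 1" if "x \<in> C" for x using that CQ mem_iff by auto
  have pos: "0 < p x" if "x \<in> C" for x using that CQ by auto
  have powr_le1: "p x powr k \<le> 1" if "x \<in> C" "0 \<le> k" for x k
    using that le1[of x] pos[of x] powr_mono2[of k "p x" 1] by simp
  have int: "integrable lebesgue (\<lambda>x. indicator C x * p x powr k)" if "0 \<le> k" for k
    using that CQ powr_le1 by (intro integrable_bounded_on_Q[of _ 1]) (auto simp: indicator_def)
  have int_layer: "integrable lebesgue (\<lambda>x. indicator {x\<in>C. s < p x} x * p x powr k)" if "0 \<le> k" for s k
    using that CQ powr_le1 by (intro integrable_bounded_on_Q[of _ 1]) (auto simp: indicator_def)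
  have layer: "X s k = (1 - s powr (?d + k)) * J k" if s: "0 < s" "s < 1" and k: "0 \<le> k" for s k
  proof -
    let ?F = "\<lambda>y. indicator {x\<in>C. p x \<le> s} y * p y powr k"
    have scaled: "s *\<^sub>R x \<in> C \<and> p (s *\<^sub>R x) \<le> s \<longleftrightarrow> x \<in> C" for x
    proof
      assume "x \<in> C"
      thus "s *\<^sub>R x \<in> C \<and> p (s *\<^sub>R x) \<le> s"
        using scale[of x s] s le1[of x] mult_mono[of s 1 "p x" 1] by (simp add: gauge_scale)
    next
      assume *: "s *\<^sub>R x \<in> C \<and> p (s *\<^sub>R x) \<le> s"
      hence "p x \<le> 1" using s by (simp add: gauge_scale)
      thus "x \<in> C" using scale[of "s *\<^sub>R x" "1/s"] * s by simp
    qed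
    have "(LINT y|lebesgue. ?F y) = s ^ DIM('a) * (LINT y|lebesgue. ?F (s *\<^sub>R y))"
      by (rule integral_lebesgue_scale) (use s in auto)
    also have "(\<lambda>y. ?F (s *\<^sub>R y)) = (\<lambda>y. s powr k * (indicator C y * p y powr k))"
      using scaled s by (auto simp: fun_eq_iff indicator_def gauge_scale powr_mult)
    finally have "(LINT y|lebesgue. ?F y) = s powr (?d + k) * J k"
      using s by (simp add: J_def powr_add powr_realpow)
    moreover have "J k = (LINT y|lebesgue. ?F y + indicator {x\<in>C. s < p x} y * p y powr k)"
      unfolding J_def by (intro Bochner_Integration.integral_cong) (auto simp: indicator_def)
    moreover have "\<dots> = (LINT y|lebesgue. ?F y) + X s k"
      unfolding X_def using k CQ powr_le1
      by (intro Bochner_Integration.integral_add int_layer integrable_bounded_on_Q[of _ 1])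
         (auto simp: indicator_def)
    ultimately show ?thesis by (simp add: algebra_simps)
  qed
  have lower: "s powr k * ((1 - s powr ?d) * J 0) \<le> (1 - s powr (?d + k)) * J k" (is ?l)
    and upper: "(1 - s powr (?d + k)) * J k \<le> (1 - s powr ?d) * J 0" (is ?u)
    if s: "0 < s" "s < 1" for s
  proof -
    have "s powr k * X s 0 \<le> X s k"
      unfolding X_def integral_mult_right_zero[symmetric]
      using s k by (intro integral_mono int_layer integrable_mult_right)
        (auto simp: indicator_def intro!: powr_mono2)
    moreover have "X s k \<le> X s 0"
      unfolding X_def using k powr_le1 by (intro integral_mono int_layer) (auto simp: indicator_def)
    ultimately show ?l ?u using layer[OF s k] layer[OF s, of 0] by simp_all
  qed
  have near: "\<forall>\<^sub>F s in at_left (1::real). 0 < s \<and> s < 1"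
    by (rule eventually_at_leftI[of 0]) auto
  have lim: "((\<lambda>s. (1 - s powr a) / (1 - s) * c) \<longlongrightarrow> a * c) (at_left (1::real))" for a c
    by (rule tendsto_mult[OF tendsto_powr_quotient tendsto_const])
  have "(?d + k) * J k \<le> ?d * J 0"
  proof (rule tendsto_le[OF _ lim lim])
    show "\<forall>\<^sub>F s in at_left (1::real).
        (1 - s powr (?d + k)) / (1 - s) * J k \<le> (1 - s powr ?d) / (1 - s) * J 0"
      using near
    proof eventually_elim
      case (elim s)
      thus ?case using divide_right_mono[OF upper[of s], of "1 - s"] by simp
    qed
  qed simp
  moreover have "1 * (?d * J 0) \<le> (?d + k) * J k"
  proof (rule tendsto_le[OF _ lim tendsto_mult[OF _ lim]])
    show "((\<lambda>s. s powr k) \<longlongrightarrow> 1) (at_left (1::real))"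
    proof -
      have "((\<lambda>s. s powr k) \<longlongrightarrow> 1 powr k) (at_left (1::real))"
        by (intro tendsto_powr tendsto_ident_at tendsto_const) simp
      thus ?thesis by simp
    qed
    show "\<forall>\<^sub>F s in at_left (1::real).
        s powr k * ((1 - s powr ?d) / (1 - s) * J 0) \<le> (1 - s powr (?d + k)) / (1 - s) * J k"
      using near
    proof eventually_elim
      case (elim s)
      thus ?case using divide_right_mono[OF lower[of s], of "1 - s"] by simp
    qed
  qed simp
  moreover have "J 0 = measure lebesgue C"
  proof -
    have "J 0 = (LINT x|lebesgue. indicator C x)"
      unfolding J_def using CQ by (intro Bochner_Integration.integral_cong) (auto simp: indicator_def)
    thus ?thesis by simp
  qed
  ultimately have "(?d + k) * J k = ?d * measure lebesgue C" by simp
  moreover have "?d + k > 0" using k by (simp add: add_pos_nonneg)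
  ultimately show ?thesis by (simp add: J_def field_simps)
qed

end

subsection \<open>Cone measure\<close>

text \<open>Changing one value preserves measurability in both directions, and two non-measurable
  functions both have integral 0 by convention. This form allows the origin to be removed for an
  arbitrary homogeneous \<open>g\<close>, whose value there is free when
  \<open>k = 0\<close>.\<close>

lemma integral_cong_except_point:
  fixes F G :: "'a::euclidean_space \<Rightarrow> real"
  assumes eq: "\<And>x. x \<noteq> a \<Longrightarrow> F x = G x"
  shows "integral\<^sup>L lebesgue F = integral\<^sup>L lebesgue G"
proof -
  have meas: "F' \<in> borel_measurable lebesgue"
    if "G' \<in> borel_measurable lebesgue" "\<And>x. x \<noteq> a \<Longrightarrow> F' x = G' x" for F' G' :: "'a \<Rightarrow> real"
  proof -
    have "(\<lambda>x. G' x + (F' a - G' a) * indicator {a} x) \<in> borel_measurable lebesgue"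
      using that(1) by (intro borel_measurable_add borel_measurable_times borel_measurable_indicator) auto
    also have "(\<lambda>x. G' x + (F' a - G' a) * indicator {a} x) = F'"
      using that(2) by (auto simp: indicator_def fun_eq_iff)
    finally show ?thesis .
  qed
  have AE: "AE x in lebesgue. F x = G x"
    by (rule AE_I'[of "{a}"]) (use eq in auto)
  show ?thesis
  proof (cases "F \<in> borel_measurable lebesgue")
    case True
    thus ?thesis using meas[of F G] eq AE by (intro integral_cong_AE) auto
  next
    case False
    hence "G \<notin> borel_measurable lebesgue" using meas[of G F] eq by blast
    thus ?thesis using False by (metis borel_measurable_integrable not_integrable_integral_eq)
  qed
qed

locale sym_convex_body_vec = sym_convex_body Q for Q :: "(real ^ 'n) set"
begin

definition radial :: "real ^ 'n \<Rightarrow> real ^ 'n" where "radial x = (1 / p x) *\<^sub>R x"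

definition cone_sets :: "(real ^ 'n) set set" where
  "cone_sets = {A. A \<subseteq> frontier Q \<and> cone_hat A \<in> sets lebesgue}"

text \<open>The truncated cone over \<open>A\<close> without its apex. As a preimage under
  \<open>radial\<close> it respects complements, whereas the sets \<open>cone_hat\<close> over
  complementary sets share the apex.\<close>

definition sector :: "(real ^ 'n) set \<Rightarrow> (real ^ 'n) set" where
  "sector A = {x \<in> Q - {0}. radial x \<in> A}"

lemma radial_frontier: "x \<noteq> 0 \<Longrightarrow> radial x \<in> frontier Q"
  by (simp add: radial_def frontier_eq gauge_radial)

lemma radial_scale: "0 < t \<Longrightarrow> radial (t *\<^sub>R x) = radial x"
  by (simp add: radial_def gauge_scale)

lemma cone_hat_sector: assumes "A \<subseteq> frontier Q" shows "cone_hat A - {0} = sector A"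
proof
  show "cone_hat A - {0} \<subseteq> sector A"
  proof
    fix y assume "y \<in> cone_hat A - {0}"
    then obtain t x where y: "y = t *\<^sub>R x" "0 \<le> t" "t \<le> 1" "x \<in> A" "y \<noteq> 0"
      by (auto simp: cone_hat_def)
    hence "0 < t" by (cases "t = 0") auto
    moreover have "p x = 1" using y assms by (auto simp: frontier_eq)
    ultimately show "y \<in> sector A"
      using y by (auto simp: sector_def mem_iff gauge_scale radial_def)
  qed
  show "sector A \<subseteq> cone_hat A - {0}"
  proof
    fix y assume "y \<in> sector A"
    hence "y \<noteq> 0" "p y \<le> 1" "radial y \<in> A" "y = p y *\<^sub>R radial y"
      by (auto simp: sector_def mem_iff radial_def)
    thus "y \<in> cone_hat A - {0}"
      using gauge_nonneg unfolding cone_hat_def by blast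
  qed
qed

lemma sets_sector_iff:
  assumes "A \<subseteq> frontier Q" shows "sector A \<in> sets lebesgue \<longleftrightarrow> cone_hat A \<in> sets lebesgue"
proof -
  \<comment> \<open>The first case is the empty \<open>A\<close>, whose cone lacks the apex.\<close>
  have "cone_hat A = sector A \<or> cone_hat A = insert 0 (sector A)"
    using cone_hat_sector[OF assms] by auto
  moreover have "0 \<notin> sector A" by (simp add: sector_def)
  moreover have "{0 :: real^'n} \<in> sets lebesgue" by simp
  ultimately show ?thesis
    by (metis Diff_insert_absorb insert_is_Un sets.Diff sets.Un)
qed

lemma emeasure_sector:
  assumes "A \<in> cone_sets" shows "emeasure lebesgue (cone_hat A) = emeasure lebesgue (sector A)"
proof -
  have "{0 :: real^'n} \<in> null_sets lebesgue" by simp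
  thus ?thesis
    using assms by (simp add: cone_hat_sector[symmetric] cone_sets_def emeasure_Diff_null_set)
qed

lemma mem_cone_sets_iff: "A \<in> cone_sets \<longleftrightarrow> A \<subseteq> frontier Q \<and> sector A \<in> sets lebesgue"
  using sets_sector_iff by (auto simp: cone_sets_def)

lemma sigma_algebra_cone_sets: "sigma_algebra (frontier Q) cone_sets"
  unfolding sigma_algebra_iff2
proof (intro conjI ballI allI impI)
  show "cone_sets \<subseteq> Pow (frontier Q)" by (auto simp: cone_sets_def)
  have "sector {} = {}" by (auto simp: sector_def)
  thus "{} \<in> cone_sets" by (simp add: mem_cone_sets_iff)
  fix A assume A: "A \<in> cone_sets"
  have "sector (frontier Q - A) = (Q - {0}) - sector A"
    using radial_frontier by (auto simp: sector_def)
  moreover have "Q - {0} \<in> sets lebesgue" by auto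
  ultimately show "frontier Q - A \<in> cone_sets"
    using A by (auto simp: mem_cone_sets_iff)
next
  fix A :: "nat \<Rightarrow> _" assume A: "range A \<subseteq> cone_sets"
  have "sector (\<Union>i. A i) = (\<Union>i. sector (A i))" by (auto simp: sector_def)
  moreover have mem: "A i \<subseteq> frontier Q" "sector (A i) \<in> sets lebesgue" for i
    using A mem_cone_sets_iff[of "A i"] by auto
  moreover have "(\<Union>i. sector (A i)) \<in> sets lebesgue"
    using mem by (intro sets.countable_UN) auto
  ultimately show "(\<Union>i. A i) \<in> cone_sets"
    unfolding mem_cone_sets_iff by (metis UN_least)
qed

text \<open>Only the measurable structure underlying the cone measure, used as the codomain of
  \<open>radial\<close>.\<close>

abbreviation "N \<equiv> sigma (frontier Q) cone_sets"

lemma sets_N: "sets N = cone_sets"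
  using sigma_algebra.sigma_sets_eq[OF sigma_algebra_cone_sets]
  by (subst sets_measure_of) (auto simp: cone_sets_def)

lemma space_N: "space N = frontier Q"
  by (rule space_measure_of) (auto simp: cone_sets_def)

abbreviation "M0 \<equiv> lebesgue_on (Q - {0})"

lemma sets_punctured [measurable, simp]: "Q - {0} \<in> sets lebesgue"
  by auto

lemma vimage_radial: "radial -` A \<inter> (Q - {0}) = sector A"
  by (auto simp: sector_def)

lemma sector_sets_M0: "A \<in> cone_sets \<Longrightarrow> sector A \<in> sets M0"
  by (subst sets_restrict_space_iff) (auto simp: mem_cone_sets_iff sector_def)

lemma measurable_radial: "radial \<in> M0 \<rightarrow>\<^sub>M N"
proof (rule measurableI)
  show "radial x \<in> space N" if "x \<in> space M0" for x
    using that by (simp add: space_N space_restrict_space radial_frontier)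
  show "radial -` A \<inter> space M0 \<in> sets M0" if "A \<in> sets N" for A
    using that by (simp add: vimage_radial sets_N sector_sets_M0)
qed

lemma emeasure_M0: "A \<in> cone_sets \<Longrightarrow> emeasure M0 (sector A) = emeasure lebesgue (sector A)"
  by (rule emeasure_restrict_space) (auto simp: sector_def)

text \<open>The preimage of \<open>A\<close> under \<open>radial\<close> is the sector over
  \<open>A\<close>, which differs from \<open>cone_hat A\<close> by a null set. As image measures
  are countably additive, the set function given to \<open>measure_of\<close> is thereby seen to be
  a measure, and integrals against it can be computed on \<open>Q - {0}\<close>.\<close>

lemma cone_measure_distr:
  "cone_measure Q = distr (density M0 (\<lambda>_. 1 / measure lebesgue Q)) N radial"
proof -
  let ?V = "measure lebesgue Q"
  have "cone_measure Q = measure_of (frontier Q) cone_sets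
      (\<lambda>A. emeasure lebesgue (cone_hat A) / emeasure lebesgue Q)"
    by (simp add: cone_measure_def cone_sets_def)
  also have "\<dots> = measure_of (space N) (sets N)
      (\<lambda>A. emeasure (density M0 (\<lambda>_. ennreal (1 / ?V)))
        (radial -` A \<inter> space (density M0 (\<lambda>_. ennreal (1 / ?V)))))"
    unfolding sets_N space_N
  proof (rule measure_of_eq)
    fix A assume "A \<in> sigma_sets (frontier Q) cone_sets"
    hence A: "A \<in> cone_sets" using sigma_algebra.sigma_sets_eq[OF sigma_algebra_cone_sets] by simp
    have "emeasure (density M0 (\<lambda>_. ennreal (1 / ?V))) (radial -` A \<inter> space M0)
        = ennreal (1 / ?V) * emeasure lebesgue (cone_hat A)"
      using A by (simp add: vimage_radial emeasure_density_const sector_sets_M0 emeasure_M0 emeasure_sector)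
    also have "\<dots> = emeasure lebesgue (cone_hat A) / emeasure lebesgue Q"
    proof -
      have "sector A \<in> lmeasurable"
        using A by (intro fmeasurableI2[OF Q_lmeasurable]) (auto simp: sector_def mem_cone_sets_iff)
      thus ?thesis
        using A volume_pos Q_lmeasurable
        by (simp add: emeasure_sector emeasure_eq_measure2 divide_ennreal ennreal_mult'[symmetric])
    qed
    finally show "emeasure lebesgue (cone_hat A) / emeasure lebesgue Q =
        emeasure (density M0 (\<lambda>_. ennreal (1 / ?V)))
        (radial -` A \<inter> space (density M0 (\<lambda>_. ennreal (1 / ?V))))" by simp
  qed (auto simp: cone_sets_def)
  finally show ?thesis by (simp add: distr_def)
qed

lemma integral_cone_measure:
  fixes F :: "real ^ 'n \<Rightarrow> real"
  assumes F: "F \<in> borel_measurable N"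
  shows "integral\<^sup>L (cone_measure Q) F = 1 / measure lebesgue Q * (LINT x|M0. F (radial x))"
proof -
  have "(\<lambda>x. F (radial x)) \<in> borel_measurable M0"
    using measurable_compose[OF measurable_radial F] .
  thus ?thesis
    unfolding cone_measure_distr using F measurable_radial
    by (subst integral_distr) (auto simp: integral_density)
qed

lemma measurable_powr_gauge: "(\<lambda>x. p x powr k) \<in> borel_measurable M0"
  by (intro measurable_restrict_space1) measurable

text \<open>A sector is stable under the dilations that keep it in \<open>Q\<close>, so
  \<open>integral_gauge_powr_cone\<close> applies to it. Hence weighting by
  \<open>p x powr k\<close> changes all sectors by one factor, independent of the direction.\<close>

lemma emeasure_powr_sector:
  assumes A: "A \<in> cone_sets" and k: "0 \<le> k"
  shows "emeasure (distr (density M0 (\<lambda>x. ennreal (p x powr k))) N radial) A =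
    ennreal (real CARD('n) / (real CARD('n) + k)) * emeasure (distr M0 N radial) A"
proof -
  let ?c = "real CARD('n) / (real CARD('n) + k)"
  have c: "0 \<le> ?c" using k by simp
  have [measurable]: "sector A \<in> sets lebesgue" using A by (simp add: mem_cone_sets_iff)
  have sub: "sector A \<subseteq> Q - {0}" by (auto simp: sector_def)
  hence fin: "sector A \<in> lmeasurable"
    using A by (intro fmeasurableI2[OF Q_lmeasurable]) (auto simp: mem_cone_sets_iff)
  have "emeasure (distr (density M0 (\<lambda>x. ennreal (p x powr k))) N radial) A =
      (\<integral>\<^sup>+x. ennreal (p x powr k) * indicator (sector A) x \<partial>M0)"
    using A measurable_powr_gauge measurable_radial
    by (subst emeasure_distr) (auto simp: sets_N vimage_radial emeasure_density sector_sets_M0)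
  also have "\<dots> = (\<integral>\<^sup>+x. ennreal (indicator (sector A) x * p x powr k) \<partial>lebesgue)"
    by (subst nn_integral_restrict_space)
       (auto intro!: nn_integral_cong simp: indicator_def sector_def)
  also have "\<dots> = ennreal (LINT x|lebesgue. indicator (sector A) x * p x powr k)"
  proof (rule nn_integral_eq_integral)
    show "integrable lebesgue (\<lambda>x. indicator (sector A) x * p x powr k)"
    proof (rule integrable_bounded_on_Q[where B = 1])
      show "(\<lambda>x. indicator (sector A) x * p x powr k) \<in> borel_measurable lebesgue" by measurable
      show "\<bar>indicator (sector A) x * p x powr k\<bar> \<le> 1" for x
        using k powr_mono2[of k "p x" 1] by (auto simp: indicator_def sector_def mem_iff)
    qed (auto simp: sector_def)
  qed auto
  also have "\<dots> = ennreal (?c * measure lebesgue (sector A))"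
  proof -
    have scale: "t *\<^sub>R x \<in> sector A" if "x \<in> sector A" "0 < t" "p (t *\<^sub>R x) \<le> 1" for x t
      using that by (auto simp: sector_def radial_scale mem_iff)
    show ?thesis using integral_gauge_powr_cone[OF _ sub scale k] by simp
  qed
  also have "\<dots> = ennreal ?c * emeasure lebesgue (sector A)"
    using k fin by (simp add: ennreal_mult'[symmetric] emeasure_eq_measure2)
  also have "emeasure lebesgue (sector A) = emeasure (distr M0 N radial) A"
    using A measurable_radial by (simp add: emeasure_distr sets_N vimage_radial emeasure_M0)
  finally show ?thesis .
qed

text \<open>By \<open>emeasure_powr_sector\<close> the two image measures on \<open>N\<close> are
  proportional, and equal measures give equal integrals whether or not \<open>F\<close> is
  integrable.\<close>

lemma integral_powr_radial:
  fixes F :: "real ^ 'n \<Rightarrow> real"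
  assumes F: "F \<in> borel_measurable N" and k: "0 \<le> k"
  shows "(LINT x|M0. p x powr k * F (radial x)) =
    real CARD('n) / (real CARD('n) + k) * (LINT x|M0. F (radial x))"
proof -
  let ?c = "real CARD('n) / (real CARD('n) + k)"
  have c: "0 \<le> ?c" using k by simp
  have "distr (density M0 (\<lambda>x. ennreal (p x powr k))) N radial =
      density (distr M0 N radial) (\<lambda>_. ennreal ?c)"
    by (rule measure_eqI)
       (auto simp: emeasure_density_const emeasure_powr_sector sets_N k)
  hence "integral\<^sup>L (distr (density M0 (\<lambda>x. ennreal (p x powr k))) N radial) F =
      integral\<^sup>L (density (distr M0 N radial) (\<lambda>_. ennreal ?c)) F" by simp
  moreover have m: "(\<lambda>x. F (radial x)) \<in> borel_measurable M0"
    using measurable_compose[OF measurable_radial F] .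
  ultimately show ?thesis
    using F c measurable_radial measurable_powr_gauge[of k]
    by (simp add: integral_distr integral_density)
qed

lemma homogeneous_radial:
  assumes "homogeneous k g" "x \<noteq> 0" shows "g x = p x powr k * g (radial x)"
proof -
  have "g (p x *\<^sub>R radial x) = p x powr k * g (radial x)"
    using assms by (auto simp: homogeneous_def)
  moreover have "p x *\<^sub>R radial x = x" using assms by (simp add: radial_def)
  ultimately show ?thesis by simp
qed

text \<open>A preimage under \<open>F\<close> lies in \<open>cone_sets\<close> exactly when its
  sector, which is the preimage under \<open>F\<close> after \<open>radial\<close>, is measurable.
  The second half transfers non-measurability from the boundary to \<open>Q\<close>.\<close>

lemma borel_measurable_N_iff:
  fixes F :: "real ^ 'n \<Rightarrow> real"
  shows "F \<in> borel_measurable N \<longleftrightarrow> (\<lambda>x. F (radial x)) \<in> borel_measurable M0"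
proof
  assume "F \<in> borel_measurable N"
  thus "(\<lambda>x. F (radial x)) \<in> borel_measurable M0"
    using measurable_compose[OF measurable_radial] by blast
next
  assume *: "(\<lambda>x. F (radial x)) \<in> borel_measurable M0"
  show "F \<in> borel_measurable N"
  proof (rule measurableI)
    fix B :: "real set" assume B: "B \<in> sets borel"
    have "(\<lambda>x. F (radial x)) -` B \<inter> space M0 = sector (F -` B \<inter> space N)"
      using radial_frontier by (auto simp: sector_def space_N space_restrict_space)
    hence "sector (F -` B \<inter> space N) \<in> sets M0" using measurable_sets[OF * B] by simp
    hence "sector (F -` B \<inter> space N) \<in> sets lebesgue" by (simp add: sets_restrict_space_iff)
    thus "F -` B \<inter> space N \<in> sets N" by (simp add: sets_N mem_cone_sets_iff space_N)
  qed simp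
qed

text \<open>If \<open>g\<close> is not measurable on the boundary, then the product of
  \<open>g (radial x)\<close> with the positive weight \<open>p x powr k\<close> is not measurable
  on \<open>Q - {0}\<close>, as division by the weight shows. Both integrals then take the default
  value 0.\<close>

theorem integral_homogeneous:
  assumes g: "homogeneous k g" and k: "0 \<le> k"
  shows "1 / measure lebesgue Q * (LINT x:Q|lebesgue. g x) =
    real CARD('n) / (real CARD('n) + k) * (LINT x|cone_measure Q. g x)"
proof -
  have ball: "(LINT x:Q|lebesgue. g x) = (LINT x|M0. p x powr k * g (radial x))"
  proof -
    have "(LINT x:Q|lebesgue. g x) = (LINT x:Q - {0}|lebesgue. g x)"
      unfolding set_lebesgue_integral_def
      by (rule integral_cong_except_point[of 0]) (simp add: indicator_def)
    also have "\<dots> = (LINT x|M0. g x)"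
      by (simp add: set_lebesgue_integral_def integral_restrict_space)
    also have "\<dots> = (LINT x|M0. p x powr k * g (radial x))"
      by (rule Bochner_Integration.integral_cong)
         (auto simp: space_restrict_space homogeneous_radial[OF g])
    finally show ?thesis .
  qed
  show ?thesis
  proof (cases "g \<in> borel_measurable N")
    case True
    thus ?thesis using ball integral_cone_measure[OF True] integral_powr_radial[OF True k] by simp
  next
    case False
    hence "\<not> integrable (cone_measure Q) g"
      by (auto simp: cone_measure_distr dest!: borel_measurable_integrable)
    moreover have "\<not> integrable M0 (\<lambda>x. p x powr k * g (radial x))"
    proof
      assume "integrable M0 (\<lambda>x. p x powr k * g (radial x))"
      hence "(\<lambda>x. (p x powr k * g (radial x)) / p x powr k) \<in> borel_measurable M0"
        using measurable_powr_gauge by (intro borel_measurable_divide) auto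
      moreover have "(\<lambda>x. (p x powr k * g (radial x)) / p x powr k) \<in> borel_measurable M0 \<longleftrightarrow>
          (\<lambda>x. g (radial x)) \<in> borel_measurable M0"
        by (rule measurable_cong) (auto simp: space_restrict_space)
      ultimately show False using False borel_measurable_N_iff by blast
    qed
    ultimately show ?thesis by (simp add: ball not_integrable_integral_eq)
  qed
qed

end

subsection \<open>Word length and the gauge\<close>

lemma of_int_vec_add: "of_int_vec (x + y) = of_int_vec x + of_int_vec y"
  and of_int_vec_0 [simp]: "of_int_vec 0 = 0"
  and of_int_vec_minus: "of_int_vec (- x) = - of_int_vec x"
  and of_int_vec_diff: "of_int_vec (x - y) = of_int_vec x - of_int_vec y"
  and of_int_vec_scale: "of_int_vec (c *s x) = of_int c *\<^sub>R of_int_vec x"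
  by (simp_all add: of_int_vec_def vec_eq_iff)

lemma of_int_vec_sum: "of_int_vec (\<Sum>i\<in>A. f i) = (\<Sum>i\<in>A. of_int_vec (f i))"
  by (induction A rule: infinite_finite_induct) (auto simp: of_int_vec_add)

lemma inj_of_int_vec: "inj of_int_vec"
  by (auto simp: inj_def of_int_vec_def vec_eq_iff)

lemma of_int_vec_eq_iff [simp]: "of_int_vec x = of_int_vec y \<longleftrightarrow> x = y"
  using inj_of_int_vec by (auto simp: inj_def)

lemma of_int_vec_eq_0_iff [simp]: "of_int_vec x = 0 \<longleftrightarrow> x = 0"
  using of_int_vec_eq_iff[of x 0] by simp

lemma finite_lattice_bounded: "finite {w :: int ^ 'n. norm (of_int_vec w) \<le> r}"
proof (rule finite_subset)
  let ?A = "{- \<lceil>r\<rceil> .. \<lceil>r\<rceil>}"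
  show "{w :: int ^ 'n. norm (of_int_vec w) \<le> r} \<subseteq> vec_lambda ` (PiE UNIV (\<lambda>_. ?A))"
  proof
    fix w :: "int ^ 'n" assume w: "w \<in> {w. norm (of_int_vec w) \<le> r}"
    have "w $ i \<in> ?A" for i
    proof -
      have "\<bar>real_of_int (w $ i)\<bar> \<le> r"
        using component_le_norm_cart[of "of_int_vec w" i] w by (simp add: of_int_vec_def)
      thus ?thesis by (auto simp: abs_le_iff) linarith+
    qed
    hence "vec_nth w \<in> PiE UNIV (\<lambda>_. ?A)" by auto
    thus "w \<in> vec_lambda ` (PiE UNIV (\<lambda>_. ?A))"
      by (intro image_eqI[of _ _ "vec_nth w"]) auto
  qed
  show "finite (vec_lambda ` (PiE (UNIV :: 'n set) (\<lambda>_. ?A)))"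
    by (intro finite_imageI finite_PiE) auto
qed

locale lattice_generators =
  fixes S :: "(int ^ 'n) set"
  assumes finite_S: "finite S" and generating: "symmetric_generating_set S"
begin

abbreviation wl :: "int ^ 'n \<Rightarrow> nat" where "wl \<equiv> word_length S"

lemma uminus_S: "s \<in> S \<Longrightarrow> - s \<in> S"
  using generating by (auto simp: symmetric_generating_set_def)

lemma word_exists: "\<exists>ws. set ws \<subseteq> S \<and> sum_list ws = w"
proof -
  have "w \<in> group_closure S" using generating by (simp add: symmetric_generating_set_def)
  thus ?thesis
  proof induction
    case (base s)
    show ?case
    proof (cases "s = 0")
      case True thus ?thesis by (intro exI[of _ "[]"]) auto
    next
      case False thus ?thesis using base by (intro exI[of _ "[s]"]) auto
    qed
  next
    case (diff s t)
    then obtain ws vs where "set ws \<subseteq> S" "sum_list ws = s" "set vs \<subseteq> S" "sum_list vs = t" by blast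
    moreover have "sum_list (map uminus vs) = - sum_list vs" for vs :: "(int ^ 'n) list"
      by (induction vs) auto
    ultimately show ?case
      by (intro exI[of _ "ws @ map uminus vs"]) (auto intro: uminus_S)
  qed
qed

lemma word_length_le: "set ws \<subseteq> S \<Longrightarrow> wl (sum_list ws) \<le> length ws"
  unfolding word_length_def by (rule Least_le) blast

lemma word_length_attained:
  obtains ws where "set ws \<subseteq> S" "length ws = wl w" "sum_list ws = w"
proof -
  have "\<exists>n ws. set ws \<subseteq> S \<and> length ws = n \<and> sum_list ws = w" using word_exists by blast
  from LeastI_ex[OF this] show ?thesis using that unfolding word_length_def by blast
qed

lemma word_length_0 [simp]: "wl 0 = 0"
  using word_length_le[of "[]"] by simp

lemma word_length_add: "wl (v + w) \<le> wl v + wl w"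
proof -
  obtain vs where vs: "set vs \<subseteq> S" "length vs = wl v" "sum_list vs = v"
    using word_length_attained by blast
  obtain ws where ws: "set ws \<subseteq> S" "length ws = wl w" "sum_list ws = w"
    using word_length_attained by blast
  show ?thesis using word_length_le[of "vs @ ws"] vs ws by simp
qed

lemma word_length_generator: "s \<in> S \<Longrightarrow> wl s \<le> 1"
  using word_length_le[of "[s]"] by simp

lemma word_length_multiple: "s \<in> S \<Longrightarrow> wl (int m *s s) \<le> m"
proof (induction m)
  case (Suc m)
  have "int (Suc m) *s s = s + int m *s s" by (simp add: vector_sadd_rdistrib)
  thus ?case using word_length_add[of s "int m *s s"] word_length_generator[of s] Suc by simp
qed simp

lemma word_length_sum: "A \<subseteq> S \<Longrightarrow> wl (\<Sum>s\<in>A. int (m s) *s s) \<le> (\<Sum>s\<in>A. m s)"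
proof (induction A rule: infinite_finite_induct)
  case (insert s A)
  thus ?case
    using word_length_add[of "int (m s) *s s" "\<Sum>s\<in>A. int (m s) *s s"] word_length_multiple[of s "m s"]
    by simp
qed auto

lemma finite_word_ball: "finite (word_ball S n)"
proof (rule finite_subset)
  show "word_ball S n \<subseteq> sum_list ` {ws. set ws \<subseteq> S \<and> length ws \<le> n}"
    using word_length_attained unfolding word_ball_def by (smt (verit) image_iff mem_Collect_eq subsetI)
qed (intro finite_imageI finite_lists_length_le finite_S)

lemma finite_word_sphere: "finite (word_sphere S n)"
  by (rule finite_subset[OF _ finite_word_ball[of n]]) (auto simp: word_sphere_def word_ball_def)

section \<open>The convex hull of the generators as a symmetric convex body\<close>

abbreviation Q :: "(real ^ 'n) set" where "Q \<equiv> hull_of S"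

lemma generator_mem_hull: "s \<in> S \<Longrightarrow> of_int_vec s \<in> Q"
  by (auto simp: hull_of_def intro: hull_inc)

lemma uminus_hull: assumes "x \<in> Q" shows "- x \<in> Q"
proof -
  have "(*\<^sub>R) (- 1) ` of_int_vec ` S = of_int_vec ` S"
  proof -
    have "(*\<^sub>R) (- 1) ` of_int_vec ` S = of_int_vec ` uminus ` S"
      by (auto simp: image_image of_int_vec_minus)
    thus ?thesis using generating by (simp add: symmetric_generating_set_def)
  qed
  hence "Q = (*\<^sub>R) (- 1) ` Q"
    unfolding hull_of_def by (metis convex_hull_scaling)
  thus ?thesis using assms by (metis image_eqI scaleR_minus1_left)
qed

lemma inner_eq_0_imp_zero:
  assumes "\<And>s. s \<in> S \<Longrightarrow> a \<bullet> of_int_vec s = 0" shows "a = 0"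
proof -
  have *: "a \<bullet> of_int_vec (sum_list ws) = 0" if "set ws \<subseteq> S" for ws
    using that by (induction ws) (auto simp: of_int_vec_add inner_add_right assms)
  have "a $ i = 0" for i
  proof -
    obtain ws where "set ws \<subseteq> S" "sum_list ws = axis i 1" using word_exists by blast
    hence "a \<bullet> of_int_vec (axis i 1) = 0" using * by metis
    moreover have "of_int_vec (axis i 1) = (axis i 1 :: real ^ 'n)"
      by (simp add: of_int_vec_def axis_def vec_eq_iff)
    ultimately show ?thesis by (simp add: inner_axis)
  qed
  thus ?thesis by (simp add: vec_eq_iff)
qed

lemma S_nonempty: "S \<noteq> {}"
proof
  assume "S = {}"
  hence "axis undefined 1 = (0 :: real ^ 'n)" by (intro inner_eq_0_imp_zero) auto
  thus False by simp
qed

lemma convex_hull_Q: "convex Q"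
  by (simp add: hull_of_def)

text \<open>Were the interior empty, \<open>Q\<close> would lie in a hyperplane, through 0 because
  \<open>0 \<in> Q\<close>, and a nonzero functional would vanish on all generators, hence on the
  unit vectors. So there is an interior point, and its midpoint with its negative is interior as
  well.\<close>

lemma zero_interior_hull: "0 \<in> interior Q"
proof -
  have half: "(1/2) *\<^sub>R x + (1/2) *\<^sub>R y \<in> A" if "convex A" "x \<in> A" "y \<in> A" for x y and A :: "(real ^ 'n) set"
    using convexD[OF that(1,2,3), of "1/2" "1/2"] by simp
  have zero: "0 \<in> Q"
  proof -
    obtain s where "s \<in> S" using S_nonempty by blast
    hence "(1/2) *\<^sub>R of_int_vec s + (1/2) *\<^sub>R (- of_int_vec s) \<in> Q"
      by (intro half convex_hull_Q generator_mem_hull uminus_hull)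
    thus ?thesis by simp
  qed
  have "interior Q \<noteq> {}"
  proof
    assume "interior Q = {}"
    then obtain a b where ab: "a \<noteq> 0" "Q \<subseteq> {x. a \<bullet> x = b}"
      using empty_interior_subset_hyperplane[OF convex_hull_Q] by blast
    hence "b = 0" using zero by auto
    hence "a \<bullet> of_int_vec s = 0" if "s \<in> S" for s
      using ab generator_mem_hull[OF that] by auto
    thus False using inner_eq_0_imp_zero ab by blast
  qed
  then obtain x where x: "x \<in> interior Q" by blast
  have "uminus ` Q = Q" using uminus_hull by (metis (no_types, lifting) image_cong image_eqI minus_minus subsetI subset_antisym image_subset_iff)
  hence "- x \<in> interior Q"
    using x interior_negations[of Q] by (metis image_eqI)
  hence "(1/2) *\<^sub>R x + (1/2) *\<^sub>R (- x) \<in> interior Q"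
    using x by (intro half convex_interior convex_hull_Q)
  thus ?thesis by simp
qed

sublocale sym_convex_body_vec Q
  by unfold_locales
     (auto simp: zero_interior_hull uminus_hull convex_hull_Q,
      auto simp: hull_of_def intro!: finite_imp_compact_convex_hull finite_S)

lemma gauge_le_word_length: "p (of_int_vec w) \<le> real (wl w)"
proof -
  have "p (of_int_vec (sum_list ws)) \<le> real (length ws)" if "set ws \<subseteq> S" for ws
    using that
  proof (induction ws)
    case (Cons s ws)
    have "p (of_int_vec (sum_list (s # ws))) \<le> p (of_int_vec s) + p (of_int_vec (sum_list ws))"
      by (simp add: of_int_vec_add gauge_add)
    moreover have "p (of_int_vec s) \<le> 1" using generator_mem_hull Cons.prems by (simp add: mem_iff[symmetric])
    ultimately show ?case using Cons by simp
  qed simp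
  thus ?thesis using word_length_attained by metis
qed

text \<open>Write \<open>w\<close> as a nonnegative combination of generators whose total weight is
  its gauge, and round the coefficients down. The rounded part is spelled by a word no longer than
  the gauge; the remainder is a lattice point in a fixed ball, and the finitely many such points
  have bounded word length.\<close>

lemma word_length_le_gauge: "\<exists>K \<ge> 0. \<forall>w. real (wl w) \<le> p (of_int_vec w) + K"
proof -
  define R where "R = (\<Sum>s\<in>S. norm (of_int_vec s :: real ^ 'n))"
  define D where "D = {r :: int ^ 'n. norm (of_int_vec r) \<le> R}"
  have "finite D" unfolding D_def by (rule finite_lattice_bounded)
  define K where "K = (\<Sum>r\<in>D. real (wl r))"
  have K: "real (wl r) \<le> K" if "r \<in> D" for r
    unfolding K_def using \<open>finite D\<close> that by (intro member_le_sum) auto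
  have "real (wl w) \<le> p (of_int_vec w) + K" for w
  proof (cases "w = 0")
    case True thus ?thesis by (simp add: K_def sum_nonneg)
  next
    case False
    define t where "t = p (of_int_vec w)"
    have t: "t > 0" using False by (simp add: t_def)
    have "(1 / t) *\<^sub>R of_int_vec w \<in> Q" using gauge_le_iff[OF t, of "of_int_vec w"] by (simp add: t_def)
    then obtain u where u: "\<And>x. x \<in> of_int_vec ` S \<Longrightarrow> 0 \<le> u x" "sum u (of_int_vec ` S) = 1"
        "(\<Sum>x\<in>of_int_vec ` S. u x *\<^sub>R x) = (1 / t) *\<^sub>R of_int_vec w"
      unfolding hull_of_def using finite_S by (subst (asm) convex_hull_finite) auto
    define c where "c s = t * u (of_int_vec s)" for s
    have inj: "inj_on of_int_vec S" using inj_of_int_vec by (rule inj_on_subset) auto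
    have c: "0 \<le> c s" if "s \<in> S" for s using u(1) that t by (simp add: c_def)
    have sum_c: "(\<Sum>s\<in>S. c s) = t"
      using u(2) by (simp add: sum.reindex[OF inj] c_def sum_distrib_left[symmetric])
    have "(\<Sum>s\<in>S. c s *\<^sub>R of_int_vec s) = t *\<^sub>R (\<Sum>x\<in>of_int_vec ` S. u x *\<^sub>R x)"
      by (simp add: sum.reindex[OF inj] c_def scaleR_sum_right)
    hence w: "of_int_vec w = (\<Sum>s\<in>S. c s *\<^sub>R of_int_vec s)" using u(3) t by simp
    define m where "m s = nat \<lfloor>c s\<rfloor>" for s
    define v where "v = (\<Sum>s\<in>S. int (m s) *s s)"
    have "of_int_vec (w - v) = (\<Sum>s\<in>S. (c s - real (m s)) *\<^sub>R of_int_vec s)"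
      by (simp add: of_int_vec_diff w v_def of_int_vec_sum of_int_vec_scale scaleR_diff_left sum_subtractf)
    also have "norm \<dots> \<le> (\<Sum>s\<in>S. norm (of_int_vec s :: real ^ 'n))"
    proof (rule sum_norm_le)
      fix s assume "s \<in> S"
      hence "\<bar>c s - real (m s)\<bar> \<le> 1" using c[of s] unfolding m_def by linarith
      thus "norm ((c s - real (m s)) *\<^sub>R of_int_vec s) \<le> norm (of_int_vec s :: real ^ 'n)"
        using mult_right_mono[of _ 1 "norm (of_int_vec s :: real ^ 'n)"] by fastforce
    qed
    finally have "w - v \<in> D" by (simp add: D_def R_def)
    hence "real (wl (w - v)) \<le> K" by (rule K)
    moreover have "real (wl v) \<le> t"
    proof -
      have "real (wl v) \<le> (\<Sum>s\<in>S. real (m s))"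
        using word_length_sum[of S m] unfolding v_def by (metis of_nat_le_iff of_nat_sum subset_refl)
      also have "\<dots> \<le> (\<Sum>s\<in>S. c s)"
        using c by (intro sum_mono) (simp add: m_def)
      finally show ?thesis by (simp add: sum_c)
    qed
    moreover have "wl w \<le> wl v + wl (w - v)" using word_length_add[of v "w - v"] by simp
    ultimately show ?thesis unfolding t_def by linarith
  qed
  thus ?thesis by (intro exI[of _ K]) (auto simp: K_def sum_nonneg)
qed

end

subsection \<open>Functions of the direction and lattice cubes\<close>

text \<open>Continuous functions on the space of rays. Continuity is asked only off the origin,
  because a nonconstant function of this kind has no continuous extension there.\<close>

definition direction_fun :: "('a::real_normed_vector \<Rightarrow> real) \<Rightarrow> bool" where
  "direction_fun h \<longleftrightarrow> continuous_on (- {0}) h \<and> (\<forall>t>0. \<forall>x. h (t *\<^sub>R x) = h x)"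

lemma direction_fun_const: "direction_fun (\<lambda>_. c)"
  by (simp add: direction_fun_def)

lemma direction_fun_normalize:
  assumes "direction_fun h" "x \<noteq> 0" shows "h x = h ((1 / norm x) *\<^sub>R x)"
  using assms by (simp add: direction_fun_def)

lemma direction_fun_bounded:
  fixes h :: "'a::euclidean_space \<Rightarrow> real"
  assumes h: "direction_fun h" obtains B where "0 \<le> B" "\<And>x. \<bar>h x\<bar> \<le> B"
proof -
  have "continuous_on (sphere 0 1) h"
    using h unfolding direction_fun_def by (auto elim!: continuous_on_subset)
  hence "bounded (h ` sphere 0 1)"
    by (intro compact_imp_bounded compact_continuous_image) auto
  then obtain B where B: "\<And>x. x \<in> sphere 0 1 \<Longrightarrow> \<bar>h x\<bar> \<le> B"
    unfolding bounded_iff by (metis imageI real_norm_def)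
  have "\<bar>h x\<bar> \<le> max B \<bar>h 0\<bar>" for x
  proof (cases "x = 0")
    case False
    thus ?thesis using B[of "(1 / norm x) *\<^sub>R x"] direction_fun_normalize[OF h False] by auto
  qed simp
  thus ?thesis by (intro that[of "max B \<bar>h 0\<bar>"]) auto
qed

lemma direction_fun_measurable:
  fixes h :: "'a::euclidean_space \<Rightarrow> real"
  assumes h: "direction_fun h" shows "h \<in> borel_measurable borel"
  by (rule borel_measurable_continuous_countable_exceptions[of "{0}"])
     (use h in \<open>auto simp: direction_fun_def\<close>)

text \<open>After division by the norm of \<open>x\<close> both points lie in a compact annulus,
  where \<open>h\<close> is uniformly continuous, at distance at most
  \<open>B / norm x\<close>.\<close>

lemma direction_fun_oscillation:
  fixes h :: "'a::euclidean_space \<Rightarrow> real"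
  assumes h: "direction_fun h" and e: "0 < e"
  obtains R where "0 < R" "\<And>x y. R \<le> norm x \<Longrightarrow> norm (x - y) \<le> B \<Longrightarrow> \<bar>h x - h y\<bar> \<le> e"
proof -
  let ?A = "cball 0 2 - ball 0 (1/2) :: 'a set"
  have "continuous_on ?A h"
    using h unfolding direction_fun_def by (auto elim!: continuous_on_subset)
  hence "uniformly_continuous_on ?A h"
    by (intro compact_uniformly_continuous) (auto intro: compact_diff)
  then obtain d where d: "d > 0" "\<And>x y. x \<in> ?A \<Longrightarrow> y \<in> ?A \<Longrightarrow> dist y x < d \<Longrightarrow> dist (h y) (h x) < e"
    using e unfolding uniformly_continuous_on_def by metis
  \<comment> \<open>The bound \<open>2 * B\<close> keeps the rescaled \<open>y\<close> in the
    annulus; \<open>2 * B / d\<close> makes the rescaled distance less than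
    \<open>d\<close>.\<close>
  define R where "R = max 1 (max (2 * B) (2 * B / d))"
  have "\<bar>h x - h y\<bar> \<le> e" if x: "R \<le> norm x" and xy: "norm (x - y) \<le> B" for x y
  proof -
    have nx: "norm x \<ge> 1" "norm x \<ge> 2 * B" "norm x \<ge> 2 * B / d" using x by (auto simp: R_def)
    define t where "t = 1 / norm x"
    have t: "t > 0" using nx(1) by (auto simp: t_def)
    have "norm (t *\<^sub>R x - t *\<^sub>R y) = norm (x - y) / norm x"
      using t by (simp add: scaleR_diff_right[symmetric] t_def)
    also have "\<dots> \<le> B / norm x" using xy nx by (intro divide_right_mono) auto
    finally have diff: "norm (t *\<^sub>R x - t *\<^sub>R y) \<le> B / norm x" .
    have B: "0 \<le> B" using xy norm_ge_zero order_trans by blast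
    have nx0: "0 < norm x" using nx by linarith
    have half: "B / norm x \<le> 1/2" using nx nx0 by (simp add: divide_le_eq)
    have small: "B / norm x < d"
    proof (cases "B = 0")
      case False
      hence "B > 0" using B by simp
      moreover have "2 * B \<le> d * norm x" using nx(3) d(1) by (simp add: field_simps)
      ultimately have "B < d * norm x" by linarith
      thus ?thesis using nx0 by (simp add: divide_less_eq)
    qed (use d in simp)
    have n1: "norm (t *\<^sub>R x) = 1" using nx(1) by (auto simp: t_def)
    have "norm (t *\<^sub>R y) \<le> 2" "1/2 \<le> norm (t *\<^sub>R y)"
      using norm_triangle_ineq3[of "t *\<^sub>R y" "t *\<^sub>R x"] norm_minus_commute[of "t *\<^sub>R y" "t *\<^sub>R x"]
        diff half unfolding n1 by linarith+
    hence "t *\<^sub>R x \<in> ?A" "t *\<^sub>R y \<in> ?A" using n1 by (auto simp: dist_norm simp del: norm_scaleR)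
    hence "dist (h (t *\<^sub>R x)) (h (t *\<^sub>R y)) < e"
      using diff small by (intro d(2)) (auto simp: dist_norm)
    thus ?thesis using h t by (simp add: direction_fun_def dist_real_def)
  qed
  thus ?thesis by (intro that[of R]) (auto simp: R_def)
qed

text \<open>With \<open>t = 1 / n\<close> this is a difference quotient at 0 of
  \<open>(1 + t * b) ^ d - (1 + t * a) ^ d\<close>. It gives the growth of the volume of shells of
  fixed thickness.\<close>

lemma power_layer_limit:
  assumes d: "0 < d"
  shows "(\<lambda>n. ((real n + b) ^ d - (real n + a) ^ d) / real n ^ (d - 1)) \<longlonglongrightarrow> real d * (b - a)"
proof -
  define f where "f t = (1 + t * b) ^ d - (1 + t * a) ^ d" for t :: real
  have "(f has_real_derivative real d * (b - a)) (at 0)"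
    unfolding f_def by (auto intro!: derivative_eq_intros simp: algebra_simps)
  hence "((\<lambda>t. (f (0 + t) - f 0) / t) \<longlongrightarrow> real d * (b - a)) (at 0)"
    by (simp add: DERIV_def)
  hence "(\<lambda>n. (f (0 + 1 / real n) - f 0) / (1 / real n)) \<longlonglongrightarrow> real d * (b - a)"
    by (rule filterlim_compose)
       (auto simp: filterlim_at eventually_sequentially lim_1_over_n intro!: exI[of _ 1])
  thus ?thesis
  proof (rule Lim_transform_eventually)
    show "\<forall>\<^sub>F n in sequentially. (f (0 + 1 / real n) - f 0) / (1 / real n) =
        ((real n + b) ^ d - (real n + a) ^ d) / real n ^ (d - 1)"
      using eventually_gt_at_top[of 0]
    proof eventually_elim
      case (elim n)
      have *: "(1 + c / real n) ^ d = (real n + c) ^ d / (real n * real n ^ (d - 1))" for c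
      proof -
        have "1 + c / real n = (real n + c) / real n" using elim by (simp add: field_simps)
        moreover have "real n ^ d = real n * real n ^ (d - 1)" using d by (cases d) auto
        ultimately show ?thesis by (simp add: power_divide)
      qed
      show ?case using elim by (simp add: f_def * diff_divide_distrib[symmetric])
    qed
  qed
qed

text \<open>Half-open cubes partition space, so that a count of lattice points is exactly a
  volume.\<close>

definition lattice_cube :: "int ^ 'n \<Rightarrow> (real ^ 'n) set" where
  "lattice_cube w = {y. \<forall>i. \<lfloor>y $ i\<rfloor> = w $ i}"

lemma mem_lattice_cube_floor: "y \<in> lattice_cube (\<chi> i. \<lfloor>y $ i\<rfloor>)"
  by (simp add: lattice_cube_def)

lemma disjoint_lattice_cube: "disjoint_family_on lattice_cube A"
  by (auto simp: disjoint_family_on_def lattice_cube_def vec_eq_iff)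

lemma norm_lattice_cube:
  assumes "y \<in> lattice_cube (w :: int ^ 'n)" shows "norm (of_int_vec w - y) \<le> real CARD('n)"
proof -
  have "norm (of_int_vec w - y) \<le> (\<Sum>i\<in>UNIV. \<bar>(of_int_vec w - y) $ i\<bar>)" by (rule norm_le_l1_cart)
  also have "\<dots> \<le> (\<Sum>i\<in>(UNIV :: 'n set). 1)"
  proof (rule sum_mono)
    fix i have "\<lfloor>y $ i\<rfloor> = w $ i" using assms by (simp add: lattice_cube_def)
    thus "\<bar>(of_int_vec w - y) $ i\<bar> \<le> 1" unfolding of_int_vec_def by simp linarith
  qed
  finally show ?thesis by simp
qed

lemma sets_lattice_cube: "lattice_cube w \<in> sets borel"
proof -
  have "lattice_cube w = (\<Inter>i. {y. of_int (w $ i) \<le> y $ i} \<inter> {y. y $ i < of_int (w $ i) + 1})"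
    by (auto simp: lattice_cube_def floor_eq_iff)
  also have "\<dots> \<in> sets borel"
    by (intro sets.finite_INT sets.Int borel_closed borel_open)
       (auto intro!: closed_Collect_le open_Collect_less continuous_intros)
  finally show ?thesis .
qed

lemma sets_lebesgue_lattice_cube [measurable]: "lattice_cube w \<in> sets lebesgue"
  by (rule sets_completionI_sets) (simp add: sets_lattice_cube)

lemma lattice_cube_lmeasurable: "lattice_cube w \<in> lmeasurable"
  and measure_lattice_cube: "measure lebesgue (lattice_cube (w :: int ^ 'n)) = 1"
proof -
  let ?a = "of_int_vec w :: real ^ 'n" and ?b = "(\<chi> i. of_int (w $ i) + 1) :: real ^ 'n"
  have 1: "lattice_cube w \<subseteq> cbox ?a ?b"
  proof
    fix y :: "real ^ 'n" assume "y \<in> lattice_cube w"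
    hence *: "\<lfloor>y $ i\<rfloor> = w $ i" for i by (simp add: lattice_cube_def)
    show "y \<in> cbox ?a ?b"
      unfolding mem_box_cart of_int_vec_def using *[symmetric] by (auto simp: less_imp_le)
  qed
  have 2: "box ?a ?b \<subseteq> lattice_cube w"
    by (auto simp: lattice_cube_def mem_box_cart of_int_vec_def floor_eq_iff less_imp_le)
  show m: "lattice_cube w \<in> lmeasurable"
    using 1 by (intro fmeasurableI2[OF lmeasurable_cbox] sets_lebesgue_lattice_cube)
  have c1: "measure lebesgue (cbox ?a ?b) = 1"
  proof -
    have "?a \<in> cbox ?a ?b" by (simp add: mem_box_cart of_int_vec_def)
    hence "cbox ?a ?b \<noteq> {}" by blast
    thus ?thesis by (simp add: content_cbox_cart of_int_vec_def)
  qed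
  have "measure lebesgue (lattice_cube w) \<le> measure lebesgue (cbox ?a ?b)"
    using 1 by (intro measure_mono_fmeasurable sets_lebesgue_lattice_cube) auto
  moreover have "measure lebesgue (box ?a ?b) \<le> measure lebesgue (lattice_cube w)"
    using 2 m by (intro measure_mono_fmeasurable sets_lebesgue_lattice_cube) auto
  moreover have "measure lebesgue (box ?a ?b) = measure lebesgue (cbox ?a ?b)"
    by (simp add: measure_lborel_box_eq measure_lborel_cbox_eq)
  ultimately show "measure lebesgue (lattice_cube w) = 1" using c1 by linarith
qed

subsection \<open>Lattice sums over shells\<close>

context sym_convex_body_vec
begin

lemma direction_fun_lebesgue_measurable:
  "direction_fun h \<Longrightarrow> h \<in> borel_measurable (lebesgue :: (real ^ 'n) measure)"
  using direction_fun_measurable by (intro measurable_completion) auto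

lemma direction_set_integrable:
  fixes h :: "real ^ 'n \<Rightarrow> real"
  assumes h: "direction_fun h" and A: "A \<in> lmeasurable"
  shows "set_integrable lebesgue A h"
proof -
  obtain B where B: "0 \<le> B" "\<And>x. \<bar>h x\<bar> \<le> B" using direction_fun_bounded[OF h] by blast
  have [measurable]: "h \<in> borel_measurable lebesgue" "A \<in> sets lebesgue"
    using direction_fun_lebesgue_measurable[OF h] A by auto
  show ?thesis
    unfolding set_integrable_def
  proof (rule Bochner_Integration.integrable_bound)
    show "integrable lebesgue (\<lambda>x. B * indicator A x)"
      using A by (simp add: fmeasurable_def)
    show "(\<lambda>x. indicator A x *\<^sub>R h x) \<in> borel_measurable lebesgue" by measurable
    show "AE x in lebesgue. norm (indicator A x *\<^sub>R h x) \<le> norm (B * indicator A x)"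
      using B by (auto simp: indicator_def)
  qed
qed

lemma set_integral_const: "A \<in> lmeasurable \<Longrightarrow> (LINT y:A|lebesgue. (c::real)) = c * measure lebesgue A"
  by (simp add: set_lebesgue_integral_def mult.commute)

lemma gauge_ball_lmeasurable: "{y. p y \<le> R} \<in> lmeasurable"
proof (rule lmeasurable_compact)
  obtain r R' where r: "0 < r" "0 < R'" "\<And>x. p x \<le> R' * norm x" and r3: "\<And>x. norm x \<le> r * p x" using gauge_norm_bounds by blast
  have "norm x \<le> r * \<bar>R\<bar>" if "p x \<le> R" for x
    using r3[of x] mult_left_mono[of "p x" "\<bar>R\<bar>" r] r(1) that by linarith
  hence "bounded {y. p y \<le> R}" by (auto simp: bounded_iff)
  thus "compact {y. p y \<le> R}"
    by (auto simp: compact_eq_bounded_closed intro!: closed_Collect_le continuous_gauge)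
qed

definition layer :: "real \<Rightarrow> real \<Rightarrow> (real ^ 'n) set" where
  "layer r R = {y. r < p y \<and> p y \<le> R}"

lemma layer_lmeasurable: "layer r R \<in> lmeasurable"
proof -
  have "layer r R = {y. p y \<le> R} - {y. p y \<le> r}" by (auto simp: layer_def)
  thus ?thesis using gauge_ball_lmeasurable by (simp add: fmeasurable_Diff fmeasurableD)
qed

lemma integral_gauge_ball:
  assumes h: "direction_fun h" and R: "0 < R"
  shows "(LINT y:{y. p y \<le> R}|lebesgue. h y) = R ^ CARD('n) * (LINT y:Q|lebesgue. h y)"
proof -
  have [measurable]: "h \<in> borel_measurable lebesgue" "{y. p y \<le> R} \<in> sets lebesgue"
    using direction_fun_lebesgue_measurable[OF h] gauge_ball_lmeasurable by (auto simp: fmeasurableD)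
  have "(LINT y|lebesgue. indicator {y. p y \<le> R} y * h y) =
      R ^ DIM(real ^ 'n) * (LINT y|lebesgue. indicator {y. p y \<le> R} (R *\<^sub>R y) * h (R *\<^sub>R y))"
    by (rule integral_lebesgue_scale[OF _ R]) measurable
  also have "(\<lambda>y. indicator {y. p y \<le> R} (R *\<^sub>R y) * h (R *\<^sub>R y)) = (\<lambda>y. indicator Q y * h y)"
    using h R by (auto simp: fun_eq_iff indicator_def direction_fun_def gauge_scale mem_iff)
  finally show ?thesis by (simp add: set_lebesgue_integral_def)
qed

lemma integral_layer:
  assumes h: "direction_fun h" and r: "0 < r" "r \<le> R"
  shows "(LINT y:layer r R|lebesgue. h y) = (R ^ CARD('n) - r ^ CARD('n)) * (LINT y:Q|lebesgue. h y)"
proof -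
  have "(LINT y:{y. p y \<le> r} \<union> layer r R|lebesgue. h y) =
      (LINT y:{y. p y \<le> r}|lebesgue. h y) + (LINT y:layer r R|lebesgue. h y)"
    by (intro set_integral_Un direction_set_integrable h gauge_ball_lmeasurable layer_lmeasurable)
       (auto simp: layer_def)
  moreover have "{y. p y \<le> r} \<union> layer r R = {y. p y \<le> R}" using r by (auto simp: layer_def)
  ultimately show ?thesis using r by (simp add: integral_gauge_ball h algebra_simps)
qed

lemma measure_layer:
  assumes "0 < r" "r \<le> R"
  shows "measure lebesgue (layer r R) = (R ^ CARD('n) - r ^ CARD('n)) * measure lebesgue Q"
  using integral_layer[OF direction_fun_const assms, of 1]
  by (simp add: set_integral_const layer_lmeasurable)

lemma lattice_cubes_lmeasurable:
  assumes "finite A" shows "(\<Union>w\<in>A. lattice_cube w) \<in> lmeasurable"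
  using assms by (intro fmeasurable.finite_UN) (auto simp: lattice_cube_lmeasurable)

lemma lattice_sum_cubes:
  fixes h :: "real ^ 'n \<Rightarrow> real"
  assumes h: "direction_fun h" and A: "finite A"
    and osc: "\<And>w y. w \<in> A \<Longrightarrow> y \<in> lattice_cube w \<Longrightarrow> \<bar>h (of_int_vec w) - h y\<bar> \<le> e"
  shows "\<bar>(\<Sum>w\<in>A. h (of_int_vec w)) - (LINT y:(\<Union>w\<in>A. lattice_cube w)|lebesgue. h y)\<bar> \<le> e * real (card A)"
proof -
  have int: "set_integrable lebesgue (lattice_cube w) h" for w
    by (intro direction_set_integrable h lattice_cube_lmeasurable)
  have const: "(LINT y:lattice_cube w|lebesgue. c) = c" for w :: "int ^ 'n" and c :: real
    by (simp add: set_integral_const lattice_cube_lmeasurable measure_lattice_cube)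
  have "\<bar>h (of_int_vec w) - (LINT y:lattice_cube w|lebesgue. h y)\<bar> \<le> e" if w: "w \<in> A" for w
  proof -
    have bd: "h (of_int_vec w) - e \<le> h y" "h y \<le> h (of_int_vec w) + e" if "y \<in> lattice_cube w" for y
      using osc[OF w that] by auto
    have "(LINT y:lattice_cube w|lebesgue. h (of_int_vec w) - e) \<le> (LINT y:lattice_cube w|lebesgue. h y)"
      by (intro set_integral_mono int direction_set_integrable direction_fun_const lattice_cube_lmeasurable bd)
    moreover have "(LINT y:lattice_cube w|lebesgue. h y) \<le> (LINT y:lattice_cube w|lebesgue. h (of_int_vec w) + e)"
      by (intro set_integral_mono int direction_set_integrable direction_fun_const lattice_cube_lmeasurable bd)
    ultimately show ?thesis unfolding const by linarith
  qed
  hence "\<bar>\<Sum>w\<in>A. h (of_int_vec w) - (LINT y:lattice_cube w|lebesgue. h y)\<bar> \<le> (\<Sum>w\<in>A. e)"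
    by (intro order_trans[OF sum_abs sum_mono])
  moreover have "(LINT y:(\<Union>w\<in>A. lattice_cube w)|lebesgue. h y) = (\<Sum>w\<in>A. LINT y:lattice_cube w|lebesgue. h y)"
    by (intro set_integral_finite_Union A int disjoint_lattice_cube sets_lebesgue_lattice_cube)
  ultimately show ?thesis by (simp add: sum_subtractf mult.commute)
qed

lemma measure_lattice_cubes:
  fixes A :: "(int ^ 'n) set"
  assumes A: "finite A" shows "measure lebesgue (\<Union>w\<in>A. lattice_cube w) = real (card A)"
proof -
  have "\<bar>(\<Sum>w\<in>A. (1::real)) - (LINT y:(\<Union>w\<in>A. lattice_cube w)|lebesgue. 1)\<bar> \<le> 0 * real (card A)"
    by (rule lattice_sum_cubes[OF direction_fun_const A]) simp
  thus ?thesis using A by (simp add: set_integral_const lattice_cubes_lmeasurable)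
qed

lemma set_integral_mono_set_nonneg:
  fixes h :: "real ^ 'n \<Rightarrow> real"
  assumes "direction_fun h" "\<And>y. 0 \<le> h y" "A \<in> lmeasurable" "B \<in> lmeasurable" "A \<subseteq> B"
  shows "(LINT y:A|lebesgue. h y) \<le> (LINT y:B|lebesgue. h y)"
  unfolding set_lebesgue_integral_def
  using assms direction_set_integrable[of h] unfolding set_integrable_def
  by (intro integral_mono) (auto simp: indicator_def)

lemma lattice_cube_gauge_bound:
  obtains c where "0 < c" "\<And>w y. y \<in> lattice_cube w \<Longrightarrow> \<bar>p (of_int_vec w) - p y\<bar> < c"
proof -
  obtain r R where R: "0 < r" "0 < R" "\<And>x. p x \<le> R * norm x" "\<And>x. norm x \<le> r * p x"
    using gauge_norm_bounds by blast
  have "\<bar>p (of_int_vec w) - p y\<bar> < R * real CARD('n) + 1" if "y \<in> lattice_cube w" for w y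
    using gauge_triangle[of "of_int_vec w" y] R(3)[of "of_int_vec w - y"]
      mult_left_mono[OF norm_lattice_cube[OF that], of R] R(2) by linarith
  thus ?thesis using R by (intro that[of "R * real CARD('n) + 1"]) (auto simp: add_pos_pos)
qed

lemma finite_lattice_gauge: "finite {w. p (of_int_vec w) \<le> R}"
proof -
  obtain r R' where r: "0 < r" "0 < R'" "\<And>x. p x \<le> R' * norm x" and r3: "\<And>x. norm x \<le> r * p x" using gauge_norm_bounds by blast
  have "{w. p (of_int_vec w) \<le> R} \<subseteq> {w. norm (of_int_vec w) \<le> r * R}"
  proof
    fix w assume "w \<in> {w. p (of_int_vec w) \<le> R}"
    thus "w \<in> {w. norm (of_int_vec w) \<le> r * R}"
      using r(1) by (auto intro!: order_trans[OF r3] mult_left_mono)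
  qed
  thus ?thesis using finite_lattice_bounded finite_subset by blast
qed

abbreviation lattice_layer :: "real \<Rightarrow> real \<Rightarrow> (int ^ 'n) set" where
  "lattice_layer r R \<equiv> {w. r \<le> p (of_int_vec w) \<and> p (of_int_vec w) \<le> R}"

lemma finite_lattice_layer: "finite (lattice_layer r R)"
  by (rule finite_subset[OF _ finite_lattice_gauge[of R]]) auto

lemma layer_sum_oscillation:
  assumes h: "direction_fun h" and e: "0 < e"
  shows "\<forall>\<^sub>F n in sequentially. \<forall>w y. real n + \<alpha> \<le> p (of_int_vec w) \<longrightarrow> y \<in> lattice_cube w \<longrightarrow>
    \<bar>h (of_int_vec w) - h y\<bar> \<le> e"
proof -
  obtain r R' where r: "0 < r" "0 < R'" "\<And>x. p x \<le> R' * norm x" "\<And>x. norm x \<le> r * p x"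
    using gauge_norm_bounds by blast
  obtain R where R: "0 < R" "\<And>x y. R \<le> norm x \<Longrightarrow> norm (x - y) \<le> real CARD('n) \<Longrightarrow> \<bar>h x - h y\<bar> \<le> e"
    using direction_fun_oscillation[OF h e] by blast
  have "\<forall>\<^sub>F n in sequentially. R' * R - \<alpha> \<le> real n"
    using filterlim_real_sequentially by (simp add: filterlim_at_top)
  thus ?thesis
  proof eventually_elim
    case (elim n)
    show ?case
    proof (intro allI impI)
      fix w y assume w: "real n + \<alpha> \<le> p (of_int_vec w)" and y: "y \<in> lattice_cube w"
      have "R' * R \<le> R' * norm (of_int_vec w :: real ^ 'n)"
        using w elim r(3)[of "of_int_vec w"] by linarith
      hence "R \<le> norm (of_int_vec w :: real ^ 'n)" using r(2) by simp
      thus "\<bar>h (of_int_vec w) - h y\<bar> \<le> e" using norm_lattice_cube[OF y] by (intro R(2)) auto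
    qed
  qed
qed

section \<open>Lattice layers between thickened and thinned shells\<close>

context
  fixes c :: real
  assumes c: "\<And>w y. y \<in> lattice_cube w \<Longrightarrow> \<bar>p (of_int_vec w) - p y\<bar> < c"
begin

lemma cubes_subset_layer: "(\<Union>w\<in>lattice_layer r R. lattice_cube w) \<subseteq> layer (r - c) (R + c)"
  using c by (force simp: layer_def)

lemma layer_subset_cubes: "layer (r + c) (R - c) \<subseteq> (\<Union>w\<in>lattice_layer r R. lattice_cube w)"
proof
  fix y assume y: "y \<in> layer (r + c) (R - c)"
  let ?w = "\<chi> i. \<lfloor>y $ i\<rfloor>"
  have "?w \<in> lattice_layer r R"
    using y c[OF mem_lattice_cube_floor[of y]] by (auto simp: layer_def)
  thus "y \<in> (\<Union>w\<in>lattice_layer r R. lattice_cube w)" using mem_lattice_cube_floor[of y] by blast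
qed

text \<open>The cubes at the points of the layer lie in the shell thickened by \<open>c\<close> on
  both sides, whose volume divided by \<open>n ^ (d - 1)\<close> tends to
  \<open>d * (b - a + 2 * c)\<close> times that of \<open>Q\<close>. The same shell bounds the
  number of points, hence the accumulated oscillation of \<open>h\<close>.\<close>

lemma layer_sum_upper:
  assumes h: "direction_fun h" "\<And>x. 0 \<le> h x" and \<epsilon>: "0 < \<epsilon>" and ab: "a \<le> b"
  shows "\<forall>\<^sub>F n in sequentially. (\<Sum>w\<in>lattice_layer (real n + a) (real n + b). h (of_int_vec w)) \<le>
    (real CARD('n) * (b - a + 2 * c) * (LINT y:Q|lebesgue. h y) + \<epsilon>) * real n ^ (CARD('n) - 1)"
proof -
  let ?I = "LINT y:Q|lebesgue. h y" and ?V = "measure lebesgue Q" and ?d = "CARD('n)"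
  define D where "D n = (real n + (b + c)) ^ ?d - (real n + (a - c)) ^ ?d" for n
  have lim: "(\<lambda>n. D n / real n ^ (?d - 1)) \<longlonglongrightarrow> real ?d * (b - a + 2 * c)"
    using power_layer_limit[of ?d "b + c" "a - c"] by (simp add: D_def algebra_simps)
  have c0: "0 < c" using c[OF mem_lattice_cube_floor] abs_ge_zero le_less_trans by blast
  have *: "\<forall>\<^sub>F n in sequentially. (\<Sum>w\<in>lattice_layer (real n + a) (real n + b). h (of_int_vec w)) \<le> D n * (?I + e * ?V)"
    if e: "0 < e" for e
  proof -
    have "\<forall>\<^sub>F n in sequentially. c - a < real n"
      using filterlim_real_sequentially by (simp add: filterlim_at_top_dense)
    thus ?thesis using layer_sum_oscillation[OF h(1) e, of a]
    proof eventually_elim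
      case (elim n)
      let ?A = "lattice_layer (real n + a) (real n + b)"
      let ?L = "layer (real n + a - c) (real n + b + c)"
      have le: "0 < real n + a - c" "real n + a - c \<le> real n + b + c" using elim(1) ab c0 by auto
      have U: "(\<Union>w\<in>?A. lattice_cube w) \<subseteq> ?L" by (rule cubes_subset_layer)
      have "(\<Sum>w\<in>?A. h (of_int_vec w)) \<le> (LINT y:(\<Union>w\<in>?A. lattice_cube w)|lebesgue. h y) + e * real (card ?A)"
        using lattice_sum_cubes[OF h(1) finite_lattice_layer, of "real n + a" "real n + b" e] elim(2) by force
      also have "(LINT y:(\<Union>w\<in>?A. lattice_cube w)|lebesgue. h y) \<le> (LINT y:?L|lebesgue. h y)"
        by (intro set_integral_mono_set_nonneg h U lattice_cubes_lmeasurable layer_lmeasurable finite_lattice_layer)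
      also have "(LINT y:?L|lebesgue. h y) = D n * ?I"
        using integral_layer[OF h(1) le] by (simp add: D_def algebra_simps)
      also have "real (card ?A) = measure lebesgue (\<Union>w\<in>?A. lattice_cube w)"
        by (rule measure_lattice_cubes[OF finite_lattice_layer, symmetric])
      also have "\<dots> \<le> measure lebesgue ?L"
        by (intro measure_mono_fmeasurable U layer_lmeasurable)
           (auto intro!: fmeasurableD lattice_cubes_lmeasurable finite_lattice_layer)
      also have "measure lebesgue ?L = D n * ?V"
        using measure_layer[OF le] by (simp add: D_def algebra_simps)
      finally show ?case using e by (simp add: algebra_simps)
    qed
  qed
  \<comment> \<open>Chosen so that the oscillation contributes at most \<open>\<epsilon> / 2\<close>
    in the limit; the summand 1 keeps the denominator positive.\<close>
  define e where "e = \<epsilon> / (2 * (real ?d * (b - a + 2 * c) * ?V + 1))"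
  have pos: "0 \<le> real ?d * (b - a + 2 * c) * ?V" using ab c0 volume_pos by simp
  hence e: "0 < e" using \<epsilon> by (simp add: e_def)
  have small: "real ?d * (b - a + 2 * c) * (e * ?V) < \<epsilon>"
  proof -
    let ?X = "real ?d * (b - a + 2 * c) * ?V"
    have "?X * e \<le> (?X + 1) * e" using e by simp
    also have "\<dots> = \<epsilon> / 2" using pos by (simp add: e_def field_simps)
    finally show ?thesis using \<epsilon> by (simp add: mult_ac)
  qed
  have "(\<lambda>n. D n / real n ^ (?d - 1) * (?I + e * ?V)) \<longlonglongrightarrow> real ?d * (b - a + 2 * c) * (?I + e * ?V)"
    by (intro tendsto_mult lim tendsto_const)
  moreover have "real ?d * (b - a + 2 * c) * (?I + e * ?V) < real ?d * (b - a + 2 * c) * ?I + \<epsilon>"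
    using small by (simp add: distrib_left)
  ultimately have "\<forall>\<^sub>F n in sequentially.
      D n / real n ^ (?d - 1) * (?I + e * ?V) < real ?d * (b - a + 2 * c) * ?I + \<epsilon>"
    by (rule order_tendstoD)
  thus ?thesis using *[OF e] eventually_gt_at_top[of 0]
  proof eventually_elim
    case (elim n)
    have "D n * (?I + e * ?V) < (real ?d * (b - a + 2 * c) * ?I + \<epsilon>) * real n ^ (?d - 1)"
      using elim(1,3) by (simp add: field_simps)
    thus ?case using elim(2) by linarith
  qed
qed

lemma layer_sum_lower:
  assumes h: "direction_fun h" "\<And>x. 0 \<le> h x" and \<epsilon>: "0 < \<epsilon>" and ab: "a + 2 * c \<le> b"
  shows "\<forall>\<^sub>F n in sequentially. (real CARD('n) * (b - a - 2 * c) * (LINT y:Q|lebesgue. h y) - \<epsilon>) * real n ^ (CARD('n) - 1)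
    \<le> (\<Sum>w\<in>lattice_layer (real n + a) (real n + b). h (of_int_vec w))"
proof -
  let ?I = "LINT y:Q|lebesgue. h y" and ?V = "measure lebesgue Q" and ?d = "CARD('n)"
  define D where "D n = (real n + (b - c)) ^ ?d - (real n + (a + c)) ^ ?d" for n
  have lim: "(\<lambda>n. D n / real n ^ (?d - 1)) \<longlonglongrightarrow> real ?d * (b - a - 2 * c)"
    using power_layer_limit[of ?d "b - c" "a + c"] by (simp add: D_def algebra_simps)
  have c0: "0 < c" using c[OF mem_lattice_cube_floor] abs_ge_zero le_less_trans by blast
  \<comment> \<open>By \<open>layer_sum_upper\<close> for the constant 1 with error 1, the layer
    eventually has at most \<open>C * n ^ (d - 1)\<close> points, which bounds the oscillation
    error.\<close>
  define C where "C = real ?d * (b - a + 2 * c) * ?V + 1"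
  have C: "0 < C" using ab c0 volume_pos by (simp add: C_def add_nonneg_pos)
  define e where "e = \<epsilon> / (2 * C)"
  have e: "0 < e" using \<epsilon> C by (simp add: e_def)
  have VI: "(LINT y:Q|lebesgue. 1) = ?V" using set_integral_const[OF Q_lmeasurable, of 1] by simp
  have card: "\<forall>\<^sub>F n in sequentially. real (card (lattice_layer (real n + a) (real n + b))) \<le> C * real n ^ (?d - 1)"
    using layer_sum_upper[OF direction_fun_const, of 1 1 a b] ab c0 by (simp add: VI C_def)
  have "\<forall>\<^sub>F n in sequentially. - (a + c) < real n"
    using filterlim_real_sequentially by (simp add: filterlim_at_top_dense)
  hence sum: "\<forall>\<^sub>F n in sequentially. D n * ?I - \<epsilon> / 2 * real n ^ (?d - 1) \<le>
      (\<Sum>w\<in>lattice_layer (real n + a) (real n + b). h (of_int_vec w))"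
    using layer_sum_oscillation[OF h(1) e, of a] card
  proof eventually_elim
    case (elim n)
    let ?A = "lattice_layer (real n + a) (real n + b)"
    let ?L = "layer (real n + a + c) (real n + b - c)"
    have le: "0 < real n + a + c" "real n + a + c \<le> real n + b - c" using elim(1) ab by auto
    have "D n * ?I = (LINT y:?L|lebesgue. h y)"
      using integral_layer[OF h(1) le] by (simp add: D_def algebra_simps)
    also have "\<dots> \<le> (LINT y:(\<Union>w\<in>?A. lattice_cube w)|lebesgue. h y)"
      by (intro set_integral_mono_set_nonneg h layer_subset_cubes lattice_cubes_lmeasurable
          layer_lmeasurable finite_lattice_layer)
    also have "\<dots> \<le> (\<Sum>w\<in>?A. h (of_int_vec w)) + e * real (card ?A)"
      using lattice_sum_cubes[OF h(1) finite_lattice_layer, of "real n + a" "real n + b" e] elim(2) by force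
    also have "e * real (card ?A) \<le> e * (C * real n ^ (?d - 1))"
      using e elim(3) by (intro mult_left_mono) auto
    also have "\<dots> = \<epsilon> / 2 * real n ^ (?d - 1)" using C by (simp add: e_def)
    finally show ?case by simp
  qed
  have "(\<lambda>n. D n / real n ^ (?d - 1) * ?I) \<longlonglongrightarrow> real ?d * (b - a - 2 * c) * ?I"
    by (intro tendsto_mult lim tendsto_const)
  hence "\<forall>\<^sub>F n in sequentially.
      real ?d * (b - a - 2 * c) * ?I - \<epsilon> / 2 < D n / real n ^ (?d - 1) * ?I"
    by (rule order_tendstoD) (use \<epsilon> in simp)
  thus ?thesis using sum eventually_gt_at_top[of 0]
  proof eventually_elim
    case (elim n)
    have "(real ?d * (b - a - 2 * c) * ?I - \<epsilon> / 2) * real n ^ (?d - 1) < D n * ?I"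
      using elim(1,3) by (simp add: field_simps)
    thus ?case using elim(2) by (simp add: algebra_simps)
  qed
qed

end

end

subsection \<open>Walls and chambers\<close>

context lattice_generators
begin

text \<open>A basis of generators on a common facet: the hyperplane \<open>a \<bullet> x = 1\<close>
  supports \<open>Q\<close> and contains \<open>T\<close>. On the cone over \<open>T\<close> the
  gauge is the linear form \<open>a\<close>, which there is the sum of the coordinates.\<close>

definition facet_basis :: "(int ^ 'n) set \<Rightarrow> bool" where
  "facet_basis T \<longleftrightarrow> T \<subseteq> S \<and> independent (of_int_vec ` T :: (real ^ 'n) set) \<and>
     span (of_int_vec ` T :: (real ^ 'n) set) = UNIV \<and>
     (\<exists>a :: real ^ 'n. (\<forall>s\<in>S. a \<bullet> of_int_vec s \<le> 1) \<and> (\<forall>s\<in>T. a \<bullet> of_int_vec s = 1))"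

definition coord :: "(int ^ 'n) set \<Rightarrow> real ^ 'n \<Rightarrow> int ^ 'n \<Rightarrow> real" where
  "coord T x s = representation (of_int_vec ` T) x (of_int_vec s)"

text \<open>With all proper spans included, generators whose span contains a point off the walls
  must span the whole space. The empty \<open>U\<close> puts the origin on a wall.\<close>

definition walls :: "(real ^ 'n) set" where
  "walls = \<Union> {span (of_int_vec ` U) | U. U \<subseteq> S \<and> span (of_int_vec ` U) \<noteq> (UNIV :: (real ^ 'n) set)}"

text \<open>A facet that is not a simplex gives overlapping cones, so a point may lie in several.
  Recording all of them gives a datum free of choices that is locally constant off the
  walls.\<close>

definition chambers :: "real ^ 'n \<Rightarrow> (int ^ 'n) set set" where
  "chambers x = {T. facet_basis T \<and> (\<forall>s\<in>T. 0 < coord T x s)}"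

lemma finite_facet_basis: "facet_basis T \<Longrightarrow> finite T"
  using finite_S finite_subset by (auto simp: facet_basis_def)

lemma coord_add:
  assumes "facet_basis T" shows "coord T (x + y) s = coord T x s + coord T y s"
  using assms unfolding coord_def facet_basis_def by (subst representation_add) auto

lemma coord_scale:
  assumes "facet_basis T" shows "coord T (c *\<^sub>R x) s = c * coord T x s"
  using assms unfolding coord_def facet_basis_def by (subst representation_scale) auto

lemma coord_basis:
  assumes "facet_basis T" "t \<in> T" shows "coord T (of_int_vec t) s = (if s = t then 1 else 0)"
  using assms unfolding coord_def facet_basis_def by (subst representation_basis) auto

lemma inj_on_of_int_vec: "inj_on of_int_vec A"
  using inj_of_int_vec by (rule inj_on_subset) auto

lemma coord_expand:
  assumes "facet_basis T" shows "(\<Sum>s\<in>T. coord T x s *\<^sub>R of_int_vec s) = x"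
proof -
  have "(\<Sum>b\<in>of_int_vec ` T. representation (of_int_vec ` T) x b *\<^sub>R b) = x"
    using assms finite_facet_basis[OF assms]
    by (intro sum_representation_eq) (auto simp: facet_basis_def)
  thus ?thesis by (simp add: sum.reindex[OF inj_on_of_int_vec] coord_def)
qed

lemma wallI:
  assumes "U \<subseteq> S" "span (of_int_vec ` U) \<noteq> (UNIV :: (real ^ 'n) set)" "x \<in> span (of_int_vec ` U)"
  shows "x \<in> walls"
  unfolding walls_def by (rule UnionI[OF _ assms(3)]) (use assms in blast)

text \<open>Such an \<open>x\<close> lies in the span of \<open>T - {s}\<close>, a proper subspace
  by independence.\<close>

lemma coord_eq_0_imp_wall:
  assumes T: "facet_basis T" and s: "s \<in> T" and 0: "coord T x s = 0" shows "x \<in> walls"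
proof -
  let ?U = "T - {s}"
  have "x = (\<Sum>s\<in>?U. coord T x s *\<^sub>R of_int_vec s)"
    using coord_expand[OF T, of x] 0 s finite_facet_basis[OF T] by (simp add: sum.remove)
  hence "x \<in> span (of_int_vec ` ?U)"
    by (metis (no_types, lifting) image_eqI span_base span_scale span_sum)
  moreover have "of_int_vec s \<notin> span (of_int_vec ` ?U :: (real ^ 'n) set)"
  proof -
    have "of_int_vec ` ?U = of_int_vec ` T - {of_int_vec s :: real ^ 'n}" by auto
    thus ?thesis using T s by (auto simp: facet_basis_def dependent_def)
  qed
  ultimately show ?thesis using T by (intro wallI[of ?U]) (auto simp: facet_basis_def)
qed

lemma zero_mem_walls: "0 \<in> walls"
proof -
  have "span (of_int_vec ` {}) \<noteq> (UNIV :: (real ^ 'n) set)"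
    using UNIV_not_singleton[of "0 :: real ^ 'n"] by (simp add: eq_commute[of UNIV])
  moreover have "0 \<in> span (of_int_vec ` {} :: (real ^ 'n) set)" by (rule span_zero)
  ultimately show ?thesis by (intro wallI[of "{}"]) auto
qed

lemma scale_mem_walls: "x \<in> walls \<Longrightarrow> c *\<^sub>R x \<in> walls"
  unfolding walls_def using span_scale by blast

lemma walls_finite_union:
  "finite {span (of_int_vec ` U) | U. U \<subseteq> S \<and> span (of_int_vec ` U) \<noteq> (UNIV :: (real ^ 'n) set)}"
  by (rule finite_subset[of _ "(\<lambda>U. span (of_int_vec ` U)) ` Pow S"]) (auto simp: finite_S)

lemma closed_walls: "closed walls"
  unfolding walls_def using walls_finite_union by (intro closed_Union) (auto intro: closed_span)

lemma negligible_walls: "negligible walls"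
  unfolding walls_def using walls_finite_union
proof (intro negligible_Union)
  fix A assume "A \<in> {span (of_int_vec ` U) | U. U \<subseteq> S \<and> span (of_int_vec ` U) \<noteq> (UNIV :: (real ^ 'n) set)}"
  hence "A \<noteq> UNIV" "span A = A" by (auto simp: span_span)
  hence "dim A < DIM(real ^ 'n)"
    using dim_eq_full[of A] dim_subset_UNIV[of A] by (metis order_le_less)
  thus "negligible A" by (rule negligible_lowdim)
qed

text \<open>The boundary point \<open>y\<close> on the ray of \<open>x\<close> lies in a face cut
  out by a supporting functional, and Caratheodory's theorem in this face writes it with at most
  \<open>CARD('n)\<close> generators. As \<open>x\<close> is off the walls these must span, so they
  form a basis; a vanishing coordinate would again put \<open>x\<close> on a wall.\<close>

lemma chambers_nonempty: assumes x: "x \<notin> walls" shows "chambers x \<noteq> {}"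
proof -
  have x0: "x \<noteq> 0" using x zero_mem_walls by auto
  define t where "t = p x"
  have t: "t > 0" using x0 by (simp add: t_def)
  define y where "y = (1 / t) *\<^sub>R x"
  have xy: "x = t *\<^sub>R y" using t by (simp add: y_def)
  have y_frontier: "y \<in> frontier Q" using x0 by (simp add: y_def t_def frontier_eq gauge_radial)
  have yQ: "y \<in> Q" using y_frontier closed by (simp add: frontier_def)
  have rel: "rel_interior Q = interior Q"
    using zero_interior_hull by (intro rel_interior_nonempty_interior) auto
  have "y \<notin> rel_interior Q" using y_frontier rel by (simp add: frontier_def)
  then obtain b where b: "\<And>z. z \<in> Q \<Longrightarrow> b \<bullet> y \<le> b \<bullet> z" "\<And>z. z \<in> interior Q \<Longrightarrow> b \<bullet> y < b \<bullet> z"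
    using supporting_hyperplane_rel_boundary[OF convex_hull_Q yQ] rel by metis
  have bneg: "b \<bullet> y < 0" using b(2)[OF zero_interior_hull] by simp
  \<comment> \<open>The functional \<open>b\<close> is minimal on \<open>Q\<close> at
    \<open>y\<close> and negative there. Dividing by that value reverses the inequality, so
    \<open>a\<close> is at most 1 on \<open>Q\<close>, with equality at \<open>y\<close>.\<close>
  define a where "a = (1 / (b \<bullet> y)) *\<^sub>R b"
  have ay: "a \<bullet> y = 1" using bneg by (simp add: a_def)
  have a_le: "a \<bullet> z \<le> 1" if "z \<in> Q" for z
    using b(1)[OF that] bneg by (simp add: a_def field_simps)
  obtain u where u: "\<And>v. v \<in> of_int_vec ` S \<Longrightarrow> 0 \<le> u v" "sum u (of_int_vec ` S) = 1"
      "(\<Sum>v\<in>of_int_vec ` S. u v *\<^sub>R v) = y"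
    using yQ unfolding hull_of_def using finite_S by (subst (asm) convex_hull_finite) auto
  define F where "F = {v \<in> of_int_vec ` S. a \<bullet> v = 1}"
  \<comment> \<open>Complementary slackness: the nonnegative numbers
    \<open>u v * (1 - a \<bullet> v)\<close> sum to \<open>1 - a \<bullet> y = 0\<close>.\<close>
  have u0: "u v = 0" if v: "v \<in> of_int_vec ` S - F" for v
  proof -
    have "(\<Sum>v\<in>of_int_vec ` S. u v * (1 - a \<bullet> v)) = sum u (of_int_vec ` S) - a \<bullet> (\<Sum>v\<in>of_int_vec ` S. u v *\<^sub>R v)"
      by (simp add: right_diff_distrib sum_subtractf inner_sum_right)
    also have "\<dots> = 0" using u ay by simp
    finally have sum0: "(\<Sum>v\<in>of_int_vec ` S. u v * (1 - a \<bullet> v)) = 0" .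
    have nonneg: "0 \<le> u v * (1 - a \<bullet> v)" if "v \<in> of_int_vec ` S" for v
      using u(1)[OF that] a_le generator_mem_hull that by auto
    have "u v * (1 - a \<bullet> v) = 0"
      using sum0 nonneg finite_S v by (subst (asm) sum_nonneg_eq_0_iff) auto
    thus ?thesis using v by (auto simp: F_def)
  qed
  have FS: "F \<subseteq> of_int_vec ` S" by (auto simp: F_def)
  have finF: "finite F" using FS finite_S finite_subset by blast
  have "y \<in> convex hull F"
  proof -
    have "sum u F = 1" "(\<Sum>v\<in>F. u v *\<^sub>R v) = y"
      using u(2,3) u0 FS finite_S by (auto intro!: sum.mono_neutral_cong_left)
         (simp add: sum.mono_neutral_right[of "of_int_vec ` S" F])+
    thus ?thesis using u(1) FS finF by (subst convex_hull_finite) (auto intro!: exI[of _ u])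
  qed
  then obtain B where B: "finite B" "B \<subseteq> F" "int (card B) \<le> aff_dim F + 1" "y \<in> convex hull B"
    unfolding caratheodory_aff_dim[of F] by auto
  \<comment> \<open>The face lies in a hyperplane, which saves one in the Caratheodory bound and
    leaves no more points than a basis has.\<close>
  have "aff_dim F \<le> int CARD('n) - 1"
  proof -
    have "a \<noteq> 0" using ay by auto
    have "aff_dim F \<le> aff_dim {v. a \<bullet> v = 1}" by (rule aff_dim_subset) (auto simp: F_def)
    also have "\<dots> = int CARD('n) - 1" using \<open>a \<noteq> 0\<close> by (simp add: aff_dim_hyperplane)
    finally show ?thesis .
  qed
  hence cardB: "card B \<le> CARD('n)" using B(3) by linarith
  define T where "T = {s \<in> S. of_int_vec s \<in> B}"
  have BT: "B = of_int_vec ` T" using B(2) FS by (auto simp: T_def)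
  have finT: "finite T" using finite_S by (simp add: T_def)
  obtain w where w: "\<And>s. s \<in> T \<Longrightarrow> 0 \<le> w s" "x = (\<Sum>s\<in>T. w s *\<^sub>R of_int_vec s)"
  proof -
    obtain w where "\<And>v. v \<in> B \<Longrightarrow> 0 \<le> w v" "(\<Sum>v\<in>B. w v *\<^sub>R v) = y"
      using B(4) B(1) by (subst (asm) convex_hull_finite) auto
    thus ?thesis using t xy
      by (intro that[of "\<lambda>s. t * w (of_int_vec s)"])
         (auto simp: BT sum.reindex[OF inj_on_of_int_vec] scaleR_sum_right)
  qed
  have "x \<in> span B"
    unfolding w(2) BT by (intro span_sum span_scale span_base) auto
  hence spanB: "span B = UNIV" using x wallI[of T] unfolding BT by (auto simp: T_def)
  have indepB: "independent B"
    using spanB B(1) cardB by (intro card_le_dim_spanning[of B UNIV]) auto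
  have aT: "a \<bullet> of_int_vec s = 1" if "s \<in> T" for s
    using that B(2) by (auto simp: T_def F_def)
  have facet: "facet_basis T"
    unfolding facet_basis_def BT[symmetric]
  proof (intro conjI exI[of _ a] ballI)
    show "T \<subseteq> S" by (auto simp: T_def)
  qed (use spanB indepB a_le generator_mem_hull aT in auto)
  have "coord T x s = w s" if "s \<in> T" for s
  proof -
    have "coord T (\<Sum>t\<in>A. w t *\<^sub>R of_int_vec t) s = (\<Sum>t\<in>A. w t * (if s = t then 1 else 0))" if "A \<subseteq> T" for A
      using finite_subset[OF that finT] that
    proof (induction A)
      case empty
      thus ?case using coord_scale[OF facet, of 0 0 s] by simp
    next
      case (insert r A)
      thus ?case by (simp add: coord_add[OF facet] coord_scale[OF facet] coord_basis[OF facet])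
    qed
    from this[OF subset_refl] show ?thesis using that finT unfolding w(2)[symmetric]
      by (simp add: if_distrib sum.delta cong: if_cong)
  qed
  moreover have "coord T x s \<noteq> 0" if "s \<in> T" for s
    using coord_eq_0_imp_wall[OF facet that] x by blast
  ultimately have "0 < coord T x s" if "s \<in> T" for s
    using w(1)[OF that] that by (metis order_le_less)
  thus ?thesis using facet unfolding chambers_def by blast
qed

text \<open>A coordinate that is positive at one point of the ball and not at another vanishes
  somewhere on the segment joining them, and that point would be on a wall.\<close>

lemma chambers_ball:
  assumes xy: "y \<in> ball x r" and disj: "ball x r \<inter> walls = {}"
  shows "chambers x = chambers y"
proof -
  have sgn: "0 < coord T v s" if T: "facet_basis T" "s \<in> T" and pos: "0 < coord T u s"
    and uv: "u \<in> ball x r" "v \<in> ball x r" for T s u v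
  proof (rule ccontr)
    assume neg: "\<not> 0 < coord T v s"
    define c where "c = coord T u s / (coord T u s - coord T v s)"
    have c: "0 \<le> c" "c \<le> 1" using pos neg by (auto simp: c_def field_simps)
    define z where "z = (1 - c) *\<^sub>R u + c *\<^sub>R v"
    have "coord T z s = (1 - c) * coord T u s + c * coord T v s"
      by (simp add: z_def coord_add[OF T(1)] coord_scale[OF T(1)])
    also have "\<dots> = 0" using pos neg by (simp add: c_def field_simps)
    finally have "z \<in> walls" by (rule coord_eq_0_imp_wall[OF T])
    moreover have "z \<in> ball x r"
      unfolding z_def using c uv by (intro convexD[OF convex_ball]) auto
    ultimately show False using disj by blast
  qed
  have "x \<in> ball x r" using xy zero_le_dist[of x y] unfolding mem_ball dist_self by linarith
  show ?thesis
  proof (intro set_eqI iffI)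
    fix T assume "T \<in> chambers x"
    thus "T \<in> chambers y" using sgn[of T _ x y] xy \<open>x \<in> ball x r\<close> by (simp add: chambers_def)
  next
    fix T assume "T \<in> chambers y"
    thus "T \<in> chambers x" using sgn[of T _ y x] xy \<open>x \<in> ball x r\<close> by (simp add: chambers_def)
  qed
qed

text \<open>Removing the \<open>s\<close> component of \<open>x\<close> moves it onto a wall. Thus
  far from the walls every positive coordinate is large.\<close>

lemma coord_ge_infdist:
  assumes T: "facet_basis T" "s \<in> T" and pos: "0 < coord T x s"
  shows "infdist x walls \<le> coord T x s * norm (of_int_vec s :: real ^ 'n)"
proof -
  define z where "z = x + (- coord T x s) *\<^sub>R of_int_vec s"
  have "coord T z s = 0"
    using T by (simp add: z_def coord_add coord_scale coord_basis del: scaleR_minus_left)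
  hence "z \<in> walls" by (rule coord_eq_0_imp_wall[OF T])
  hence "infdist x walls \<le> dist x z" by (rule infdist_le)
  also have "dist x z = coord T x s * norm (of_int_vec s :: real ^ 'n)"
    using pos by (simp add: z_def dist_norm)
  finally show ?thesis .
qed

text \<open>On each coset of the lattice spanned by T, the defect \<open>wl w - a \<bullet> w\<close> is nonnegative and takes values
  in a translate of the integers, so it attains a minimum. Adding elements of T does not increase
  the defect, so it is constant from the minimiser on.\<close>
lemma word_length_deep:
  assumes T: "facet_basis T"
  shows "\<exists>K. \<forall>x. (\<forall>s\<in>T. K \<le> coord T (of_int_vec x) s) \<longrightarrow> (\<forall>s\<in>T. wl (x + s) = wl x + 1)"
proof -
  obtain a :: "real ^ 'n" where a: "\<And>s. s \<in> S \<Longrightarrow> a \<bullet> of_int_vec s \<le> 1" "\<And>s. s \<in> T \<Longrightarrow> a \<bullet> of_int_vec s = 1"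
    and TS: "T \<subseteq> S" using T unfolding facet_basis_def by blast
  note finT = finite_facet_basis[OF T]
  define comb where "comb c = (\<Sum>s\<in>T. c s *s s)" for c :: "int ^ 'n \<Rightarrow> int"
  have wl_ge: "a \<bullet> of_int_vec w \<le> real (wl w)" for w
  proof -
    have "a \<bullet> of_int_vec (sum_list ws) \<le> real (length ws)" if "set ws \<subseteq> S" for ws
      using that
    proof (induction ws)
      case (Cons s ws)
      thus ?case using a(1)[of s] by (simp add: of_int_vec_add inner_add_right)
    qed simp
    thus ?thesis using word_length_attained[of w] by metis
  qed
  have a_comb: "a \<bullet> of_int_vec (comb c) = of_int (sum c T)" for c
    by (simp add: comb_def of_int_vec_sum of_int_vec_scale inner_sum_right a(2))
  have "\<exists>c. \<forall>c'. int (wl (r + comb c)) - sum c T \<le> int (wl (r + comb c')) - sum c' T" for r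
  proof -
    define e where "e c = nat (int (wl (r + comb c)) - sum c T - \<lfloor>a \<bullet> of_int_vec r\<rfloor>)" for c
    have e: "int (e c) = int (wl (r + comb c)) - sum c T - \<lfloor>a \<bullet> of_int_vec r\<rfloor>" for c
    proof -
      have "of_int \<lfloor>a \<bullet> of_int_vec r\<rfloor> + of_int (sum c T) \<le> real (wl (r + comb c))"
        using wl_ge[of "r + comb c"] by (simp add: of_int_vec_add inner_add_right a_comb) linarith
      hence "\<lfloor>a \<bullet> of_int_vec r\<rfloor> + sum c T \<le> int (wl (r + comb c))" by linarith
      thus ?thesis by (simp add: e_def)
    qed
    obtain c where "\<And>c'. e c \<le> e c'"
      using ex_has_least_nat[of "\<lambda>_. True" undefined e] by blast
    hence "int (e c) \<le> int (e c')" for c' by simp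
    thus ?thesis unfolding e by (intro exI[of _ c]) (metis add_le_cancel_right diff_add_cancel diff_right_mono diff_add_cancel)
  qed
  then obtain m where m: "\<And>r c'. int (wl (r + comb (m r))) - sum (m r) T \<le> int (wl (r + comb c')) - sum c' T"
    by metis
  \<comment> \<open>Modulo the lattice spanned by \<open>T\<close>, each point has a representative
    with coordinates in \<open>[0, 1)\<close>, of norm at most \<open>R\<close>. These are finitely
    many, so one \<open>K\<close> exceeds all coordinates of the chosen minimisers.\<close>
  define R where "R = (\<Sum>s\<in>T. norm (of_int_vec s :: real ^ 'n))"
  define D where "D = {r :: int ^ 'n. norm (of_int_vec r) \<le> R}"
  have finD: "finite D" unfolding D_def by (rule finite_lattice_bounded)
  define K where "K = 1 + (\<Sum>r\<in>D. \<Sum>s\<in>T. \<bar>m r s\<bar>)"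
  have K: "m r s \<le> K - 1" if "r \<in> D" "s \<in> T" for r s
  proof -
    have "m r s \<le> (\<Sum>s\<in>T. \<bar>m r s\<bar>)"
      using member_le_sum[of s T "\<lambda>s. \<bar>m r s\<bar>"] that finT by simp
    also have "\<dots> \<le> (\<Sum>r\<in>D. \<Sum>s\<in>T. \<bar>m r s\<bar>)"
      using member_le_sum[of r D "\<lambda>r. \<Sum>s\<in>T. \<bar>m r s\<bar>"] that finD by (simp add: sum_nonneg)
    finally show ?thesis by (simp add: K_def)
  qed
  have comb_diff: "comb c = comb c' + comb (\<lambda>s. c s - c' s)" for c c'
    by (simp add: comb_def sum.distrib[symmetric] vector_sadd_rdistrib[symmetric])
  have min: "int (wl (r + comb q)) - sum q T = int (wl (r + comb (m r))) - sum (m r) T"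
    if "\<And>s. s \<in> T \<Longrightarrow> m r s \<le> q s" for r q
  proof (rule antisym[OF _ m])
    let ?n = "\<lambda>s. nat (q s - m r s)"
    have "comb (\<lambda>s. q s - m r s) = (\<Sum>s\<in>T. int (?n s) *s s)"
      unfolding comb_def by (intro sum.cong) (auto simp: that)
    hence "wl (comb (\<lambda>s. q s - m r s)) \<le> sum ?n T" using word_length_sum[OF TS] by metis
    moreover have "int (sum ?n T) = sum q T - sum (m r) T"
      using that by (simp add: sum_subtractf[symmetric])
    moreover have "wl (r + comb q) \<le> wl (r + comb (m r)) + wl (comb (\<lambda>s. q s - m r s))"
      using word_length_add[of "r + comb (m r)" "comb (\<lambda>s. q s - m r s)"] comb_diff[of q "m r"]
      by (simp add: add.assoc)
    ultimately show "int (wl (r + comb q)) - sum q T \<le> int (wl (r + comb (m r))) - sum (m r) T" by linarith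
  qed
  have "wl (x + t) = wl x + 1" if x: "\<And>s. s \<in> T \<Longrightarrow> of_int K \<le> coord T (of_int_vec x) s" and t: "t \<in> T" for x t
  proof -
    define q where "q s = \<lfloor>coord T (of_int_vec x) s\<rfloor>" for s
    define r where "r = x - comb q"
    have "of_int_vec r = (\<Sum>s\<in>T. frac (coord T (of_int_vec x) s) *\<^sub>R of_int_vec s)"
      using coord_expand[OF T, of "of_int_vec x"]
      by (simp add: r_def comb_def of_int_vec_diff of_int_vec_sum of_int_vec_scale q_def frac_def
          scaleR_diff_left sum_subtractf)
    also have "norm \<dots> \<le> R"
      unfolding R_def
    proof (rule sum_norm_le)
      fix s
      show "norm (frac (coord T (of_int_vec x) s) *\<^sub>R of_int_vec s) \<le> norm (of_int_vec s :: real ^ 'n)"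
        using mult_right_mono[of "frac (coord T (of_int_vec x) s)" 1 "norm (of_int_vec s :: real ^ 'n)"]
          frac_lt_1[of "coord T (of_int_vec x) s"] frac_ge_0[of "coord T (of_int_vec x) s"] by simp
    qed
    finally have rD: "r \<in> D" by (simp add: D_def)
    have q: "m r s \<le> q s" if "s \<in> T" for s
      using K[OF rD that] x[OF that] unfolding q_def by linarith
    define q' where "q' s = (if s = t then q s + 1 else q s)" for s
    have "q' s - q s = (if s = t then 1 else 0)" for s by (simp add: q'_def)
    hence "comb (\<lambda>s. q' s - q s) = (\<Sum>s\<in>T. if s = t then s else 0)"
      unfolding comb_def by (intro sum.cong) auto
    hence "comb q' = comb q + t"
      using comb_diff[of q' q] t finT by simp
    moreover have "sum q' T = sum q T + 1"
    proof -
      have "q' s = q s + (if s = t then 1 else 0)" for s by (simp add: q'_def)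
      thus ?thesis using t finT by (simp add: sum.distrib)
    qed
    moreover have "m r s \<le> q' s" if "s \<in> T" for s using q[OF that] by (auto simp: q'_def)
    moreover have "x = r + comb q" by (simp add: r_def)
    ultimately show ?thesis using min[of r q] min[of r q'] q by (simp add: add.assoc)
  qed
  thus ?thesis by blast
qed

text \<open>The map adds one generator, selected as a function of the set \<open>chambers x\<close>
  alone. If two images agree, the points differ by at most \<open>2 * A < C\<close>, hence lie in
  one ball that avoids the walls, have the same chambers and receive the same generator. This gives
  injectivity.\<close>

lemma sphere_shift:
  "\<exists>C>0. \<exists>\<Phi>. inj_on \<Phi> {x. C \<le> infdist (of_int_vec x) walls} \<and>
    (\<forall>x. C \<le> infdist (of_int_vec x) walls \<longrightarrow> wl (\<Phi> x) = wl x + 1 \<and> \<Phi> x - x \<in> S)"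
proof -
  have fin: "finite {T. facet_basis T}"
    by (rule finite_subset[of _ "Pow S"]) (auto simp: facet_basis_def finite_S)
  obtain K where K: "\<And>T x s. facet_basis T \<Longrightarrow> (\<And>s. s \<in> T \<Longrightarrow> K T \<le> coord T (of_int_vec x) s) \<Longrightarrow>
      s \<in> T \<Longrightarrow> wl (x + s) = wl x + 1"
    using word_length_deep by metis
  define A where "A = (\<Sum>s\<in>S. norm (of_int_vec s :: real ^ 'n))"
  have A: "norm (of_int_vec s :: real ^ 'n) \<le> A" if "s \<in> S" for s
    unfolding A_def using finite_S that by (intro member_le_sum) auto
  have A0: "0 \<le> A" by (simp add: A_def sum_nonneg)
  define M where "M = (\<Sum>T | facet_basis T. \<bar>K T\<bar>)"
  have M: "K T \<le> M" if "facet_basis T" for T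
    using member_le_sum[of T "{T. facet_basis T}" "\<lambda>T. \<bar>K T\<bar>"] fin that by (simp add: M_def)
  have M0: "0 \<le> M" by (simp add: M_def sum_nonneg)
  \<comment> \<open>The term \<open>2 * A\<close> serves injectivity; \<open>M * A\<close> makes the
    coordinates exceed \<open>M\<close>, a depth sufficient in \<open>word_length_deep\<close> for
    every facet basis.\<close>
  define C where "C = 2 * A + M * A + 1"
  have C: "0 < C" "2 * A < C" "M * A < C" using A0 M0 by (auto simp: C_def add_nonneg_pos)
  define step where "step \<A> = (SOME s. \<exists>T\<in>\<A>. s \<in> T)" for \<A> :: "(int ^ 'n) set set"
  define \<Phi> where "\<Phi> x = x + step (chambers (of_int_vec x))" for x
  have off_walls: "ball (of_int_vec x) C \<inter> walls = {}" if "C \<le> infdist (of_int_vec x) walls" for x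
    using infdist_le[of _ walls "of_int_vec x"] that by force
  have step: "\<exists>T\<in>chambers (of_int_vec x). step (chambers (of_int_vec x)) \<in> T"
    if x: "C \<le> infdist (of_int_vec x) walls" for x
  proof -
    have "of_int_vec x \<notin> walls" using off_walls[OF x] C(1) by force
    then obtain T where T: "T \<in> chambers (of_int_vec x)" using chambers_nonempty by blast
    have "facet_basis T" using T unfolding chambers_def by blast
    hence sp: "span (of_int_vec ` T) = (UNIV :: (real ^ 'n) set)" unfolding facet_basis_def by blast
    have "T \<noteq> {}"
    proof
      assume "T = {}"
      hence "(UNIV :: (real ^ 'n) set) = {0}" unfolding sp[symmetric] by (simp only: image_empty span_empty)
      thus False using UNIV_not_singleton[of "0 :: real ^ 'n"] by contradiction
    qed
    hence "\<exists>s. \<exists>T\<in>chambers (of_int_vec x). s \<in> T" using T by blast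
    from someI_ex[OF this] show ?thesis unfolding step_def .
  qed
  have good: "wl (\<Phi> x) = wl x + 1" "\<Phi> x - x \<in> S" if x: "C \<le> infdist (of_int_vec x) walls" for x
  proof -
    obtain T where T: "T \<in> chambers (of_int_vec x)" "step (chambers (of_int_vec x)) \<in> T"
      using step[OF x] by blast
    have facet: "facet_basis T" and TS: "T \<subseteq> S" using T by (auto simp: chambers_def facet_basis_def)
    have "K T \<le> coord T (of_int_vec x) s" if s: "s \<in> T" for s
    proof -
      have pos: "0 < coord T (of_int_vec x) s" using T s by (auto simp: chambers_def)
      have "M * A < coord T (of_int_vec x) s * norm (of_int_vec s :: real ^ 'n)"
        using coord_ge_infdist[OF facet s pos] x C by linarith
      also have "\<dots> \<le> coord T (of_int_vec x) s * A"
        using A TS s pos by (intro mult_left_mono) auto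
      finally have "M < coord T (of_int_vec x) s" using A0 by (simp add: mult_less_cancel_right)
      thus ?thesis using M[OF facet] by linarith
    qed
    thus "wl (\<Phi> x) = wl x + 1" unfolding \<Phi>_def by (intro K[OF facet]) (use T in auto)
    show "\<Phi> x - x \<in> S" using T TS by (auto simp: \<Phi>_def)
  qed
  moreover have "inj_on \<Phi> {x. C \<le> infdist (of_int_vec x) walls}"
  proof (rule inj_onI)
    fix x y assume "x \<in> {x. C \<le> infdist (of_int_vec x) walls}" "y \<in> {x. C \<le> infdist (of_int_vec x) walls}"
      and eq: "\<Phi> x = \<Phi> y"
    hence x: "C \<le> infdist (of_int_vec x) walls" and y: "C \<le> infdist (of_int_vec y) walls" by auto
    have "(of_int_vec x :: real ^ 'n) - of_int_vec y = of_int_vec (\<Phi> y - y) - of_int_vec (\<Phi> x - x)"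
      by (simp add: of_int_vec_diff eq)
    also have "norm \<dots> \<le> A + A"
      by (rule order_trans[OF norm_triangle_ineq4 add_mono]) (auto intro!: A good x y)
    finally have "of_int_vec y \<in> ball (of_int_vec x :: real ^ 'n) C" using C by (simp add: dist_norm)
    from chambers_ball[OF this off_walls[OF x]] show "x = y" using eq by (simp add: \<Phi>_def)
  qed
  ultimately show ?thesis using C(1) by blast
qed

end

subsection \<open>Sums over word spheres\<close>

text \<open>The error \<open>\<Gamma>\<close> does not depend on the window length M, hence is negligible after dividing by M.\<close>
lemma tauberian_windows:
  fixes s w :: "nat \<Rightarrow> real"
  assumes pos: "\<forall>\<^sub>F n in sequentially. 0 < w n"
    and ratio: "(\<lambda>n. w (Suc n) / w n) \<longlonglongrightarrow> 1"
    and step: "\<And>\<epsilon>. 0 < \<epsilon> \<Longrightarrow> \<forall>\<^sub>F n in sequentially. s n - \<epsilon> * w n \<le> s (Suc n)"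
    and window: "\<And>M. N \<le> M \<Longrightarrow>
      \<forall>\<^sub>F n in sequentially. \<bar>(\<Sum>j<M. s (n + j)) - real M * c * w n\<bar> \<le> \<Gamma> * w n"
  shows "(\<lambda>n. s n / w n) \<longlonglongrightarrow> c"
proof -
  have shifted: "\<forall>\<^sub>F n in sequentially. P (n + j)" if "\<forall>\<^sub>F n in sequentially. P n" for P j
    using that by (simp add: eventually_sequentially_seg)
  have ratio_add: "(\<lambda>n. w (n + j) / w n) \<longlonglongrightarrow> 1" for j
  proof (induction j)
    case 0
    show ?case
      by (rule Lim_transform_eventually[OF tendsto_const]) (use pos in eventually_elim, simp)
  next
    case (Suc j)
    have "(\<lambda>n. w (Suc (n + j)) / w (n + j) * (w (n + j) / w n)) \<longlonglongrightarrow> 1 * 1"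
      by (intro tendsto_mult Suc LIMSEQ_ignore_initial_segment[OF ratio])
    moreover have "\<forall>\<^sub>F n in sequentially.
        w (Suc (n + j)) / w (n + j) * (w (n + j) / w n) = w (n + Suc j) / w n"
      using shifted[OF pos, of j] by eventually_elim simp
    ultimately show ?case by (simp add: Lim_transform_eventually)
  qed
  have double: "\<forall>\<^sub>F n in sequentially. w (n + j) \<le> 2 * w n" for j
  proof -
    have "\<forall>\<^sub>F n in sequentially. w (n + j) / w n < 2"
      by (rule order_tendstoD(2)[OF ratio_add]) simp
    thus ?thesis using pos by eventually_elim (simp add: divide_less_eq)
  qed
  have shift: "\<forall>\<^sub>F n in sequentially. s n - \<epsilon> * w n \<le> s (n + j)" if "0 < \<epsilon>" for j \<epsilon>
    using that
  proof (induction j arbitrary: \<epsilon>)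
    case 0
    show ?case using pos by eventually_elim (use 0 in simp)
  next
    case (Suc j)
    have "\<forall>\<^sub>F n in sequentially. s n - \<epsilon> / 2 * w n \<le> s (n + j)"
      using Suc.IH[of "\<epsilon> / 2"] Suc.prems by simp
    moreover have "\<forall>\<^sub>F n in sequentially. s (n + j) - \<epsilon> / 4 * w (n + j) \<le> s (Suc (n + j))"
      by (rule shifted[OF step]) (use Suc.prems in simp)
    ultimately show ?case using double[of j]
    proof eventually_elim
      case (elim n)
      have "\<epsilon> / 4 * w (n + j) \<le> \<epsilon> / 4 * (2 * w n)"
        using elim(3) Suc.prems by (intro mult_left_mono) auto
      thus ?case using elim(1,2) by simp
    qed
  qed
  show ?thesis
  proof (rule order_tendstoI)
    \<comment> \<open>Up to a small error \<open>s n\<close> is below each of the \<open>M\<close>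
      terms of the window, thus below their mean. The choice of \<open>M\<close> makes
      \<open>\<Gamma> / M\<close> less than \<open>e / 2\<close>.\<close>
    fix u assume "c < u"
    define e where "e = u - c"
    have e: "0 < e" using \<open>c < u\<close> by (simp add: e_def)
    obtain M where M: "2 * \<bar>\<Gamma>\<bar> / e + real N + 1 < real M" using reals_Archimedean2 by blast
    have "0 \<le> 2 * \<bar>\<Gamma>\<bar> / e" using e by simp
    hence M': "N \<le> M" "0 < real M" "2 * \<bar>\<Gamma>\<bar> / e < real M" using M by linarith+
    have \<Gamma>: "2 * \<Gamma> < real M * e" using M'(3) e by (simp add: divide_less_eq)
    have ev: "\<forall>\<^sub>F n in sequentially. \<forall>j\<in>{..<M}. s n - e / 2 * w n \<le> s (n + j)"
      using shift[of "e / 2"] e by (intro eventually_ball_finite) auto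
    show "\<forall>\<^sub>F n in sequentially. s n / w n < u" using ev window[OF M'(1)] pos
    proof eventually_elim
      case (elim n)
      have "real M * (s n - e / 2 * w n) \<le> (\<Sum>j<M. s (n + j))"
        using sum_mono[of "{..<M}" "\<lambda>_. s n - e / 2 * w n" "\<lambda>j. s (n + j)"] elim(1) by simp
      also have "\<dots> \<le> (real M * c + \<Gamma>) * w n" using elim(2) by (simp add: algebra_simps abs_le_iff)
      finally have "real M * s n \<le> (real M * c + \<Gamma> + real M * e / 2) * w n" by (simp add: algebra_simps)
      also have "\<dots> < (real M * c + real M * e) * w n"
        using \<Gamma> elim(3) by (intro mult_strict_right_mono) auto
      finally have "s n < (c + e) * w n" using M'(2)
        by (simp add: distrib_left[symmetric] mult.assoc)
      thus ?case using elim(3) by (simp add: e_def divide_less_eq)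
    qed
  next
    \<comment> \<open>Here the term \<open>s (n + M)\<close> just after the window nearly dominates
      all terms in it. The estimate is therefore obtained at \<open>n + M\<close> and shifted back
      at the end.\<close>
    fix u assume "u < c"
    define e where "e = c - u"
    have e: "0 < e" using \<open>u < c\<close> by (simp add: e_def)
    obtain M where M: "4 * \<bar>\<Gamma>\<bar> / e + real N + 1 < real M" using reals_Archimedean2 by blast
    have "0 \<le> 4 * \<bar>\<Gamma>\<bar> / e" using e by simp
    hence M': "N \<le> M" "0 < real M" "4 * \<bar>\<Gamma>\<bar> / e < real M" using M by linarith+
    have \<Gamma>: "4 * \<bar>\<Gamma>\<bar> < real M * e" using M'(3) e by (simp add: divide_less_eq)
    have to_end: "\<forall>\<^sub>F n in sequentially. s (n + j) - e / 8 * w (n + j) \<le> s (n + j + (M - j))" for j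
      by (rule shifted[OF shift]) (use e in simp)
    have 1: "\<forall>\<^sub>F n in sequentially. \<forall>j\<in>{..<M}. s (n + j) - e / 8 * w (n + j) \<le> s (n + j + (M - j))"
      by (intro eventually_ball_finite ballI to_end finite_lessThan)
    have 2: "\<forall>\<^sub>F n in sequentially. \<forall>j\<in>{..<M}. w (n + j) \<le> 2 * w n"
      using double by (intro eventually_ball_finite) auto
    have "(\<lambda>n. (c - e / 2) * inverse (w (n + M) / w n)) \<longlonglongrightarrow> (c - e / 2) * inverse 1"
      by (intro tendsto_intros ratio_add) simp
    hence 3: "\<forall>\<^sub>F n in sequentially. u < (c - e / 2) * inverse (w (n + M) / w n)"
      by (rule order_tendstoD) (use e in \<open>simp add: e_def field_simps\<close>)
    have "\<forall>\<^sub>F n in sequentially. u < s (n + M) / w (n + M)"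
      using 1 2 3 window[OF M'(1)] pos shifted[OF pos, of M]
    proof eventually_elim
      case (elim n)
      have "s (n + j) \<le> s (n + M) + e / 4 * w n" if j: "j \<in> {..<M}" for j
      proof -
        have "e / 8 * w (n + j) \<le> e / 8 * (2 * w n)"
          using elim(2) j e by (intro mult_left_mono) auto
        moreover have "n + j + (M - j) = n + M" using j by simp
        ultimately show ?thesis using bspec[OF elim(1) j] by simp
      qed
      hence "(\<Sum>j<M. s (n + j)) \<le> real M * (s (n + M) + e / 4 * w n)"
        using sum_mono[of "{..<M}" "\<lambda>j. s (n + j)" "\<lambda>_. s (n + M) + e / 4 * w n"] by simp
      moreover have "real M * c * w n - \<Gamma> * w n \<le> (\<Sum>j<M. s (n + j))"
        using elim(4) by (simp add: abs_le_iff)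
      moreover have "\<Gamma> * w n \<le> real M * (e / 4) * w n"
        using \<Gamma> elim(5) by (intro mult_right_mono) auto
      ultimately have "real M * ((c - e / 2) * w n) \<le> real M * s (n + M)"
        by (simp add: algebra_simps)
      hence "(c - e / 2) * w n \<le> s (n + M)" using M'(2) by simp
      hence "(c - e / 2) * w n / w (n + M) \<le> s (n + M) / w (n + M)"
        using elim(6) by (intro divide_right_mono) auto
      thus ?case using elim(3) by (simp add: field_simps)
    qed
    thus "\<forall>\<^sub>F n in sequentially. u < s n / w n"
      using eventually_sequentially_seg[of "\<lambda>n. u < s n / w n" M] by simp
  qed
qed

context lattice_generators
begin

definition sphere_sum :: "(real ^ 'n \<Rightarrow> real) \<Rightarrow> nat \<Rightarrow> real" where
  "sphere_sum h n = (\<Sum>x\<in>word_sphere S n. h (of_int_vec x))"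

text \<open>Spheres lie in gauge layers of thickness \<open>K\<close>. The point is that
  \<open>B\<close> is chosen before \<open>h\<close>: a function of small integral has small sphere
  sums, which is applied to bumps around the walls.\<close>

lemma sphere_sum_upper:
  "\<exists>B\<ge>0. \<forall>h \<epsilon>. direction_fun h \<longrightarrow> (\<forall>x. 0 \<le> h x) \<longrightarrow> 0 < \<epsilon> \<longrightarrow>
    (\<forall>\<^sub>F n in sequentially. sphere_sum h n \<le> (B * (LINT y:Q|lebesgue. h y) + \<epsilon>) * real n ^ (CARD('n) - 1))"
proof -
  obtain c where c: "0 < c" "\<And>w y. y \<in> lattice_cube w \<Longrightarrow> \<bar>p (of_int_vec w) - p y\<bar> < c"
    using lattice_cube_gauge_bound by blast
  obtain K where K: "0 \<le> K" "\<And>w. real (wl w) \<le> p (of_int_vec w) + K" using word_length_le_gauge by blast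
  have "\<forall>\<^sub>F n in sequentially. sphere_sum h n \<le>
      (real CARD('n) * (K + 2 * c) * (LINT y:Q|lebesgue. h y) + \<epsilon>) * real n ^ (CARD('n) - 1)"
    if h: "direction_fun h" "\<forall>x. 0 \<le> h x" "0 < \<epsilon>" for h \<epsilon>
  proof -
    have sub: "sphere_sum h n \<le> (\<Sum>w\<in>lattice_layer (real n + (- K)) (real n + 0). h (of_int_vec w))" for n
      unfolding sphere_sum_def
    proof (rule sum_mono2[OF finite_lattice_layer])
      show "word_sphere S n \<subseteq> lattice_layer (real n + (- K)) (real n + 0)"
      proof
        fix w assume "w \<in> word_sphere S n"
        hence "wl w = n" by (simp add: word_sphere_def)
        thus "w \<in> lattice_layer (real n + (- K)) (real n + 0)"
          using K(2)[of w] gauge_le_word_length[of w] by auto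
      qed
    qed (use h in auto)
    have "\<forall>\<^sub>F n in sequentially. (\<Sum>w\<in>lattice_layer (real n + (- K)) (real n + 0). h (of_int_vec w)) \<le>
        (real CARD('n) * (0 - (- K) + 2 * c) * (LINT y:Q|lebesgue. h y) + \<epsilon>) * real n ^ (CARD('n) - 1)"
      using h K(1) by (intro layer_sum_upper[OF c(2)]) auto
    thus ?thesis by eventually_elim (use order_trans[OF sub] in simp)
  qed
  thus ?thesis using K c by (intro exI[of _ "real CARD('n) * (K + 2 * c)"]) auto
qed

section \<open>Scarcity of sphere points near the walls\<close>

lemma infdist_walls_scale: assumes t: "0 < t" shows "infdist (t *\<^sub>R x) walls = t * infdist x walls"
proof (rule antisym)
  have le: "infdist (t *\<^sub>R x) walls \<le> t * infdist x walls" if t: "0 < t" for t x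
  proof -
    obtain y where y: "y \<in> walls" "infdist x walls = dist x y"
      using infdist_attains_inf[OF closed_walls] zero_mem_walls by blast
    have "infdist (t *\<^sub>R x) walls \<le> dist (t *\<^sub>R x) (t *\<^sub>R y)"
      by (rule infdist_le[OF scale_mem_walls[OF y(1)]])
    thus ?thesis using t y(2) by (simp add: dist_norm scaleR_diff_right[symmetric])
  qed
  show "infdist (t *\<^sub>R x) walls \<le> t * infdist x walls" by (rule le[OF t])
  show "t * infdist x walls \<le> infdist (t *\<^sub>R x) walls"
    using le[of "1 / t" "t *\<^sub>R x"] t by (simp add: field_simps)
qed

text \<open>A continuous substitute for the indicator of a thin conical neighbourhood of the walls:
  it is 1 on the walls and, for \<open>m > 0\<close> and \<open>x \<noteq> 0\<close>, vanishes where
  \<open>infdist x walls\<close> is at least \<open>p x / m\<close>.\<close>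

definition wall_bump :: "nat \<Rightarrow> real ^ 'n \<Rightarrow> real" where
  "wall_bump m x = max 0 (1 - real m * infdist x walls / p x)"

lemma direction_fun_wall_bump: "direction_fun (wall_bump m)"
  unfolding direction_fun_def wall_bump_def
proof (intro conjI allI impI)
  show "continuous_on (- {0}) (\<lambda>x. max 0 (1 - real m * infdist x walls / p x))"
    by (intro continuous_intros continuous_gauge) auto
  fix t :: real and x :: "real ^ 'n" assume "0 < t"
  thus "max 0 (1 - real m * infdist (t *\<^sub>R x) walls / p (t *\<^sub>R x)) = max 0 (1 - real m * infdist x walls / p x)"
    by (simp add: infdist_walls_scale gauge_scale)
qed

lemma wall_bump_bounds: "0 \<le> wall_bump m x" "wall_bump m x \<le> 1"
  by (auto simp: wall_bump_def infdist_nonneg)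

text \<open>The walls are closed and null, so almost every point has positive distance from them and
  is left by the bumps as \<open>m\<close> grows; dominated convergence applies on
  \<open>Q\<close>.\<close>

lemma integral_wall_bump: "(\<lambda>m. LINT y:Q|lebesgue. wall_bump m y) \<longlonglongrightarrow> 0"
proof -
  have "(\<lambda>m. LINT y|lebesgue. indicator Q y *\<^sub>R wall_bump m y) \<longlonglongrightarrow> (LINT y :: real ^ 'n|lebesgue. (0 :: real))"
  proof (rule Bochner_Integration.integral_dominated_convergence[where w = "indicator Q"])
    show "integrable lebesgue (\<lambda>y. indicator Q y :: real)"
      using Q_lmeasurable by (simp add: fmeasurable_def)
    show "(\<lambda>y. indicator Q y *\<^sub>R wall_bump m y) \<in> borel_measurable lebesgue" for m
      using direction_fun_lebesgue_measurable[OF direction_fun_wall_bump, of m] by measurable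
    show "AE y in lebesgue. norm (indicator Q y *\<^sub>R wall_bump m y) \<le> indicator Q y" for m
      using wall_bump_bounds[of m] by (auto simp: indicator_def)
    have "AE y in lebesgue. y \<notin> walls"
      using negligible_walls by (intro AE_not_in) (simp add: negligible_iff_null_sets)
    thus "AE y in lebesgue. (\<lambda>m. indicator Q y *\<^sub>R wall_bump m y) \<longlonglongrightarrow> 0"
    proof eventually_elim
      case (elim y)
      have "y \<noteq> 0" using elim zero_mem_walls by auto
      moreover have "infdist y walls \<noteq> 0"
        using elim in_closed_iff_infdist_zero[OF closed_walls] zero_mem_walls by blast
      ultimately have pos: "0 < infdist y walls / p y" using infdist_nonneg[of y walls] by simp
      obtain m0 where "1 / (infdist y walls / p y) < real m0" using reals_Archimedean2 by blast
      hence m0: "1 < real m0 * (infdist y walls / p y)" using pos by (simp only: pos_divide_less_eq)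
      have "\<forall>\<^sub>F m in sequentially. wall_bump m y = 0"
        using eventually_ge_at_top[of m0]
      proof eventually_elim
        case (elim m)
        have "real m0 * (infdist y walls / p y) \<le> real m * (infdist y walls / p y)"
          using elim pos by (intro mult_right_mono) auto
        thus ?case using m0 by (simp add: wall_bump_def)
      qed
      hence "\<forall>\<^sub>F m in sequentially. indicator Q y *\<^sub>R wall_bump m y = 0" by eventually_elim simp
      thus ?case by (rule tendsto_eventually)
    qed
  qed simp
  thus ?thesis by (simp add: set_lebesgue_integral_def)
qed

text \<open>On a sphere of large radius the fixed distance \<open>C\<close> is a small fraction of
  the gauge, so the points counted have bump value at least 1/2. Their number is at most twice a
  sphere sum, made small through the integral of the bump.\<close>

lemma card_near_walls:
  assumes \<delta>: "0 < \<delta>"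
  shows "\<forall>\<^sub>F n in sequentially. real (card {x \<in> word_sphere S n. infdist (of_int_vec x) walls < C})
    \<le> \<delta> * real n ^ (CARD('n) - 1)"
proof -
  obtain B where B: "0 \<le> B" and upper: "\<And>h \<epsilon>. direction_fun h \<Longrightarrow> (\<And>x. 0 \<le> h x) \<Longrightarrow> 0 < \<epsilon> \<Longrightarrow>
    \<forall>\<^sub>F n in sequentially. sphere_sum h n \<le> (B * (LINT y:Q|lebesgue. h y) + \<epsilon>) * real n ^ (CARD('n) - 1)"
    using sphere_sum_upper by blast
  obtain K where K: "0 \<le> K" "\<And>w. real (wl w) \<le> p (of_int_vec w) + K" using word_length_le_gauge by blast
  have "(\<lambda>m. B * (LINT y:Q|lebesgue. wall_bump m y)) \<longlonglongrightarrow> B * 0"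
    by (intro tendsto_mult tendsto_const integral_wall_bump)
  hence "\<forall>\<^sub>F m in sequentially. B * (LINT y:Q|lebesgue. wall_bump m y) < \<delta> / 4"
    by (rule order_tendstoD) (use \<delta> in simp)
  then obtain m where m: "B * (LINT y:Q|lebesgue. wall_bump m y) < \<delta> / 4"
    by (auto simp: eventually_sequentially)
  have "\<forall>\<^sub>F n in sequentially. 2 * \<bar>C\<bar> * real m + K + 1 \<le> real n"
    using filterlim_real_sequentially by (simp add: filterlim_at_top)
  moreover have "\<forall>\<^sub>F n in sequentially. sphere_sum (wall_bump m) n \<le>
      (B * (LINT y:Q|lebesgue. wall_bump m y) + \<delta> / 4) * real n ^ (CARD('n) - 1)"
    by (rule upper[OF direction_fun_wall_bump]) (use wall_bump_bounds \<delta> in auto)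
  ultimately show ?thesis
  proof eventually_elim
    case (elim n)
    let ?D = "{x \<in> word_sphere S n. infdist (of_int_vec x) walls < C}"
    have half: "1 / 2 \<le> wall_bump m (of_int_vec x)" if x: "x \<in> ?D" for x
    proof -
      have "real n \<le> p (of_int_vec x) + K" using x K(2)[of x] by (simp add: word_sphere_def)
      hence px: "2 * \<bar>C\<bar> * real m \<le> p (of_int_vec x)" "0 < p (of_int_vec x)" using elim(1)
        by (linarith, smt (verit) elim(1) mult_nonneg_nonneg abs_ge_zero of_nat_0_le_iff)
      have "real m * infdist (of_int_vec x) walls \<le> real m * \<bar>C\<bar>"
        using x by (intro mult_left_mono) auto
      hence "real m * infdist (of_int_vec x) walls \<le> p (of_int_vec x) / 2" using px(1) by (simp add: mult_ac)
      hence "real m * infdist (of_int_vec x) walls / p (of_int_vec x) \<le> 1 / 2"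
        using px(2) by (simp add: divide_le_eq)
      thus ?thesis unfolding wall_bump_def le_max_iff_disj by linarith
    qed
    have "real (card ?D) * (1 / 2) = (\<Sum>x\<in>?D. 1 / 2)" by simp
    also have "\<dots> \<le> (\<Sum>x\<in>?D. wall_bump m (of_int_vec x))" by (intro sum_mono half)
    also have "\<dots> \<le> sphere_sum (wall_bump m) n"
      unfolding sphere_sum_def
      by (intro sum_mono2 finite_word_sphere) (auto simp: wall_bump_bounds)
    also have "\<dots> \<le> (\<delta> / 2) * real n ^ (CARD('n) - 1)"
      using elim(2) by (rule order_trans) (use m in \<open>intro mult_right_mono, auto\<close>)
    finally show ?case by simp
  qed
qed

text \<open>Half of \<open>\<epsilon>\<close> pays for the points near the walls, few and each of
  value at most \<open>H\<close>; the other half pays for the change \<open>e\<close> of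
  \<open>h\<close> under \<open>\<Phi>\<close>, over at most \<open>D * n ^ (d - 1)\<close> points.
  As \<open>h\<close> is nonnegative, points of the next sphere outside the image of
  \<open>\<Phi>\<close> only help.\<close>

lemma sphere_sum_step:
  assumes h: "direction_fun h" "\<And>x. 0 \<le> h x" and \<epsilon>: "0 < \<epsilon>"
  shows "\<forall>\<^sub>F n in sequentially. sphere_sum h n - \<epsilon> * real n ^ (CARD('n) - 1) \<le> sphere_sum h (Suc n)"
proof -
  obtain B where B: "0 \<le> B" and upper: "\<And>h \<epsilon>. direction_fun h \<Longrightarrow> (\<And>x. 0 \<le> h x) \<Longrightarrow> 0 < \<epsilon> \<Longrightarrow>
    \<forall>\<^sub>F n in sequentially. sphere_sum h n \<le> (B * (LINT y:Q|lebesgue. h y) + \<epsilon>) * real n ^ (CARD('n) - 1)"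
    using sphere_sum_upper by blast
  obtain K where K: "0 \<le> K" "\<And>w. real (wl w) \<le> p (of_int_vec w) + K" using word_length_le_gauge by blast
  obtain r R' where R': "0 < r" "0 < R'" "\<And>x. p x \<le> R' * norm x" "\<And>x. norm x \<le> r * p x"
    using gauge_norm_bounds by blast
  obtain C \<Phi> where \<Phi>: "inj_on \<Phi> {x. C \<le> infdist (of_int_vec x) walls}"
    "\<And>x. C \<le> infdist (of_int_vec x) walls \<Longrightarrow> wl (\<Phi> x) = wl x + 1"
    "\<And>x. C \<le> infdist (of_int_vec x) walls \<Longrightarrow> \<Phi> x - x \<in> S"
    using sphere_shift by blast
  define A where "A = (\<Sum>s\<in>S. norm (of_int_vec s :: real ^ 'n))"
  have A: "norm (of_int_vec s :: real ^ 'n) \<le> A" if "s \<in> S" for s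
    unfolding A_def using finite_S that by (intro member_le_sum) auto
  obtain H where H: "0 < H" "\<And>x. h x \<le> H"
  proof -
    obtain B where "0 \<le> B" "\<And>x. \<bar>h x\<bar> \<le> B" using direction_fun_bounded[OF h(1)] by blast
    hence "0 < B + 1" "h x \<le> B + 1" for x using abs_le_D1[of "h x" B] by (linarith, smt (verit))
    thus ?thesis by (rule that)
  qed
  define D where "D = B * (LINT y:Q|lebesgue. 1) + 1"
  have D: "0 < D"
    using B volume_pos by (simp add: D_def set_integral_const add_nonneg_pos)
  define e where "e = \<epsilon> / (2 * D)"
  have e: "0 < e" using \<epsilon> D by (simp add: e_def)
  obtain R where R: "0 < R" "\<And>x y. R \<le> norm x \<Longrightarrow> norm (x - y) \<le> A \<Longrightarrow> \<bar>h x - h y\<bar> \<le> e"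
    using direction_fun_oscillation[OF h(1) e] by blast
  define \<delta> where "\<delta> = \<epsilon> / (2 * H)"
  have \<delta>: "0 < \<delta>" using \<epsilon> H by (simp add: \<delta>_def)
  have "\<forall>\<^sub>F n in sequentially. R' * R + K \<le> real n"
    using filterlim_real_sequentially by (simp add: filterlim_at_top)
  moreover have "\<forall>\<^sub>F n in sequentially. sphere_sum (\<lambda>_. 1) n \<le> D * real n ^ (CARD('n) - 1)"
    using upper[OF direction_fun_const, of 1 1] by (simp add: D_def)
  ultimately show ?thesis using card_near_walls[OF \<delta>, of C]
  proof eventually_elim
    case (elim n)
    let ?N = "real n ^ (CARD('n) - 1)"
    let ?bad = "{x \<in> word_sphere S n. infdist (of_int_vec x) walls < C}"
    let ?good = "{x \<in> word_sphere S n. C \<le> infdist (of_int_vec x) walls}"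
    have fin: "finite ?good" "finite ?bad" using finite_word_sphere[of n] by auto
    have card: "real (card (word_sphere S n)) \<le> D * ?N" using elim(2) by (simp add: sphere_sum_def)
    have "sphere_sum h n = (\<Sum>x\<in>?good. h (of_int_vec x)) + (\<Sum>x\<in>?bad. h (of_int_vec x))"
      unfolding sphere_sum_def using fin
      by (subst sum.union_disjoint[symmetric]) (auto intro!: sum.cong)
    moreover have "(\<Sum>x\<in>?bad. h (of_int_vec x)) \<le> \<epsilon> / 2 * ?N"
    proof -
      have "(\<Sum>x\<in>?bad. h (of_int_vec x)) \<le> (\<Sum>x\<in>?bad. H)"
        using H(2) by (intro sum_mono)
      also have "\<dots> = H * real (card ?bad)" by simp
      also have "\<dots> \<le> H * (\<delta> * ?N)" using elim(3) H(1) by (intro mult_left_mono) auto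
      also have "\<dots> = \<epsilon> / 2 * ?N" using H(1) by (simp add: \<delta>_def)
      finally show ?thesis .
    qed
    moreover have "(\<Sum>x\<in>?good. h (of_int_vec x)) \<le> (\<Sum>x\<in>?good. h (of_int_vec (\<Phi> x)) + e)"
    proof (rule sum_mono)
      fix x assume x: "x \<in> ?good"
      have "R' * R \<le> p (of_int_vec x)"
        using K(2)[of x] elim(1) x by (simp add: word_sphere_def)
      also have "\<dots> \<le> R' * norm (of_int_vec x :: real ^ 'n)" by (rule R'(3))
      finally have "R \<le> norm (of_int_vec x :: real ^ 'n)" using R'(2) by simp
      moreover have "norm (of_int_vec x - of_int_vec (\<Phi> x) :: real ^ 'n) \<le> A"
        using A[OF \<Phi>(3)[of x]] x by (simp add: of_int_vec_diff norm_minus_commute)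
      ultimately have "\<bar>h (of_int_vec x) - h (of_int_vec (\<Phi> x))\<bar> \<le> e" by (rule R(2))
      thus "h (of_int_vec x) \<le> h (of_int_vec (\<Phi> x)) + e" by linarith
    qed
    moreover have "(\<Sum>x\<in>?good. h (of_int_vec (\<Phi> x)) + e) \<le> sphere_sum h (Suc n) + \<epsilon> / 2 * ?N"
    proof -
      have inj: "inj_on \<Phi> ?good" by (rule inj_on_subset[OF \<Phi>(1)]) auto
      have "(\<Sum>x\<in>?good. h (of_int_vec (\<Phi> x))) = (\<Sum>x\<in>\<Phi> ` ?good. h (of_int_vec x))"
        by (simp add: sum.reindex[OF inj])
      also have "\<dots> \<le> sphere_sum h (Suc n)"
        unfolding sphere_sum_def
        by (intro sum_mono2 finite_word_sphere) (auto simp: h word_sphere_def \<Phi>(2))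
      finally have 1: "(\<Sum>x\<in>?good. h (of_int_vec (\<Phi> x))) \<le> sphere_sum h (Suc n)" .
      have "e * real (card ?good) \<le> e * (D * ?N)"
        using card e card_mono[OF finite_word_sphere[of n], of ?good]
        by (intro mult_left_mono) auto
      also have "\<dots> = \<epsilon> / 2 * ?N" using D by (simp add: e_def)
      finally show ?thesis using 1 by (simp add: sum.distrib mult.commute)
    qed
    ultimately show ?case by (simp add: algebra_simps)
  qed
qed

section \<open>Asymptotics of sphere sums\<close>

lemma sphere_sum_window:
  "(\<Sum>j<M. sphere_sum h (n + j)) = (\<Sum>x | n \<le> wl x \<and> wl x < n + M. h (of_int_vec x))"
proof -
  have "{x. n \<le> wl x \<and> wl x < n + M} = (\<Union>j\<in>{..<M}. word_sphere S (n + j))"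
  proof (intro set_eqI iffI)
    fix x assume "x \<in> {x. n \<le> wl x \<and> wl x < n + M}"
    thus "x \<in> (\<Union>j\<in>{..<M}. word_sphere S (n + j))"
      by (intro UN_I[of "wl x - n"]) (auto simp: word_sphere_def)
  qed (auto simp: word_sphere_def)
  thus ?thesis
    unfolding sphere_sum_def
    by (simp only:) (subst sum.UNION_disjoint, auto simp: finite_word_sphere, auto simp: word_sphere_def)
qed

lemma sphere_sum_limit_nonneg:
  assumes h: "direction_fun h" "\<And>x. 0 \<le> h x"
  shows "(\<lambda>n. sphere_sum h n / real n ^ (CARD('n) - 1)) \<longlonglongrightarrow> real CARD('n) * (LINT y:Q|lebesgue. h y)"
proof -
  let ?I = "LINT y:Q|lebesgue. h y" and ?d = "real CARD('n)"
  obtain c where c: "0 < c" "\<And>w y. y \<in> lattice_cube w \<Longrightarrow> \<bar>p (of_int_vec w) - p y\<bar> < c"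
    using lattice_cube_gauge_bound by blast
  obtain K where K: "0 \<le> K" "\<And>w. real (wl w) \<le> p (of_int_vec w) + K" using word_length_le_gauge by blast
  have I0: "0 \<le> ?I" unfolding set_lebesgue_integral_def by (intro Bochner_Integration.integral_nonneg) (auto simp: h)
  \<comment> \<open>Beyond \<open>M0\<close> the gauge layer inside a window is thicker than
    \<open>2 * c\<close>, as \<open>layer_sum_lower\<close> demands.\<close>
  obtain M0 where M0: "1 + K + 2 * c < real M0" using reals_Archimedean2 by blast
  show ?thesis
  \<comment> \<open>In \<open>\<Gamma>\<close>, the part \<open>1 + K\<close> covers the error of
    word length against gauge at the ends of the window, \<open>2 * c\<close> comes from the cubes,
    and the final 1 absorbs the error terms of the layer estimates.\<close>
  proof (rule tauberian_windows[where N = M0 and \<Gamma> = "?d * (1 + K + 2 * c) * ?I + 1"])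
    show "\<forall>\<^sub>F n in sequentially. 0 < real n ^ (CARD('n) - 1)"
      using eventually_gt_at_top[of 0] by eventually_elim simp
    have "(\<lambda>n. (1 + 1 / real n) ^ (CARD('n) - 1)) \<longlonglongrightarrow> (1 + 0) ^ (CARD('n) - 1)"
      by (intro tendsto_intros lim_1_over_n)
    moreover have "\<forall>\<^sub>F n in sequentially. (1 + 1 / real n) ^ (CARD('n) - 1) =
        real (Suc n) ^ (CARD('n) - 1) / real n ^ (CARD('n) - 1)"
      using eventually_gt_at_top[of 0]
      by eventually_elim (simp add: power_divide[symmetric] add_divide_distrib add.commute)
    ultimately show "(\<lambda>n. real (Suc n) ^ (CARD('n) - 1) / real n ^ (CARD('n) - 1)) \<longlonglongrightarrow> 1"
      by (simp add: Lim_transform_eventually)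
    show "\<forall>\<^sub>F n in sequentially. sphere_sum h n - \<epsilon> * real n ^ (CARD('n) - 1) \<le> sphere_sum h (Suc n)"
      if "0 < \<epsilon>" for \<epsilon> by (rule sphere_sum_step[OF h that])
    fix M assume M: "M0 \<le> M"
    hence M': "1 + K + 2 * c < real M" using M0 by (meson of_nat_le_iff order_less_le_trans)
    have up: "\<forall>\<^sub>F n in sequentially. (\<Sum>w\<in>lattice_layer (real n + (- K)) (real n + real M). h (of_int_vec w)) \<le>
        (?d * (real M - (- K) + 2 * c) * ?I + 1) * real n ^ (CARD('n) - 1)"
      by (rule layer_sum_upper[OF c(2) h]) (use K in auto)
    have low: "\<forall>\<^sub>F n in sequentially. (?d * ((real M - 1 - K) - 0 - 2 * c) * ?I - 1) * real n ^ (CARD('n) - 1) \<le>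
        (\<Sum>w\<in>lattice_layer (real n + 0) (real n + (real M - 1 - K)). h (of_int_vec w))"
      by (rule layer_sum_lower[OF c(2) h]) (use M' in auto)
    show "\<forall>\<^sub>F n in sequentially. \<bar>(\<Sum>j<M. sphere_sum h (n + j)) - real M * (?d * ?I) * real n ^ (CARD('n) - 1)\<bar> \<le>
        (?d * (1 + K + 2 * c) * ?I + 1) * real n ^ (CARD('n) - 1)"
      using up low
    proof eventually_elim
      case (elim n)
      let ?W = "{x. n \<le> wl x \<and> wl x < n + M}" and ?N = "real n ^ (CARD('n) - 1)"
      have finW: "finite ?W"
        by (rule finite_subset[OF _ finite_word_ball[of "n + M"]]) (auto simp: word_ball_def)
      have "?W \<subseteq> lattice_layer (real n + (- K)) (real n + real M)"
      proof
        fix x assume x: "x \<in> ?W"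
        show "x \<in> lattice_layer (real n + (- K)) (real n + real M)"
          using x K(2)[of x] gauge_le_word_length[of x] by simp
      qed
      hence "(\<Sum>x\<in>?W. h (of_int_vec x)) \<le> (\<Sum>w\<in>lattice_layer (real n + (- K)) (real n + real M). h (of_int_vec w))"
        by (intro sum_mono2 finite_lattice_layer) (auto simp: h)
      also have "\<dots> \<le> (?d * (real M + K + 2 * c) * ?I + 1) * ?N" using elim(1) by simp
      also have "\<dots> \<le> (?d * (real M + (1 + K + 2 * c)) * ?I + 1) * ?N"
        using I0 by (intro mult_right_mono add_right_mono mult_left_mono) auto
      finally have 1: "(\<Sum>x\<in>?W. h (of_int_vec x)) \<le> (?d * (real M + (1 + K + 2 * c)) * ?I + 1) * ?N" .
      have "lattice_layer (real n + 0) (real n + (real M - 1 - K)) \<subseteq> ?W"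
      proof
        fix x assume x: "x \<in> lattice_layer (real n + 0) (real n + (real M - 1 - K))"
        have "real n \<le> real (wl x)" "real (wl x) < real (n + M)"
          using x K(2)[of x] gauge_le_word_length[of x] by auto
        thus "x \<in> ?W" by simp
      qed
      hence "(\<Sum>w\<in>lattice_layer (real n + 0) (real n + (real M - 1 - K)). h (of_int_vec w)) \<le> (\<Sum>x\<in>?W. h (of_int_vec x))"
        by (intro sum_mono2 finW) (auto simp: h)
      hence 2: "(?d * (real M - (1 + K + 2 * c)) * ?I - 1) * ?N \<le> (\<Sum>x\<in>?W. h (of_int_vec x))"
        using elim(2) by (simp add: algebra_simps)
      show ?case unfolding sphere_sum_window using 1 2 by (simp add: abs_le_iff algebra_simps)
    qed
  qed
qed

lemma sphere_sum_add: "sphere_sum (\<lambda>x. g x + h x) n = sphere_sum g n + sphere_sum h n"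
  by (simp add: sphere_sum_def sum.distrib)

theorem sphere_sum_limit:
  assumes h: "direction_fun h"
  shows "(\<lambda>n. sphere_sum h n / real n ^ (CARD('n) - 1)) \<longlonglongrightarrow> real CARD('n) * (LINT y:Q|lebesgue. h y)"
proof -
  obtain H where H: "0 \<le> H" "\<And>x. \<bar>h x\<bar> \<le> H" using direction_fun_bounded[OF h] by blast
  have nonneg: "0 \<le> h x + H" for x using H(2)[of x] by linarith
  have dir: "direction_fun (\<lambda>x. h x + H)"
    using h by (auto simp: direction_fun_def intro!: continuous_intros)
  have "(\<lambda>n. sphere_sum (\<lambda>x. h x + H) n / real n ^ (CARD('n) - 1) - sphere_sum (\<lambda>_. H) n / real n ^ (CARD('n) - 1))
      \<longlonglongrightarrow> real CARD('n) * (LINT y:Q|lebesgue. h y + H) - real CARD('n) * (LINT y:Q|lebesgue. H)"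
    by (intro tendsto_diff sphere_sum_limit_nonneg dir nonneg direction_fun_const H)
  moreover have "(LINT y:Q|lebesgue. h y + H) = (LINT y:Q|lebesgue. h y) + (LINT y:Q|lebesgue. H)"
    by (intro set_integral_add direction_set_integrable h direction_fun_const Q_lmeasurable)
  ultimately show ?thesis
    by (simp add: sphere_sum_add diff_divide_distrib[symmetric] algebra_simps)
qed

end

subsection \<open>Averages\<close>

lemma real_powr_at_top:
  assumes "0 < a" shows "filterlim (\<lambda>n. real n powr a) at_top sequentially"
  unfolding filterlim_at_top
proof
  fix Z :: real
  have "\<forall>\<^sub>F n in sequentially. max 1 Z powr (1 / a) \<le> real n"
    using filterlim_real_sequentially by (simp add: filterlim_at_top)
  thus "\<forall>\<^sub>F n in sequentially. Z \<le> real n powr a"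
  proof eventually_elim
    case (elim n)
    have "(max 1 Z powr (1 / a)) powr a \<le> real n powr a"
      using elim assms by (intro powr_mono2) auto
    thus ?case using assms by (simp add: powr_powr)
  qed
qed

lemma stolz_cesaro:
  fixes x y :: "nat \<Rightarrow> real"
  assumes inc: "\<And>n. y n < y (Suc n)" and top: "filterlim y at_top sequentially"
    and lim: "(\<lambda>n. (x (Suc n) - x n) / (y (Suc n) - y n)) \<longlonglongrightarrow> L"
  shows "(\<lambda>n. x n / y n) \<longlonglongrightarrow> L"
proof (rule tendstoI)
  fix e :: real assume e: "0 < e"
  obtain N where N: "\<And>n. N \<le> n \<Longrightarrow> \<bar>(x (Suc n) - x n) / (y (Suc n) - y n) - L\<bar> < e / 2"
    using tendstoD[OF lim, of "e / 2"] e by (auto simp: eventually_sequentially dist_real_def)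
  have bound: "\<bar>(x n - L * y n) - (x N - L * y N)\<bar> \<le> e / 2 * (y n - y N)" if "N \<le> n" for n
    using that
  proof (induction n rule: dec_induct)
    case (step n)
    have "(x (Suc n) - x n) - L * (y (Suc n) - y n) =
        ((x (Suc n) - x n) / (y (Suc n) - y n) - L) * (y (Suc n) - y n)"
    proof -
      have "y (Suc n) - y n \<noteq> 0" using inc[of n] by simp
      thus ?thesis by (simp add: field_simps)
    qed
    hence "\<bar>(x (Suc n) - x n) - L * (y (Suc n) - y n)\<bar> =
        \<bar>(x (Suc n) - x n) / (y (Suc n) - y n) - L\<bar> * (y (Suc n) - y n)"
      using inc[of n] by (simp add: abs_mult)
    also have "\<dots> \<le> e / 2 * (y (Suc n) - y n)"
      using N[of n] step inc[of n] by (intro mult_right_mono) auto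
    finally show ?case using step.IH unfolding right_diff_distrib by linarith
  qed simp
  define c where "c = \<bar>x N - L * y N\<bar> + e / 2 * \<bar>y N\<bar>"
  have "\<forall>\<^sub>F n in sequentially. max 0 (2 * c / e) < y n"
    using top[unfolded filterlim_at_top_dense] by blast
  thus "\<forall>\<^sub>F n in sequentially. dist (x n / y n) L < e"
    using eventually_ge_at_top[of N]
  proof eventually_elim
    case (elim n)
    have y: "0 < y n" "c < e / 2 * y n" using elim(1) e by (auto simp: field_simps)
    have "\<bar>x n - L * y n\<bar> \<le> c + e / 2 * y n"
    proof -
      have "- (e / 2 * y N) \<le> e / 2 * \<bar>y N\<bar>"
        using e mult_left_mono[of "- y N" "\<bar>y N\<bar>" "e / 2"] by simp
      thus ?thesis using bound[OF elim(2)] unfolding c_def by (simp add: right_diff_distrib)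
    qed
    also have "\<dots> < e * y n" using y(2) by simp
    finally have "\<bar>x n - L * y n\<bar> < e * y n" .
    moreover have "x n / y n - L = (x n - L * y n) / y n" using y(1) by (simp add: field_simps)
    ultimately show ?case using y(1) by (simp add: dist_real_def abs_divide divide_less_eq)
  qed
qed

text \<open>Stolz-Cesaro against \<open>n powr (r + 1)\<close>, whose increments are asymptotic to
  \<open>(r + 1) * n powr r\<close>. With \<open>r = d - 1\<close> and \<open>r = d - 1 + k\<close>
  the factors \<open>1 / (r + 1)\<close> produce \<open>d / (d + k)\<close>.\<close>

lemma power_sum_limit:
  fixes b :: "nat \<Rightarrow> real"
  assumes r: "0 \<le> r" and lim: "(\<lambda>m. b m / real m powr r) \<longlonglongrightarrow> c"
  shows "(\<lambda>n. (\<Sum>m<n. b (Suc m)) / real n powr (r + 1)) \<longlonglongrightarrow> c / (r + 1)"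
proof (rule stolz_cesaro)
  show "real n powr (r + 1) < real (Suc n) powr (r + 1)" for n
    using r by (intro powr_less_mono2) auto
  show "filterlim (\<lambda>n. real n powr (r + 1)) at_top sequentially"
    using r by (intro real_powr_at_top) auto
  \<comment> \<open>The increments are those of \<open>s powr (r + 1)\<close> between
    \<open>s = n / (n + 1)\<close> and 1, rescaled.\<close>
  have "filterlim (\<lambda>n. 1 - 1 / real (Suc n)) (at_left 1) sequentially"
    unfolding filterlim_at
    using tendsto_diff[OF tendsto_const LIMSEQ_Suc[OF lim_1_over_n], of "1::real"]
    by (auto simp: eventually_sequentially)
  from filterlim_compose[OF tendsto_powr_quotient this, of "r + 1"]
  have "(\<lambda>n. (1 - (1 - 1 / real (Suc n)) powr (r + 1)) / (1 - (1 - 1 / real (Suc n)))) \<longlonglongrightarrow> r + 1" .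
  moreover have "(1 - (1 - 1 / real (Suc n)) powr (r + 1)) / (1 - (1 - 1 / real (Suc n))) =
      (real (Suc n) powr (r + 1) - real n powr (r + 1)) / real (Suc n) powr r" for n
  proof -
    define a X Y where "a = real (Suc n)" and "X = a powr r" and "Y = real n powr (r + 1)"
    have pos: "0 < a" "0 < X" by (auto simp: a_def X_def)
    have "1 - 1 / a = real n / a" by (simp add: a_def field_simps)
    moreover have "a powr (r + 1) = X * a" using pos by (simp add: X_def powr_add)
    moreover have "(1 - Y / (X * a)) / (1 - (1 - 1 / a)) = (X * a - Y) / X"
      using pos by (simp add: field_simps)
    ultimately have "(1 - (1 - 1 / a) powr (r + 1)) / (1 - (1 - 1 / a)) = (a powr (r + 1) - Y) / X"
      using pos by (simp add: powr_divide Y_def)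
    thus ?thesis by (simp only: a_def X_def Y_def)
  qed
  ultimately have "(\<lambda>n. (real (Suc n) powr (r + 1) - real n powr (r + 1)) / real (Suc n) powr r) \<longlonglongrightarrow> r + 1"
    by simp
  from tendsto_divide[OF LIMSEQ_Suc[OF lim] this]
  show "(\<lambda>n. ((\<Sum>m<Suc n. b (Suc m)) - (\<Sum>m<n. b (Suc m))) / (real (Suc n) powr (r + 1) - real n powr (r + 1)))
      \<longlonglongrightarrow> c / (r + 1)"
    using r by simp
qed

section \<open>From sphere averages to ball averages\<close>

context lattice_generators
begin

lemma sum_word_ball: "(\<Sum>x\<in>word_ball S n. f x) = (\<Sum>m<Suc n. \<Sum>x\<in>word_sphere S m. (f x :: real))"
proof -
  have "word_ball S n = (\<Union>m\<in>{..<Suc n}. word_sphere S m)"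
    by (auto simp: word_ball_def word_sphere_def)
  thus ?thesis
    by (simp only:) (subst sum.UNION_disjoint, auto simp: finite_word_sphere, auto simp: word_sphere_def)
qed

lemma card_word_sphere_limit:
  "(\<lambda>n. real (card (word_sphere S n)) / real n ^ (CARD('n) - 1)) \<longlonglongrightarrow> real CARD('n) * measure lebesgue Q"
  using sphere_sum_limit[OF direction_fun_const, of 1]
  by (simp add: sphere_sum_def set_integral_const)

lemma powr_dim: "0 < n \<Longrightarrow> real n powr (real CARD('n) - 1) = real n ^ (CARD('n) - 1)"
  by (simp add: powr_realpow[symmetric] of_nat_diff)

lemma card_word_ball_limit:
  "(\<lambda>n. real (card (word_ball S n)) / real n powr real CARD('n)) \<longlonglongrightarrow> measure lebesgue Q"
proof -
  let ?d = "real CARD('n)"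
  have d: "0 < ?d" by simp
  have "(\<lambda>m. real (card (word_sphere S m)) / real m powr (?d - 1)) \<longlonglongrightarrow> ?d * measure lebesgue Q"
    by (rule Lim_transform_eventually[OF card_word_sphere_limit])
       (use eventually_gt_at_top[of 0] in eventually_elim, simp add: powr_dim)
  hence "(\<lambda>n. (\<Sum>m<n. real (card (word_sphere S (Suc m)))) / real n powr (?d - 1 + 1))
      \<longlonglongrightarrow> ?d * measure lebesgue Q / (?d - 1 + 1)"
    by (intro power_sum_limit) (auto simp: Suc_le_eq)
  moreover have "(\<lambda>n. real (card (word_sphere S 0)) / real n powr ?d) \<longlonglongrightarrow> 0"
    by (intro tendsto_divide_0[OF tendsto_const] filterlim_at_top_imp_at_infinity
        real_powr_at_top d)
  ultimately have "(\<lambda>n. real (card (word_sphere S 0)) / real n powr ?d +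
      (\<Sum>m<n. real (card (word_sphere S (Suc m)))) / real n powr ?d) \<longlonglongrightarrow> 0 + measure lebesgue Q"
    by (intro tendsto_add) auto
  moreover have "real (card (word_ball S n)) = real (card (word_sphere S 0)) + (\<Sum>m<n. real (card (word_sphere S (Suc m))))" for n
    using sum_word_ball[of "\<lambda>_. 1" n] by (simp only: sum.lessThan_Suc_shift) simp
  ultimately show ?thesis by (simp add: add_divide_distrib)
qed

text \<open>Undoing the averages, the sphere sums of \<open>f\<close> divided by
  \<open>n powr (d - 1 + k)\<close> tend to \<open>d * V * l\<close>, where \<open>V\<close> is the
  volume of \<open>Q\<close>. Then \<open>power_sum_limit\<close> adds them up, and the ball
  cardinality, asymptotic to \<open>V * n powr d\<close>, is divided out.\<close>

theorem ball_average_limit: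
  assumes k: "0 \<le> k" and lim: "scaled_average k f (word_sphere S) \<longlonglongrightarrow> l"
  shows "scaled_average k f (word_ball S) \<longlonglongrightarrow> real CARD('n) / (real CARD('n) + k) * l"
proof -
  let ?d = "real CARD('n)" and ?V = "measure lebesgue Q"
  have d: "1 \<le> ?d" by (simp add: Suc_le_eq)
  define b where "b m = (\<Sum>x\<in>word_sphere S m. f x)" for m
  have avg: "b m = real (card (word_sphere S m)) * real m powr k * scaled_average k f (word_sphere S) m"
    if "0 < m" for m
  proof (cases "card (word_sphere S m) = 0")
    case True
    hence "word_sphere S m = {}" using finite_word_sphere by simp
    thus ?thesis by (simp add: b_def)
  next
    case False
    thus ?thesis using that
      by (simp add: scaled_average_def b_def sum_distrib_left[symmetric] sum_divide_distrib[symmetric])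
  qed
  have "(\<lambda>m. real (card (word_sphere S m)) / real m ^ (CARD('n) - 1) * scaled_average k f (word_sphere S) m)
      \<longlonglongrightarrow> ?d * ?V * l"
    by (intro tendsto_mult card_word_sphere_limit lim)
  hence "(\<lambda>m. b m / real m powr (?d - 1 + k)) \<longlonglongrightarrow> ?d * ?V * l"
    by (rule Lim_transform_eventually)
       (use eventually_gt_at_top[of 0] in eventually_elim, simp add: avg powr_add powr_dim)
  hence "(\<lambda>n. (\<Sum>m<n. b (Suc m)) / real n powr (?d - 1 + k + 1)) \<longlonglongrightarrow> ?d * ?V * l / (?d - 1 + k + 1)"
    using d k by (intro power_sum_limit) auto
  \<comment> \<open>Radius 0 is kept apart because \<open>real 0 powr k\<close> is 0, so that
    \<open>avg\<close> covers only positive radii. Its single term vanishes in the limit.\<close>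
  moreover have "(\<lambda>n. b 0 / real n powr (?d + k)) \<longlonglongrightarrow> 0"
    using d k by (intro tendsto_divide_0[OF tendsto_const] filterlim_at_top_imp_at_infinity
        real_powr_at_top) (auto intro: add_pos_nonneg)
  ultimately have "(\<lambda>n. b 0 / real n powr (?d + k) + (\<Sum>m<n. b (Suc m)) / real n powr (?d + k))
      \<longlonglongrightarrow> 0 + ?d * ?V * l / (?d + k)"
    by (intro tendsto_add) (auto simp: algebra_simps)
  hence quot: "(\<lambda>n. (b 0 / real n powr (?d + k) + (\<Sum>m<n. b (Suc m)) / real n powr (?d + k)) /
      (real (card (word_ball S n)) / real n powr ?d)) \<longlonglongrightarrow> (0 + ?d * ?V * l / (?d + k)) / ?V"
    using volume_pos by (intro tendsto_divide card_word_ball_limit) auto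
  have val: "(0 + ?d * ?V * l / (?d + k)) / ?V = ?d / (?d + k) * l"
    using volume_pos by simp
  have ev: "\<forall>\<^sub>F n in sequentially. (b 0 / real n powr (?d + k) + (\<Sum>m<n. b (Suc m)) / real n powr (?d + k)) /
      (real (card (word_ball S n)) / real n powr ?d) = scaled_average k f (word_ball S) n"
    using eventually_gt_at_top[of 0]
  proof eventually_elim
    case (elim n)
    have sum: "(\<Sum>x\<in>word_ball S n. f x) = b 0 + (\<Sum>m<n. b (Suc m))"
      unfolding sum_word_ball b_def[symmetric] by (rule sum.lessThan_Suc_shift)
    have avg: "scaled_average k f (word_ball S) n =
        1 / real (card (word_ball S n)) * (1 / real n powr k * (b 0 + (\<Sum>m<n. b (Suc m))))"
      by (simp only: scaled_average_def sum_distrib_left[symmetric] sum)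
    show ?case
      unfolding avg add_divide_distrib[symmetric] powr_add using elim by simp
  qed
  show ?thesis using Lim_transform_eventually[OF quot ev] unfolding val .
qed

section \<open>Sphere averages of asymptotically homogeneous functions\<close>

lemma direction_fun_radial:
  assumes "continuous_on (- {0}) g" shows "direction_fun (\<lambda>x. g (radial x))"
  unfolding direction_fun_def
proof (intro conjI allI impI)
  have "continuous_on (- {0}) radial"
    unfolding radial_def by (intro continuous_intros continuous_gauge) auto
  moreover have "radial ` (- {0}) \<subseteq> - {0}" by (auto simp: radial_def)
  ultimately show "continuous_on (- {0}) (\<lambda>x. g (radial x))"
    using continuous_on_compose2[OF assms] by blast
qed (simp add: radial_scale)

lemma sphere_coeff_eq:
  assumes g: "continuous_on (- {0}) g"
  shows "sphere_coeff g S = 1 / measure lebesgue Q * (LINT x:Q|lebesgue. g (radial x))"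
proof -
  have "(\<lambda>x. g (radial x)) \<in> borel_measurable M0"
    by (intro measurable_restrict_space1 direction_fun_lebesgue_measurable direction_fun_radial g)
  hence "g \<in> borel_measurable N" by (simp add: borel_measurable_N_iff)
  moreover have "(LINT x|M0. g (radial x)) = (LINT x:Q|lebesgue. g (radial x))"
    unfolding set_lebesgue_integral_def
    by (subst integral_restrict_space) (auto intro!: integral_cong_except_point[of 0] simp: indicator_def)
  ultimately show ?thesis by (simp add: sphere_coeff_def integral_cone_measure)
qed

text \<open>The error is put in multiplied form because \<open>g\<close> may vanish at lattice
  points. The finitely many exceptional points have bounded word length, so large spheres avoid
  them.\<close>

lemma asymptotic_sphere_bound:
  assumes "asymptotic_to f g" and e: "0 < e"
  shows "\<forall>\<^sub>F n in sequentially. \<forall>x\<in>word_sphere S n. \<bar>f x - g (of_int_vec x)\<bar> \<le> e * \<bar>g (of_int_vec x)\<bar>"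
proof -
  \<comment> \<open>Where \<open>g\<close> vanishes and \<open>f\<close> does not, the quotient is 0
    by convention, at distance 1 from 1; the cap 1/2 excludes this.\<close>
  let ?e = "min e (1/2)"
  have "\<forall>\<^sub>F x in cofinite. dist (if f x = 0 \<and> g (of_int_vec x) = 0 then 1 else f x / g (of_int_vec x)) 1 < ?e"
    using assms unfolding asymptotic_to_def by (intro tendstoD asymp_equivD) auto
  hence "\<forall>\<^sub>F x in cofinite. \<bar>f x - g (of_int_vec x)\<bar> \<le> e * \<bar>g (of_int_vec x)\<bar>"
  proof eventually_elim
    case (elim x)
    show ?case
    proof (cases "g (of_int_vec x) = 0")
      case True
      thus ?thesis using elim by (auto simp: dist_real_def split: if_splits)
    next
      case False
      hence "\<bar>f x / g (of_int_vec x) - 1\<bar> \<le> e" using elim by (auto simp: dist_real_def)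
      hence "\<bar>f x / g (of_int_vec x) - 1\<bar> * \<bar>g (of_int_vec x)\<bar> \<le> e * \<bar>g (of_int_vec x)\<bar>"
        by (intro mult_right_mono) auto
      thus ?thesis using False by (simp add: abs_mult[symmetric] left_diff_distrib)
    qed
  qed
  then obtain E where E: "finite E" "\<And>x. x \<notin> E \<Longrightarrow> \<bar>f x - g (of_int_vec x)\<bar> \<le> e * \<bar>g (of_int_vec x)\<bar>"
    unfolding eventually_cofinite by blast
  have "\<forall>\<^sub>F n in sequentially. n > (\<Sum>x\<in>E. wl x)" by (rule eventually_gt_at_top)
  thus ?thesis
  proof eventually_elim
    case (elim n)
    show ?case
    proof
      fix x assume "x \<in> word_sphere S n"
      hence "wl x = n" by (simp add: word_sphere_def)
      hence "x \<notin> E" using member_le_sum[of x E wl] E(1) elim by auto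
      thus "\<bar>f x - g (of_int_vec x)\<bar> \<le> e * \<bar>g (of_int_vec x)\<bar>" by (rule E(2))
    qed
  qed
qed

text \<open>By homogeneity \<open>g x\<close> is \<open>p x powr k * g (radial x)\<close>, and on
  the sphere \<open>p x / n\<close> lies between \<open>1 - K / n\<close> and 1. Division by
  \<open>n powr k\<close> thus leaves the direction part up to a uniform error.\<close>

lemma scaled_sphere_bound:
  assumes g: "homogeneous k g" "continuous_on (- {0}) g" and k: "0 \<le> k" and f: "asymptotic_to f g"
    and \<epsilon>: "0 < \<epsilon>"
  shows "\<forall>\<^sub>F n in sequentially. \<forall>x\<in>word_sphere S n. \<bar>1 / real n powr k * f x - g (radial (of_int_vec x))\<bar> \<le> \<epsilon>"
proof -
  obtain K where K: "0 \<le> K" "\<And>w. real (wl w) \<le> p (of_int_vec w) + K" using word_length_le_gauge by blast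
  obtain H where H: "0 \<le> H" "\<And>x. \<bar>g (radial x)\<bar> \<le> H"
    using direction_fun_bounded[OF direction_fun_radial[OF g(2)]] by blast
  \<comment> \<open>Two errors of size at most \<open>e * H\<close> arise, from \<open>f\<close>
    against \<open>g\<close> and from gauge against word length; \<open>H + 1\<close> avoids a zero
    denominator.\<close>
  define e where "e = \<epsilon> / (2 * (H + 1))"
  have e: "0 < e" "e * H \<le> \<epsilon> / 2" using \<epsilon> H(1) by (auto simp: e_def field_simps)
  have "(\<lambda>n. (1 - K / real n) powr k) \<longlonglongrightarrow> (1 - 0) powr k"
    by (intro tendsto_intros tendsto_divide_0[OF tendsto_const] filterlim_at_top_imp_at_infinity
        filterlim_real_sequentially) simp
  hence "\<forall>\<^sub>F n in sequentially. 1 - e < (1 - K / real n) powr k"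
    by (rule order_tendstoD) (use e in simp)
  moreover have "\<forall>\<^sub>F n in sequentially. K + 1 \<le> real n"
    using filterlim_real_sequentially by (simp add: filterlim_at_top)
  ultimately show ?thesis using asymptotic_sphere_bound[OF f e(1)]
  proof eventually_elim
    case (elim n)
    show ?case
    proof
      fix x assume x: "x \<in> word_sphere S n"
      let ?h = "g (radial (of_int_vec x))"
      have n: "0 < real n" using elim(2) K(1) by linarith
      have px: "real n - K \<le> p (of_int_vec x)" "p (of_int_vec x) \<le> real n"
        using x K(2)[of x] gauge_le_word_length[of x] by (auto simp: word_sphere_def)
      define q where "q = (p (of_int_vec x) / real n) powr k"
      have q: "1 - e \<le> q" "0 \<le> q" "q \<le> 1"
      proof -
        have "1 - K / real n = (real n - K) / real n" using n by (simp add: diff_divide_distrib)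
        hence "1 - K / real n \<le> p (of_int_vec x) / real n" "0 \<le> 1 - K / real n"
          using px(1) n elim(2) divide_right_mono[OF px(1), of "real n"] by auto
        hence "(1 - K / real n) powr k \<le> q" unfolding q_def using k by (intro powr_mono2) auto
        thus "1 - e \<le> q" using elim(1) by simp
        show "0 \<le> q" by (simp add: q_def)
        have "p (of_int_vec x) / real n \<le> 1" using px(2) n by simp
        thus "q \<le> 1" unfolding q_def using k n powr_mono2[of k "p (of_int_vec x) / real n" 1] by simp
      qed
      have "of_int_vec x \<noteq> (0 :: real ^ 'n)" using px(1) elim(2) by auto
      hence gx: "1 / real n powr k * g (of_int_vec x) = q * ?h"
        using homogeneous_radial[OF g(1), of "of_int_vec x"] n by (simp add: q_def powr_divide)
      have "1 / real n powr k * \<bar>f x - g (of_int_vec x)\<bar> \<le> 1 / real n powr k * (e * \<bar>g (of_int_vec x)\<bar>)"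
        using elim(3) x by (intro mult_left_mono) auto
      also have "\<dots> = e * \<bar>1 / real n powr k * g (of_int_vec x)\<bar>" by (simp add: abs_mult)
      also have "\<dots> = e * (q * \<bar>?h\<bar>)" using q(2) by (simp only: gx abs_mult abs_of_nonneg)
      also have "\<dots> \<le> e * (1 * H)" using e q H by (intro mult_left_mono mult_mono) auto
      finally have fg: "1 / real n powr k * \<bar>f x - g (of_int_vec x)\<bar> \<le> e * H" by simp
      have 1: "\<bar>1 / real n powr k * f x - q * ?h\<bar> \<le> e * H"
      proof -
        have "1 / real n powr k * f x - q * ?h = 1 / real n powr k * (f x - g (of_int_vec x))"
          by (simp only: gx[symmetric] right_diff_distrib)
        hence "\<bar>1 / real n powr k * f x - q * ?h\<bar> = 1 / real n powr k * \<bar>f x - g (of_int_vec x)\<bar>"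
          by (simp only: abs_mult) simp
        thus ?thesis using fg by linarith
      qed
      have "\<bar>q * ?h - ?h\<bar> = (1 - q) * \<bar>?h\<bar>"
        using q(3) abs_mult[of "q - 1" ?h] by (simp add: left_diff_distrib)
      also have "\<dots> \<le> e * H" using q H by (intro mult_mono) auto
      finally show "\<bar>1 / real n powr k * f x - ?h\<bar> \<le> \<epsilon>" using 1 e(2) by linarith
    qed
  qed
qed

theorem sphere_average_limit:
  assumes g: "homogeneous k g" "continuous_on (- {0}) g" and k: "0 \<le> k" and f: "asymptotic_to f g"
  shows "scaled_average k f (word_sphere S) \<longlonglongrightarrow> sphere_coeff g S"
proof -
  let ?d = "real CARD('n)" and ?h = "\<lambda>x. g (radial x)" and ?N = "\<lambda>n. real n ^ (CARD('n) - 1)"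
  have "(\<lambda>n. sphere_sum ?h n / ?N n / (real (card (word_sphere S n)) / ?N n)) \<longlonglongrightarrow>
      ?d * (LINT y:Q|lebesgue. ?h y) / (?d * measure lebesgue Q)"
    using volume_pos
    by (intro tendsto_divide sphere_sum_limit card_word_sphere_limit direction_fun_radial g(2)) simp
  also have "?d * (LINT y:Q|lebesgue. ?h y) / (?d * measure lebesgue Q) = sphere_coeff g S"
    by (simp add: sphere_coeff_eq[OF g(2)])
  finally have "(\<lambda>n. sphere_sum ?h n / real (card (word_sphere S n))) \<longlonglongrightarrow> sphere_coeff g S"
    by (rule Lim_transform_eventually) (use eventually_gt_at_top[of 0] in eventually_elim, simp)
  moreover have "(\<lambda>n. scaled_average k f (word_sphere S) n - sphere_sum ?h n / real (card (word_sphere S n))) \<longlonglongrightarrow> 0"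
  proof (rule tendstoI)
    fix \<epsilon> :: real assume \<epsilon>: "0 < \<epsilon>"
    have "\<forall>\<^sub>F n in sequentially. \<forall>x\<in>word_sphere S n. \<bar>1 / real n powr k * f x - g (radial (of_int_vec x))\<bar> \<le> \<epsilon> / 2"
      by (rule scaled_sphere_bound[OF g k f]) (use \<epsilon> in simp)
    thus "\<forall>\<^sub>F n in sequentially. dist (scaled_average k f (word_sphere S) n -
        sphere_sum ?h n / real (card (word_sphere S n))) 0 < \<epsilon>"
    proof eventually_elim
      case (elim n)
      let ?A = "word_sphere S n"
      have "\<bar>\<Sum>x\<in>?A. 1 / real n powr k * f x - ?h (of_int_vec x)\<bar> \<le> (\<Sum>x\<in>?A. \<epsilon> / 2)"
        by (rule order_trans[OF sum_abs sum_mono]) (use elim in blast)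
      hence le: "\<bar>(\<Sum>x\<in>?A. 1 / real n powr k * f x) - sphere_sum ?h n\<bar> \<le> \<epsilon> / 2 * real (card ?A)"
        by (simp add: sphere_sum_def sum_subtractf mult.commute)
      have "\<bar>(\<Sum>x\<in>?A. 1 / real n powr k * f x) - sphere_sum ?h n\<bar> / real (card ?A) \<le> \<epsilon> / 2"
      proof (cases "card ?A = 0")
        case False
        hence "0 < real (card ?A)" by simp
        thus ?thesis using le by (simp only: pos_divide_le_eq)
      qed (use \<epsilon> in simp)
      also have "\<dots> < \<epsilon>" using \<epsilon> by simp
      finally show ?case
        by (simp add: scaled_average_def dist_real_def diff_divide_distrib[symmetric] abs_divide)
    qed
  qed
  ultimately have "(\<lambda>n. sphere_sum ?h n / real (card (word_sphere S n)) +
      (scaled_average k f (word_sphere S) n - sphere_sum ?h n / real (card (word_sphere S n)))) \<longlonglongrightarrow> sphere_coeff g S + 0"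
    by (rule tendsto_add)
  thus ?thesis by simp
qed

end

text \<open>The two limits are linked by an implication, since for general \<open>g\<close> the
  sphere averages need not converge; for \<open>g\<close> continuous off the origin they do, and the
  coefficients are the limits. Without continuity the integrals may miss the lattice directions: for
  \<open>d \<ge> 2\<close> and \<open>k = 0\<close>, let \<open>g\<close> be 1 on the rays through
  lattice points and 0 elsewhere. With \<open>f = 1\<close> both averages tend to 1, yet both
  coefficients are 0.\<close>

theorem theorem1p3:
  fixes S :: "(int ^ 'n) set"
    and f :: "int ^ 'n \<Rightarrow> real"
    and g :: "real ^ 'n \<Rightarrow> real"
    and k :: real
  assumes "finite S"
    and "symmetric_generating_set S"
    and "k \<ge> 0"
    and "homogeneous k g"
    and "asymptotic_to f g"
  shows
    "(\<forall>l. scaled_average k f (word_sphere S) \<longlonglongrightarrow> l \<longrightarrow>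
          scaled_average k f (word_ball S) \<longlonglongrightarrow> real CARD('n) / (real CARD('n) + k) * l)
     \<and> (continuous_on (- {0}) g \<longrightarrow>
          scaled_average k f (word_sphere S) \<longlonglongrightarrow> sphere_coeff g S \<and>
          scaled_average k f (word_ball S) \<longlonglongrightarrow> ball_coeff g S)
     \<and> ball_coeff g S = real CARD('n) / (real CARD('n) + k) * sphere_coeff g S"
proof -
  interpret lattice_generators S by unfold_locales fact+
  have coeff: "ball_coeff g S = real CARD('n) / (real CARD('n) + k) * sphere_coeff g S"
    unfolding ball_coeff_def sphere_coeff_def by (rule integral_homogeneous) fact+
  show ?thesis
  proof (intro conjI allI impI)
    show "scaled_average k f (word_ball S) \<longlonglongrightarrow> real CARD('n) / (real CARD('n) + k) * l"
      if "scaled_average k f (word_sphere S) \<longlonglongrightarrow> l" for l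
      using assms(3) that by (rule ball_average_limit)
    assume g: "continuous_on (- {0}) g"
    show sphere: "scaled_average k f (word_sphere S) \<longlonglongrightarrow> sphere_coeff g S"
      by (rule sphere_average_limit) fact+
    show "scaled_average k f (word_ball S) \<longlonglongrightarrow> ball_coeff g S"
      unfolding coeff using assms(3) sphere by (rule ball_average_limit)
  qed (rule coeff)
qed

end
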